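(* Let $G$ be a connected graph. Then the perfectly matchable subgraph polytope $\mathcal{P}_G$ is compressed if and only if all blocks of $G$ are complete bipartite graphs except for at most one block, which is either $K_4$ or $K_{1,1,n}$ (for some $n$).
   Context: All graphs are finite and simple. For a graph $G$ on vertex set $V=\{1,\dots,n\}$, let $\mathscr{W}(G)$ be the set of all $S\subset V$ such that the induced subgraph $G[S]$ has a perfect matching (a matching covering all of $S$), with the convention $\emptyset\in\mathscr{W}(G)$. For $S\subset V$ put $\rho(S)=\sum_{i\in S}\mathbf{e}_i\in\mathbb{R}^n$ ($\mathbf{e}_i$ the unit vectors). The perfectly matchable subgraph polytope $\mathcal{P}_G\subset\mathbb{R}^n$ is the convex hull of $\{\rho(S): S\in\mathscr{W}(G)\}$. For a lattice polytope $\mathscr{P}\subset\mathbb{R}^n$ (convex polytope with vertices in $\mathbb{Z}^n$) with $\mathscr{P}\cap\mathbb{Z}^n=\{\mathbf{a}_1,\dots,\mathbf{a}_m\}$ and a field $K$, the toric ring $K[\mathscr{P}]$ is the $K$-subalgebra of $K[x_1^{\pm1},\dots,x_n^{\pm1},s]$ generated by $\mathbf{x}^{\mathbf{a}_1}s,\dots,\mathbf{x}^{\mathbf{a}_m}s$, and the toric ideal $I_{\mathscr{P}}$ is the kernel of the surjection $K[y_1,\dots,y_m]\to K[\mathscr{P}]$, $y_i\mapsto \mathbf{x}^{\mathbf{a}_i}s$. The polytope $\mathscr{P}$ is compressed if the initial ideal of $I_{\mathscr{P}}$ is generated by squarefree monomials with respect to any reverse lexicographic order (for every ordering of the variables). A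 cut vertex of a connected graph is a vertex whose removal leaves a disconnected graph. A block of $G$ is a maximal connected subgraph of $G$ without cut vertices (of itself). $K_{p_1,\dots,p_k}$ denotes the complete $k$-partite graph with parts of sizes $p_1,\dots,p_k$, and $K_n$ the complete graph on $n$ vertices. *)

theory Defs
  imports
    "HOL-Analysis.Analysis"
    "HOL-Library.Poly_Mapping"
    "HOL-Algebra.Ideal"
begin

section \<open>Simple graphs\<close>

record 'v sgraph =
  verts :: "'v set"
  edges :: "'v set set"

definition simple_graph :: "'v sgraph \<Rightarrow> bool" where
  "simple_graph H \<longleftrightarrow>
     finite (verts H) \<and> (\<forall>e\<in>edges H. e \<subseteq> verts H \<and> card e = 2)"

definition subgraph_of :: "'v sgraph \<Rightarrow> 'v sgraph \<Rightarrow> bool" where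
  "subgraph_of H G \<longleftrightarrow>
     simple_graph H \<and> verts H \<subseteq> verts G \<and> edges H \<subseteq> edges G"

definition induced :: "'v sgraph \<Rightarrow> 'v set \<Rightarrow> 'v sgraph" where
  "induced G S = \<lparr>verts = S, edges = {e \<in> edges G. e \<subseteq> S}\<rparr>"

definition joined :: "'v sgraph \<Rightarrow> 'v \<Rightarrow> 'v \<Rightarrow> bool" where
  "joined H u v \<longleftrightarrow> (u, v) \<in> {(x, y). {x, y} \<in> edges H}\<^sup>*"

definition disconnected_graph :: "'v sgraph \<Rightarrow> bool" where
  "disconnected_graph H \<longleftrightarrow> (\<exists>u\<in>verts H. \<exists>v\<in>verts H. \<not> joined H u v)"

text \<open>The empty graph is neither connected nor disconnected; in particular the vertex
  of a one-vertex graph is not a cut vertex.\<close>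

definition connected_graph :: "'v sgraph \<Rightarrow> bool" where
  "connected_graph H \<longleftrightarrow> verts H \<noteq> {} \<and> \<not> disconnected_graph H"

definition cut_vertex :: "'v sgraph \<Rightarrow> 'v \<Rightarrow> bool" where
  "cut_vertex H v \<longleftrightarrow>
     v \<in> verts H \<and> disconnected_graph (induced H (verts H - {v}))"

definition conn_without_cut_vertex :: "'v sgraph \<Rightarrow> bool" where
  "conn_without_cut_vertex H \<longleftrightarrow> connected_graph H \<and> (\<forall>v. \<not> cut_vertex H v)"

definition blocks :: "'v sgraph \<Rightarrow> 'v sgraph set" where
  "blocks G = {B. subgraph_of B G \<and> conn_without_cut_vertex B \<and>
     (\<forall>B'. subgraph_of B' G \<and> conn_without_cut_vertex B' \<and> subgraph_of B B' \<longrightarrow> B' = B)}"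

definition is_complete :: "nat \<Rightarrow> 'v sgraph \<Rightarrow> bool" where
  "is_complete n H \<longleftrightarrow> finite (verts H) \<and> card (verts H) = n \<and>
     edges H = {e. e \<subseteq> verts H \<and> card e = 2}"

text \<open>\<open>H\<close> is a \<open>K\<^sub>p\<^sub>s\<close> for a list \<open>ps\<close> of part sizes, \<open>Vs\<close> being the list of the parts.\<close>

definition is_complete_multipartite :: "nat list \<Rightarrow> 'v sgraph \<Rightarrow> bool" where
  "is_complete_multipartite ps H \<longleftrightarrow>
     (\<exists>Vs. map card Vs = ps \<and> (\<forall>V\<in>set Vs. finite V) \<and>
        (\<forall>i<length Vs. \<forall>j<length Vs. i \<noteq> j \<longrightarrow> Vs ! i \<inter> Vs ! j = {}) \<and>
        verts H = \<Union> (set Vs) \<and>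
        edges H = {{u, v} | u v i j. i < length Vs \<and> j < length Vs \<and> i \<noteq> j \<and>
                     u \<in> Vs ! i \<and> v \<in> Vs ! j})"

text \<open>An empty part is admitted, so that the one-vertex graph, which is its own only block,
  is the complete bipartite graph \<open>K\<^sub>1\<^sub>,\<^sub>0\<close>. For connected graphs with at least two vertices
  both parts are automatically nonempty.\<close>

definition complete_bipartite :: "'v sgraph \<Rightarrow> bool" where
  "complete_bipartite H \<longleftrightarrow> (\<exists>p q. is_complete_multipartite [p, q] H)"

section \<open>Perfectly matchable subgraph polytopes\<close>

definition perfect_matching :: "'v sgraph \<Rightarrow> 'v set set \<Rightarrow> bool" where
  "perfect_matching H M \<longleftrightarrow>
     M \<subseteq> edges H \<and> (\<forall>e\<in>M. \<forall>f\<in>M. e \<noteq> f \<longrightarrow> e \<inter> f = {}) \<and> \<Union> M = verts H"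

definition matchable_sets :: "'v sgraph \<Rightarrow> 'v set set" where
  "matchable_sets G = {S. S \<subseteq> verts G \<and> (\<exists>M. perfect_matching (induced G S) M)}"

definition rho :: "'n::finite set \<Rightarrow> real^'n" where
  "rho S = (\<Sum>i\<in>S. axis i 1)"

definition pms_polytope :: "'n::finite sgraph \<Rightarrow> (real^'n) set" where
  "pms_polytope G = convex hull (rho ` matchable_sets G)"

section \<open>Polynomials and initial ideals\<close>

text \<open>Polynomials over \<open>'k\<close> in variables indexed by \<open>'a\<close> have type
  \<open>('a \<Rightarrow>\<^sub>0 nat) \<Rightarrow>\<^sub>0 'k\<close>; \<open>mpoly_ring A\<close> is the polynomial ring in the variables from \<open>A\<close>.\<close>

definition monoms_in :: "'a set \<Rightarrow> ('a \<Rightarrow>\<^sub>0 nat) set" where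
  "monoms_in A = {m. Poly_Mapping.keys m \<subseteq> A}"

definition mpoly_ring :: "'a set \<Rightarrow> (('a \<Rightarrow>\<^sub>0 nat) \<Rightarrow>\<^sub>0 'k::field) ring" where
  "mpoly_ring A = \<lparr>carrier = {p. Poly_Mapping.keys p \<subseteq> monoms_in A},
     mult = (*), one = 1, zero = 0, add = (+)\<rparr>"

definition monomial :: "('a \<Rightarrow>\<^sub>0 nat) \<Rightarrow> (('a \<Rightarrow>\<^sub>0 nat) \<Rightarrow>\<^sub>0 'k::field)" where
  "monomial m = Poly_Mapping.single m 1"

definition squarefree_monom :: "('a \<Rightarrow>\<^sub>0 nat) \<Rightarrow> bool" where
  "squarefree_monom m \<longleftrightarrow> (\<forall>a. Poly_Mapping.lookup m a \<le> 1)"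

definition total_deg :: "('a \<Rightarrow>\<^sub>0 nat) \<Rightarrow> nat" where
  "total_deg m = (\<Sum>a\<in>Poly_Mapping.keys m. Poly_Mapping.lookup m a)"

text \<open>The (graded) reverse lexicographic order for which the variables, listed in \<open>ys\<close>,
  decrease: at equal degree, the smaller monomial is the one with the larger exponent at the
  last variable where the two differ.\<close>

definition revlex_less :: "'a list \<Rightarrow> ('a \<Rightarrow>\<^sub>0 nat) \<Rightarrow> ('a \<Rightarrow>\<^sub>0 nat) \<Rightarrow> bool" where
  "revlex_less ys u v \<longleftrightarrow> total_deg u < total_deg v \<or>
     (total_deg u = total_deg v \<and>
       (\<exists>i<length ys. Poly_Mapping.lookup u (ys ! i) > Poly_Mapping.lookup v (ys ! i) \<and>
          (\<forall>j<length ys. i < j \<longrightarrow>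
             Poly_Mapping.lookup u (ys ! j) = Poly_Mapping.lookup v (ys ! j))))"

definition is_lead_monom ::
    "(('a \<Rightarrow>\<^sub>0 nat) \<Rightarrow> ('a \<Rightarrow>\<^sub>0 nat) \<Rightarrow> bool) \<Rightarrow> (('a \<Rightarrow>\<^sub>0 nat) \<Rightarrow>\<^sub>0 'k::field) \<Rightarrow>
     ('a \<Rightarrow>\<^sub>0 nat) \<Rightarrow> bool" where
  "is_lead_monom lt p m \<longleftrightarrow> m \<in> Poly_Mapping.keys p \<and>
     (\<forall>m'\<in>Poly_Mapping.keys p. m' \<noteq> m \<longrightarrow> lt m' m)"

definition initial_ideal ::
    "'a set \<Rightarrow> (('a \<Rightarrow>\<^sub>0 nat) \<Rightarrow> ('a \<Rightarrow>\<^sub>0 nat) \<Rightarrow> bool) \<Rightarrow>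
     (('a \<Rightarrow>\<^sub>0 nat) \<Rightarrow>\<^sub>0 'k::field) set \<Rightarrow> (('a \<Rightarrow>\<^sub>0 nat) \<Rightarrow>\<^sub>0 'k) set" where
  "initial_ideal A lt I =
     genideal (mpoly_ring A) {monomial m | m p. p \<in> I \<and> is_lead_monom lt p m}"

definition squarefree_generated :: "'a set \<Rightarrow> (('a \<Rightarrow>\<^sub>0 nat) \<Rightarrow>\<^sub>0 'k::field) set \<Rightarrow> bool" where
  "squarefree_generated A J \<longleftrightarrow>
     (\<exists>M. M \<subseteq> monoms_in A \<and> (\<forall>m\<in>M. squarefree_monom m) \<and>
          J = genideal (mpoly_ring A) (monomial ` M))"

section \<open>Toric ideals and compressed polytopes\<close>

definition vec_of_int :: "int^'n::finite \<Rightarrow> real^'n" where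
  "vec_of_int a = (\<chi> i. of_int (a $ i))"

definition lattice_points :: "(real^'n::finite) set \<Rightarrow> (int^'n) set" where
  "lattice_points P = {a. vec_of_int a \<in> P}"

definition lattice_polytope :: "(real^'n::finite) set \<Rightarrow> bool" where
  "lattice_polytope P \<longleftrightarrow>
     polytope P \<and> (\<forall>v. v extreme_point_of P \<longrightarrow> v \<in> range vec_of_int)"

text \<open>The ring \<open>K[x\<^sub>1\<^sup>\<plusminus>\<^sup>1, \<dots>, x\<^sub>n\<^sup>\<plusminus>\<^sup>1, s]\<close> is the monoid algebra of \<open>\<int>\<^sup>n \<times> \<nat>\<close>.
  The substitution \<open>y\<^sub>a \<mapsto> x\<^sup>a s\<close> is written out on a polynomial as the sum of its terms.\<close>

definition toric_hom ::
    "((int^'n::finite \<Rightarrow>\<^sub>0 nat) \<Rightarrow>\<^sub>0 'k::field) \<Rightarrow> ((int^'n) \<times> nat \<Rightarrow>\<^sub>0 'k)" where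
  "toric_hom p = (\<Sum>m\<in>Poly_Mapping.keys p. Poly_Mapping.single 0 (Poly_Mapping.lookup p m) *
     (\<Prod>a\<in>Poly_Mapping.keys m. Poly_Mapping.single (a, 1) 1 ^ Poly_Mapping.lookup m a))"

definition toric_ideal ::
    "(real^'n::finite) set \<Rightarrow> ((int^'n \<Rightarrow>\<^sub>0 nat) \<Rightarrow>\<^sub>0 'k::field) set" where
  "toric_ideal P = {p \<in> carrier (mpoly_ring (lattice_points P)). toric_hom p = 0}"

definition compressed :: "'k::field itself \<Rightarrow> (real^'n::finite) set \<Rightarrow> bool" where
  "compressed K P \<longleftrightarrow> lattice_polytope P \<and>
     (\<forall>ys. distinct ys \<and> set ys = lattice_points P \<longrightarrow>
        squarefree_generated (lattice_points P)
          (initial_ideal (lattice_points P) (revlex_less ys)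
             (toric_ideal P :: ((int^'n \<Rightarrow>\<^sub>0 nat) \<Rightarrow>\<^sub>0 'k) set)))"

end

theory Submission
  imports Defs "HOL-Library.Multiset"
begin

text \<open>Write \<open>W\<close> for the family of matchable sets; the lattice points of the polytope are the
  indicator vectors of \<open>W\<close>, monomials are multisets over \<open>W\<close>, and a fiber of the toric map consists
  of the multisets of given size and given sum of indicator vectors. For a reverse lexicographic
  order a monomial is standard iff it is the least element of its fiber. Hence the polytope is
  compressed as soon as \<open>W\<close> has the following exchange property: if a fiber contains \<open>M\<close> and some
  multiset using \<open>T\<close>, then the fiber of any \<open>D\<close> with the same support as \<open>M\<close> also contains a
  multiset using \<open>T\<close>. Conversely, if this fails for the support \<open>D\<close> of \<open>M\<close>, and \<open>D\<close> is the only
  element of its fiber using some \<open>A \<in> D\<close>, then the order with \<open>T\<close> last and \<open>A\<close> next to last shows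
  that the polytope is not compressed.

  Four obstructions of this kind suffice: factor-critical sets with at least five vertices
  (in particular odd cycles of length at least 5, and two triangles sharing one vertex),
  two vertices at odd distance on an even cycle that are not adjacent, and two disjoint triangles
  joined by a path of even or of odd length. In their absence any two triangles share two vertices,
  so that at most one block has a triangle, and growing a block by ears
  shows that it is complete bipartite, \<open>K\<^sub>4\<close> or \<open>K\<^sub>1\<^sub>,\<^sub>1\<^sub>,\<^sub>n\<close>.

  The exchange property holds for complete bipartite graphs, where sums of \<open>k\<close> matchable sets are
  described by obvious inequalities; it carries over to \<open>K\<^sub>1\<^sub>,\<^sub>1\<^sub>,\<^sub>n\<close>, where the multiplicity of the pair
  of apices is constant on fibers, it holds for \<open>K\<^sub>4\<close>, whose polytope is a cross-polytope,
  and it is preserved when a bipartite graph is attached at a cut vertex.\<close>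

section \<open>Fibers\<close>

text \<open>The exchange property concerns all \<open>D\<close> with the support of
  \<open>M\<close>, not only the squarefree one that the initial ideal needs. The reason is gluing
  at a cut vertex: projecting the members of a squarefree \<open>D\<close> to one side can produce
  repetitions, but equal supports stay equal, so it is this stronger form that survives the
  induction. Gluing also explains why one exceptional block is tolerated. At the cut vertex a fiber
  records only the total degree, not the share of either side. If one side is bipartite, its colour
  classes have equal degree sums, which determines its share. With an exceptional block on each side
  there would be two triangles with at most one common vertex, and these are obstructed. The
  obstructions come from linear relations between indicator vectors. In each relation one set
  \<open>A\<close> occurs twice on one side, which lets \<open>T\<close> appear on the other; the
  squarefree fiber, without the doubling, is too rigid to contain \<open>T\<close>. The rigidity
  comes from odd cardinalities or from a missing matchable set. The field enters only through
  binomials with coefficients 1 and -1, so being compressed becomes a statement about fibers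
  alone.\<close>

definition deg :: "'a set multiset \<Rightarrow> 'a \<Rightarrow> nat" where
  "deg M i = size {#S \<in># M. i \<in> S#}"

lemma deg_simps [simp]:
  "deg {#} i = 0"
  "deg (add_mset S M) i = of_bool (i \<in> S) + deg M i"
  "deg (M + N) i = deg M i + deg N i"
  by (auto simp: deg_def)

lemma deg_le_size: "deg M i \<le> size M"
  by (simp add: deg_def size_filter_mset_lesseq)

lemma deg_eq_0_iff: "deg M i = 0 \<longleftrightarrow> (\<forall>S\<in>#M. i \<notin> S)"
  by (induction M) auto

lemma deg_eq_size_iff: "deg M i = size M \<longleftrightarrow> (\<forall>S\<in>#M. i \<in> S)"
proof (induction M)
  case (add S M)
  then show ?case using deg_le_size[of M i] by auto
qed auto

lemma sum_deg:
  assumes "finite U"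
  shows "(\<Sum>i\<in>U. deg M i) = (\<Sum>S\<in>#M. card (S \<inter> U))"
proof (induction M)
  case (add S M)
  have "(\<Sum>i\<in>U. of_bool (i \<in> S)) = card (S \<inter> U)"
    using assms by (simp add: Int_commute)
  with add show ?case by (simp add: sum.distrib)
qed auto

definition same_fiber :: "'a set multiset \<Rightarrow> 'a set multiset \<Rightarrow> bool" where
  "same_fiber M N \<longleftrightarrow> size M = size N \<and> (\<forall>i. deg M i = deg N i)"

lemma same_fiber_refl [simp]: "same_fiber M M"
  by (simp add: same_fiber_def)

lemma same_fiber_sym: "same_fiber M N \<Longrightarrow> same_fiber N M"
  by (simp add: same_fiber_def)

lemma same_fiber_add_cancel [simp]:
  "same_fiber (M + K) (N + K) \<longleftrightarrow> same_fiber M N"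
  by (simp add: same_fiber_def)

definition exchange_property :: "'a set set \<Rightarrow> bool" where
  "exchange_property W \<longleftrightarrow>
     (\<forall>T\<in>W. \<forall>M N D. set_mset M \<subseteq> W \<and> set_mset N \<subseteq> W \<and> same_fiber M (add_mset T N) \<and>
        set_mset D = set_mset M \<longrightarrow>
        (\<exists>N'. set_mset N' \<subseteq> W \<and> same_fiber D (add_mset T N')))"

lemma exchange_propertyI:
  assumes "\<And>T M N D. T \<in> W \<Longrightarrow> set_mset M \<subseteq> W \<Longrightarrow> set_mset N \<subseteq> W \<Longrightarrow>
    same_fiber M (add_mset T N) \<Longrightarrow> set_mset D = set_mset M \<Longrightarrow>
    \<exists>N'. set_mset N' \<subseteq> W \<and> same_fiber D (add_mset T N')"
  shows "exchange_property W"
  unfolding exchange_property_def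
proof (intro ballI allI impI, elim conjE)
qed (rule assms)

lemma exchange_propertyD:
  assumes "exchange_property W" "T \<in> W" "set_mset M \<subseteq> W" "set_mset N \<subseteq> W"
    "same_fiber M (add_mset T N)" "set_mset D = set_mset M"
  obtains N' where "set_mset N' \<subseteq> W" "same_fiber D (add_mset T N')"
  using assms(1)[unfolded exchange_property_def, rule_format,
      OF assms(2) conjI[OF assms(3) conjI[OF assms(4) conjI[OF assms(5,6)]]]] that
  by (elim exE conjE)

definition obstructed :: "'a set set \<Rightarrow> bool" where
  "obstructed W \<longleftrightarrow> (\<exists>D A T M N. A \<in> D \<and> T \<in> W \<and> T \<noteq> A \<and> set_mset M = D \<and> D \<subseteq> W \<and>
     set_mset N \<subseteq> W \<and> same_fiber M (add_mset T N) \<and>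
     (\<forall>E. set_mset E \<subseteq> W \<and> same_fiber E (mset_set D) \<longrightarrow>
        T \<notin># E \<and> (A \<in># E \<longrightarrow> E = mset_set D)))"

section \<open>Matchable sets\<close>

abbreviation adj :: "'v sgraph \<Rightarrow> 'v \<Rightarrow> 'v \<Rightarrow> bool" where
  "adj G u v \<equiv> {u, v} \<in> edges G"

lemma adj_sym: "adj G u v \<Longrightarrow> adj G v u"
  by (simp add: insert_commute)

lemma adjD:
  assumes "simple_graph G" "adj G u v"
  shows "u \<noteq> v" "u \<in> verts G" "v \<in> verts G"
proof -
  have "\<forall>e\<in>edges G. e \<subseteq> verts G \<and> card e = 2"
    using assms(1) by (simp add: simple_graph_def)
  from bspec[OF this assms(2)] have uv: "{u, v} \<subseteq> verts G" "card {u, v} = 2" by simp_all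
  show "u \<noteq> v" using uv(2) by (cases "u = v") simp_all
  show "u \<in> verts G" "v \<in> verts G" using uv(1) by simp_all
qed

lemma empty_matchable [simp]: "{} \<in> matchable_sets G"
  by (auto simp: matchable_sets_def perfect_matching_def induced_def intro!: exI[of _ "{}"])

lemma edge_matchable:
  assumes "simple_graph G" "adj G u v"
  shows "{u, v} \<in> matchable_sets G"
proof -
  have "perfect_matching (induced G {u, v}) {{u, v}}"
    using assms by (simp add: perfect_matching_def induced_def)
  then show ?thesis using adjD[OF assms] unfolding matchable_sets_def by blast
qed

lemma union_matchable:
  assumes "S \<in> matchable_sets G" "T \<in> matchable_sets G" "S \<inter> T = {}"
  shows "S \<union> T \<in> matchable_sets G"
proof -
  obtain M N where M: "S \<subseteq> verts G" "perfect_matching (induced G S) M"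
    and N: "T \<subseteq> verts G" "perfect_matching (induced G T) N"
    using assms(1,2) unfolding matchable_sets_def by blast
  have "perfect_matching (induced G (S \<union> T)) (M \<union> N)"
    unfolding perfect_matching_def
  proof (intro conjI ballI impI)
    show "M \<union> N \<subseteq> edges (induced G (S \<union> T))" "\<Union> (M \<union> N) = verts (induced G (S \<union> T))"
      using M N by (auto simp: perfect_matching_def induced_def)
    have sub: "e \<subseteq> S" if "e \<in> M" for e
      using M that by (auto simp: perfect_matching_def induced_def)
    have sub': "e \<subseteq> T" if "e \<in> N" for e
      using N that by (auto simp: perfect_matching_def induced_def)
    have cross: "e \<inter> f = {}" if "e \<in> M" "f \<in> N" for e f
      using sub[OF that(1)] sub'[OF that(2)] assms(3) by auto
    fix e f assume ef: "e \<in> M \<union> N" "f \<in> M \<union> N" "e \<noteq> f"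
    then consider "e \<in> M" "f \<in> M" | "e \<in> M" "f \<in> N" | "e \<in> N" "f \<in> M" | "e \<in> N" "f \<in> N" by auto
    then show "e \<inter> f = {}"
    proof cases
      case 1
      then show ?thesis using M(2) ef(3) unfolding perfect_matching_def by metis
    next
      case 4
      then show ?thesis using N(2) ef(3) unfolding perfect_matching_def by metis
    qed (use cross in \<open>auto simp: Int_commute\<close>)
  qed
  with M N show ?thesis unfolding matchable_sets_def by auto
qed

lemma insert_edge_matchable:
  assumes "simple_graph G" "adj G u v" "S \<in> matchable_sets G" "u \<notin> S" "v \<notin> S"
  shows "insert u (insert v S) \<in> matchable_sets G"
  using union_matchable[OF edge_matchable[OF assms(1,2)] assms(3)] assms(4,5) by auto

lemma matchable_subset: "S \<in> matchable_sets G \<Longrightarrow> S \<subseteq> verts G"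
  by (simp add: matchable_sets_def)

text \<open>Peels the edges off a perfect matching one by one; later arguments then need no explicit
  matching.\<close>

lemma matchable_induct [consumes 2, case_names empty edge]:
  assumes "simple_graph G" "S \<in> matchable_sets G" "P {}"
    and step: "\<And>u v S. \<lbrakk>adj G u v; u \<noteq> v; S \<in> matchable_sets G; u \<notin> S; v \<notin> S; P S\<rbrakk>
      \<Longrightarrow> P (insert u (insert v S))"
  shows "P S"
proof -
  have edges: "finite (edges G)"
  proof -
    have "edges G \<subseteq> Pow (verts G)" using assms(1) by (auto simp: simple_graph_def)
    then show ?thesis using assms(1) finite_subset by (auto simp: simple_graph_def)
  qed
  obtain M where "perfect_matching (induced G S) M"
    using assms(2) unfolding matchable_sets_def by blast
  then have M: "M \<subseteq> edges G" "\<forall>e\<in>M. \<forall>f\<in>M. e \<noteq> f \<longrightarrow> e \<inter> f = {}" "\<Union>M = S"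
    unfolding perfect_matching_def induced_def by (simp_all add: subset_iff)
  have "finite M" using M(1) edges finite_subset by blast
  then have "P (\<Union>M) \<and> \<Union>M \<in> matchable_sets G" using M(1,2)
  proof (induction M)
    case (insert e M)
    have e: "e \<in> edges G" using insert by auto
    then obtain u v where uv: "e = {u, v}" "u \<noteq> v"
      using assms(1) unfolding simple_graph_def card_2_iff by blast
    have "e \<inter> \<Union>M = {}" using insert by fastforce
    moreover have "P (\<Union>M) \<and> \<Union>M \<in> matchable_sets G" using insert by auto
    ultimately show ?case
      using uv e step[of u v "\<Union>M"] insert_edge_matchable[OF assms(1), of u v "\<Union>M"] by auto
  qed (simp add: assms(3))
  then show ?thesis using M by simp
qed

lemma finite_matchable: "simple_graph G \<Longrightarrow> S \<in> matchable_sets G \<Longrightarrow> finite S"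
  by (meson finite_subset matchable_subset simple_graph_def)

lemma even_card_matchable:
  assumes "simple_graph G" "S \<in> matchable_sets G"
  shows "even (card S)"
  using assms by (induction rule: matchable_induct) (auto simp: finite_matchable[OF assms(1)])

lemma pair_matchable_iff:
  assumes "simple_graph G" "u \<noteq> v"
  shows "{u, v} \<in> matchable_sets G \<longleftrightarrow> adj G u v"
proof
  have "adj G u v" if "S \<in> matchable_sets G" "S = {u, v}" for S
    using assms(1) that
  proof (induction S rule: matchable_induct)
    case (edge x y S)
    have "finite S" using edge assms(1) finite_matchable by blast
    then have "card S = 0"
      using arg_cong[OF edge.prems, of card] edge.hyps assms(2) by simp
    then have "S = {}" using \<open>finite S\<close> by simp
    then show ?case using edge.hyps(1) edge.prems by simp
  qed simp
  then show "{u, v} \<in> matchable_sets G \<Longrightarrow> adj G u v" by blast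
qed (rule edge_matchable[OF assms(1)])

text \<open>Every second edge of the path, beginning with the first, belongs to the
  matching.\<close>

lemma path_matchable:
  assumes "simple_graph G"
  shows "\<lbrakk>successively (adj G) xs; distinct xs; even (length xs)\<rbrakk> \<Longrightarrow> set xs \<in> matchable_sets G"
proof (induction xs rule: induct_list012)
  case (3 x y zs)
  then have "set zs \<in> matchable_sets G" by (cases zs) auto
  with 3 show ?case using insert_edge_matchable[OF assms, of x y "set zs"] by auto
qed simp_all

section \<open>Obstructions\<close>

lemma size_2_ex: "size E = 2 \<Longrightarrow> T \<in># E \<Longrightarrow> \<exists>X. E = {#T, X#}"
  by (metis One_nat_def Suc_1 insert_DiffM nat.inject size_1_singleton_mset size_add_mset)

lemma size_3_ex:
  assumes "size E = 3" "T \<in># E" shows "\<exists>X Y. E = {#T, X, Y#}"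
proof -
  obtain E' where E: "E = add_mset T E'" using assms(2) by (metis insert_DiffM)
  then have "size E' = 2" using assms(1) by simp
  moreover from this obtain X where "X \<in># E'" by (metis size_empty zero_neq_numeral multiset_nonemptyE)
  ultimately show ?thesis using size_2_ex[of E' X] E by blast
qed

lemma obstructedI:
  assumes "A \<in> D" "T \<in> W" "T \<noteq> A" "set_mset M = D" "D \<subseteq> W" "set_mset N \<subseteq> W"
    "same_fiber M (add_mset T N)"
    "\<And>E. set_mset E \<subseteq> W \<Longrightarrow> same_fiber E (mset_set D) \<Longrightarrow> T \<notin># E \<and> (A \<in># E \<longrightarrow> E = mset_set D)"
  shows "obstructed W"
  unfolding obstructed_def
  by (intro exI[of _ D] exI[of _ A] exI[of _ T] exI[of _ M] exI[of _ N] conjI)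
    (use assms in \<open>simp_all\<close>)

text \<open>Two sets with the same sum as the disjoint sets \<open>A\<close> and \<open>B\<close>
  must partition \<open>A \<union> B\<close>. Hence \<open>T\<close> could only be accompanied by
  \<open>A \<union> B - T\<close>, and \<open>A\<close> only by \<open>B\<close>.\<close>

lemma obstructed_pairI:
  assumes "A \<in> W" "B \<in> W" "A \<inter> B = {}" "A \<noteq> B" "T \<in> W" "T \<noteq> A" "A \<union> B - T \<notin> W"
    and "set_mset N \<subseteq> W" "same_fiber {#A, A, B#} (add_mset T N)"
  shows "obstructed W"
proof -
  have pair: "E = {#S, A \<union> B - S#}" if E: "same_fiber E {#A, B#}" "S \<in># E" for E S
  proof -
    have "size E = 2" using E by (simp add: same_fiber_def)
    then obtain X where X: "E = {#S, X#}" using size_2_ex[OF _ E(2)] by blast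
    have *: "of_bool (i \<in> S) + of_bool (i \<in> X) = (of_bool (i \<in> A) + of_bool (i \<in> B) :: nat)" for i
      using E X by (auto simp: same_fiber_def)
    have "i \<in> X \<longleftrightarrow> i \<in> A \<union> B - S" for i
      using assms(3) *[of i] by (cases "i \<in> S"; cases "i \<in> X"; cases "i \<in> A"; cases "i \<in> B"; force)
    then have "X = A \<union> B - S" by blast
    then show ?thesis using X by simp
  qed
  have D: "mset_set {A, B} = {#A, B#}" using assms(4) by simp
  have "T \<notin># E \<and> (A \<in># E \<longrightarrow> E = mset_set {A, B})"
    if E: "set_mset E \<subseteq> W" "same_fiber E (mset_set {A, B})" for E
  proof
    show "T \<notin># E"
    proof
      assume "T \<in># E"
      then have "E = {#T, A \<union> B - T#}" using pair E D by simp
      then show False using E(1) assms(7) by simp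
    qed
    have "A \<union> B - A = B" using assms(3) by blast
    then show "A \<in># E \<longrightarrow> E = mset_set {A, B}" using pair[of E A] E D by simp
  qed
  then show ?thesis by (rule obstructedI[OF _ _ _ _ _ assms(8,9), rotated -1]) (use assms in auto)
qed

text \<open>Here \<open>D\<close> consists of \<open>T \<union> {s, t}\<close>,
  \<open>H - {s}\<close> and \<open>H - {t}\<close>, with sum \<open>T + 2H\<close>. Next to
  \<open>T\<close>, both remaining sets would have to be the odd set \<open>H\<close>. Next to
  \<open>T \<union> {s, t}\<close>, both contain \<open>H - {s, t}\<close> and they share out
  \<open>s\<close> and \<open>t\<close>; giving both points to one set produces \<open>H\<close>
  again.\<close>

lemma obstructed_oddI:
  assumes even: "\<And>S. S \<in> W \<Longrightarrow> even (card S)"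
    and H: "finite H" "odd (card H)" "s \<in> H" "t \<in> H" "s \<noteq> t" "T \<subseteq> H - {s, t}"
    and W: "T \<in> W" "T \<union> {s, t} \<in> W" "H - {s} \<in> W" "H - {t} \<in> W" "set_mset N \<subseteq> W"
    and N: "same_fiber {#T \<union> {s, t}, T \<union> {s, t}, H - {s}, H - {t}#} (add_mset T N)"
  shows "obstructed W"
proof -
  let ?A = "T \<union> {s, t}" and ?B = "H - {s}" and ?C = "H - {t}"
  have "?A \<noteq> ?B" "?A \<noteq> ?C" "?B \<noteq> ?C" using H by blast+
  then have D: "mset_set {?A, ?B, ?C} = {#?A, ?B, ?C#}" by simp
  have "card (H - {s, t}) = card H - 2" using H by (simp add: card_Diff_subset)
  moreover have "card {s, t} \<le> card H" using H by (intro card_mono) auto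
  ultimately have "odd (card (H - {s, t}))" using H by simp
  then have odd: "H \<notin> W" "H - {s, t} \<notin> W" using even H by blast+
  have three: "\<exists>X Y. E = {#S, X, Y#} \<and> (\<forall>i. deg {#S, X, Y#} i = deg {#?A, ?B, ?C#} i)"
    if E: "same_fiber E (mset_set {?A, ?B, ?C})" "S \<in># E" for E S
  proof -
    have "size E = 3" using E(1) unfolding D by (simp add: same_fiber_def)
    then obtain X Y where X: "E = {#S, X, Y#}" using size_3_ex[OF _ E(2)] by blast
    have "\<forall>i. deg E i = deg {#?A, ?B, ?C#} i"
      using E(1) unfolding D by (simp add: same_fiber_def)
    then show ?thesis unfolding X by blast
  qed
  have T: "i \<in> T \<Longrightarrow> i \<in> H \<and> i \<noteq> s \<and> i \<noteq> t" for i using H by blast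
  have main: "T \<notin># E \<and> (?A \<in># E \<longrightarrow> E = mset_set {?A, ?B, ?C})"
    if E: "set_mset E \<subseteq> W" "same_fiber E (mset_set {?A, ?B, ?C})" for E
  proof
    show "T \<notin># E"
    proof
      assume "T \<in># E"
      from three[OF E(2) this] obtain X Y where X: "E = {#T, X, Y#}" and
        *: "\<And>i. deg {#T, X, Y#} i = deg {#?A, ?B, ?C#} i" by blast
      have "i \<in> X \<longleftrightarrow> i \<in> H" for i
        using *[of i] H(3-5) T[of i]
        by (cases "i = s"; cases "i = t"; cases "i \<in> T"; cases "i \<in> X"; cases "i \<in> Y"; cases "i \<in> H"; simp)
      then have "X = H" by blast
      then show False using E(1) X odd by simp
    qed
    show "?A \<in># E \<longrightarrow> E = mset_set {?A, ?B, ?C}"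
    proof
      assume "?A \<in># E"
      from three[OF E(2) this] obtain X Y where X: "E = {#?A, X, Y#}" and
        deg: "\<And>i. deg {#?A, X, Y#} i = deg {#?A, ?B, ?C#} i" by blast
      have *: "of_bool (i \<in> X) + of_bool (i \<in> Y) = (of_bool (i \<in> ?B) + of_bool (i \<in> ?C) :: nat)" for i
        using deg[of i] by simp
      have rest: "i \<in> X \<longleftrightarrow> i \<in> H" "i \<in> Y \<longleftrightarrow> i \<in> H" if "i \<noteq> s" "i \<noteq> t" for i
        using *[of i] that by (cases "i \<in> X"; cases "i \<in> Y"; cases "i \<in> H"; simp)+
      have s: "s \<in> X \<longleftrightarrow> s \<notin> Y"
        using *[of s] H(3-5) by (cases "s \<in> X"; cases "s \<in> Y"; simp)
      have t: "t \<in> X \<longleftrightarrow> t \<notin> Y"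
        using *[of t] H(3-5) by (cases "t \<in> X"; cases "t \<in> Y"; simp)
      have "X \<in> W" "Y \<in> W" using E(1) X by auto
      consider "s \<in> X" "t \<in> X" | "s \<in> X" "t \<in> Y" | "s \<in> Y" "t \<in> X" | "s \<in> Y" "t \<in> Y"
        using s t by blast
      then show "E = mset_set {?A, ?B, ?C}"
      proof cases
        case 1
        then have "i \<in> X \<longleftrightarrow> i \<in> H" for i using rest[of i] H by metis
        then have "X = H" by blast
        with odd \<open>X \<in> W\<close> show ?thesis by simp
      next
        case 2
        then have "i \<in> X \<longleftrightarrow> i \<in> H - {t}" "i \<in> Y \<longleftrightarrow> i \<in> H - {s}" for i
          using rest[of i] H s t by (cases "i = s"; cases "i = t"; auto)+
        then have "X = H - {t}" "Y = H - {s}" by blast+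
        then show ?thesis unfolding X D by (simp add: add_mset_commute)
      next
        case 3
        then have "i \<in> X \<longleftrightarrow> i \<in> H - {s}" "i \<in> Y \<longleftrightarrow> i \<in> H - {t}" for i
          using rest[of i] H s t by (cases "i = s"; cases "i = t"; auto)+
        then have "X = H - {s}" "Y = H - {t}" by blast+
        then show ?thesis unfolding X D by (simp add: add_mset_commute)
      next
        case 4
        then have "i \<in> Y \<longleftrightarrow> i \<in> H" for i using rest[of i] H by metis
        then have "Y = H" by blast
        with odd \<open>Y \<in> W\<close> show ?thesis by simp
      qed
    qed
  qed
  show ?thesis
    by (rule obstructedI[OF _ _ _ _ _ W(5) N main]) (use H W in auto)
qed

text \<open>With \<open>H = R + p + q + r + s + t\<close> the relation is \<open>2(R + s + t) + (H -
  s) + (H - t) = R + (H - p) + (H - q) + (H - r)\<close>; both sides equal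
  \<open>2H + 2R + s + t\<close>. This is the origin of the number five: two deletions on the left,
  three on the right.\<close>

lemma obstructed_factor_critical:
  assumes even: "\<And>S. S \<in> W \<Longrightarrow> even (card S)"
    and R: "finite R" "distinct [p, q, r, s, t]" "R \<inter> {p, q, r, s, t} = {}"
    and W: "R \<in> W" "R \<union> {s, t} \<in> W" "\<And>x. x \<in> {p, q, r, s, t} \<Longrightarrow> R \<union> {p, q, r, s, t} - {x} \<in> W"
  shows "obstructed W"
proof (rule obstructed_oddI[OF even])
  let ?H = "R \<union> {p, q, r, s, t}"
  have "card (?H - {p}) = card ?H - 1" "card ?H > 0"
    using R by (simp_all add: card_gt_0_iff)
  then show "odd (card ?H)" using even[OF W(3)[of p]] by simp
  show "same_fiber {#R \<union> {s, t}, R \<union> {s, t}, ?H - {s}, ?H - {t}#}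
      (add_mset R {#?H - {p}, ?H - {q}, ?H - {r}#})"
    unfolding same_fiber_def
  proof (intro conjI allI)
    fix i
    consider "i \<in> R" | "i = p" | "i = q" | "i = r" | "i = s" | "i = t" | "i \<notin> ?H" by blast
    then show "deg {#R \<union> {s, t}, R \<union> {s, t}, ?H - {s}, ?H - {t}#} i =
      deg (add_mset R {#?H - {p}, ?H - {q}, ?H - {r}#}) i"
      using R(2,3) by cases auto
  qed simp
  show "set_mset {#?H - {p}, ?H - {q}, ?H - {r}#} \<subseteq> W"
    unfolding set_mset_add_mset_insert set_mset_empty
    by (intro insert_subsetI W(3) empty_subsetI) simp_all
  show "?H - {s} \<in> W" "?H - {t} \<in> W" by (rule W(3), simp)+
qed (use R W(1,2) in auto)

text \<open>\<open>P\<close> and \<open>Q\<close> are to be the interiors of the two arcs of an even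
  cycle between \<open>u\<close> and \<open>w\<close>. The relation
  \<open>2P + (Q + u + w) = (P + Q) + (P + u + w) + 0\<close> brings in \<open>P \<union> Q\<close>,
  whose only possible partner in the squarefree fiber is the missing edge
  \<open>{u, w}\<close>.\<close>

lemma obstructed_exchange:
  assumes "P \<inter> Q = {}" "u \<noteq> w" "{u, w} \<inter> (P \<union> Q) = {}"
    and W: "{} \<in> W" "P \<in> W" "P \<union> Q \<in> W" "P \<union> {u, w} \<in> W" "Q \<union> {u, w} \<in> W" "{u, w} \<notin> W"
  shows "obstructed W"
proof (rule obstructed_pairI)
  have "P \<union> (Q \<union> {u, w}) - (P \<union> Q) = {u, w}" using assms(3) by blast
  then show "P \<union> (Q \<union> {u, w}) - (P \<union> Q) \<notin> W" using W by simp
  have "Q \<noteq> {}" using W by auto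
  then show "P \<union> Q \<noteq> P" using assms(1) by blast
  show "same_fiber {#P, P, Q \<union> {u, w}#} (add_mset (P \<union> Q) {#P \<union> {u, w}, {}#})"
    unfolding same_fiber_def
  proof (intro conjI allI)
    fix i
    consider "i \<in> P" | "i \<in> Q" | "i = u" | "i = w" | "i \<notin> P \<union> Q \<union> {u, w}" by blast
    then show "deg {#P, P, Q \<union> {u, w}#} i = deg (add_mset (P \<union> Q) {#P \<union> {u, w}, {}#}) i"
      using assms(1-3) by cases auto
  qed simp
qed (use assms in auto)

text \<open>\<open>I\<close> is to be the interior of a path from \<open>c\<close> to
  \<open>z\<close> between triangles on \<open>a, b, c\<close> and \<open>x, y, z\<close>. In the
  relation \<open>2(I + c + z) + (a + b + x + y) = (I + y + z) + (a + c) + (I + b + c + x +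
  z)\<close> the first set on the right would need the partner \<open>{a, b, c, x}\<close>.\<close>

lemma obstructed_odd_path:
  assumes dist: "distinct [a, b, c, x, y, z]" "I \<inter> {a, b, c, x, y, z} = {}"
    and W: "{c, z} \<union> I \<in> W" "{a, b, x, y} \<in> W" "I \<union> {y, z} \<in> W" "{a, c} \<in> W"
      "I \<union> {b, c, x, z} \<in> W" "{a, b, c, x} \<notin> W"
  shows "obstructed W"
proof (rule obstructed_pairI)
  have "{c, z} \<union> I \<union> {a, b, x, y} - (I \<union> {y, z}) = {a, b, c, x}" using dist by auto
  then show "{c, z} \<union> I \<union> {a, b, x, y} - (I \<union> {y, z}) \<notin> W" using W by simp
  show "same_fiber {#{c, z} \<union> I, {c, z} \<union> I, {a, b, x, y}#}
    (add_mset (I \<union> {y, z}) {#{a, c}, I \<union> {b, c, x, z}#})"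
    unfolding same_fiber_def
  proof (intro conjI allI)
    fix i
    consider "i \<in> I" | "i = a" | "i = b" | "i = c" | "i = x" | "i = y" | "i = z"
      | "i \<notin> I \<union> {a, b, c, x, y, z}" by blast
    then show "deg {#{c, z} \<union> I, {c, z} \<union> I, {a, b, x, y}#} i =
      deg (add_mset (I \<union> {y, z}) {#{a, c}, I \<union> {b, c, x, z}#}) i"
      using dist by cases auto
  qed simp
qed (use dist W in auto)

text \<open>The case of \<open>obstructed_oddI\<close> in which \<open>T\<close> is empty, from
  \<open>2(a + b) + (H - a) + (H - b) = 0 + (H - y) + (H - z) + (a + b + y + z)\<close>. The set
  \<open>H\<close> is to consist of two triangles and the interior of a path between them.\<close>

lemma obstructed_even_path:
  assumes even: "\<And>S. S \<in> W \<Longrightarrow> even (card S)"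
    and dist: "finite H" "odd (card H)" "{a, b, y, z} \<subseteq> H" "distinct [a, b, y, z]"
    and W: "{} \<in> W" "{a, b} \<in> W" "H - {a} \<in> W" "H - {b} \<in> W" "H - {y} \<in> W" "H - {z} \<in> W"
      "{a, b, y, z} \<in> W"
  shows "obstructed W"
proof (rule obstructed_oddI[OF even])
  show "same_fiber {#{} \<union> {a, b}, {} \<union> {a, b}, H - {a}, H - {b}#}
    (add_mset {} {#H - {y}, H - {z}, {a, b, y, z}#})"
    unfolding same_fiber_def
  proof (intro conjI allI)
    fix i
    consider "i = a" | "i = b" | "i = y" | "i = z" | "i \<in> H - {a, b, y, z}" | "i \<notin> H" by blast
    then show "deg {#{} \<union> {a, b}, {} \<union> {a, b}, H - {a}, H - {b}#} i =
      deg (add_mset {} {#H - {y}, H - {z}, {a, b, y, z}#}) i"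
      using dist by cases auto
  qed simp
qed (use dist W in auto)

section \<open>Paths, cycles and triangles\<close>

text \<open>Each step puts one vertex in front of the path already found. If the vertex occurs
  there, the loop is cut off; if its successor lies in \<open>Y\<close>, the path starts
  anew.\<close>

lemma rtrancl_path:
  assumes "(x, y) \<in> {(x, y). R x y}\<^sup>*" "x \<notin> Y" "y \<in> Y"
  shows "\<exists>I z. z \<in> Y \<and> distinct (x # I @ [z]) \<and> successively R (x # I @ [z]) \<and> set I \<inter> Y = {}"
  using assms
proof (induction rule: converse_rtrancl_induct)
  case base
  then show ?case by simp
next
  case (step x x1)
  show ?case
  proof (cases "x1 \<in> Y")
    case True
    then show ?thesis using step by (intro exI[of _ "[]"] exI[of _ x1]) auto
  next
    case False
    then obtain I z where I: "z \<in> Y" "distinct (x1 # I @ [z])" "successively R (x1 # I @ [z])"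
      "set I \<inter> Y = {}" using step by blast
    show ?thesis
    proof (cases "x \<in> set (x1 # I)")
      case True
      then obtain as bs where "x1 # I = as @ x # bs" by (meson split_list)
      then have eq: "x1 # I @ [z] = as @ x # bs @ [z]" and sub: "set bs \<subseteq> set (x1 # I)" by auto
      have "distinct (x # bs @ [z])" "successively R (x # bs @ [z])"
        using I(2,3) unfolding eq by (auto simp: successively_append_iff)
      moreover have "set bs \<inter> Y = {}" using sub I(4) False by auto
      ultimately show ?thesis using I(1) by blast
    next
      case notin: False
      then have "distinct (x # (x1 # I) @ [z])" using I(1,2) step.prems by auto
      moreover have "successively R (x # (x1 # I) @ [z])" using I(3) step.hyps by auto
      moreover have "set (x1 # I) \<inter> Y = {}" using I(4) False by auto
      ultimately show ?thesis using I(1) by blast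
    qed
  qed
qed

text \<open>The path from \<open>x\<close> stops at its first vertex in \<open>Y\<close>. Letting it
  begin at its last vertex in \<open>X\<close> clears the interior of both sets.\<close>

lemma path_between_sets:
  assumes "(x, y) \<in> {(x, y). R x y}\<^sup>*" "x \<in> X" "y \<in> Y" "X \<inter> Y = {}"
  obtains c I z where "c \<in> X" "z \<in> Y" "distinct (c # I @ [z])" "successively R (c # I @ [z])"
    "set I \<inter> (X \<union> Y) = {}"
proof -
  obtain I z where I: "z \<in> Y" "distinct (x # I @ [z])" "successively R (x # I @ [z])"
      "set I \<inter> Y = {}" using rtrancl_path[OF assms(1) _ assms(3)] assms by blast
  have "\<exists>c\<in>set (x # I). c \<in> X" using assms by auto
  then obtain as c bs where "x # I = as @ c # bs" and c: "c \<in> X" "\<forall>b\<in>set bs. b \<notin> X"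
    using split_list_last_prop[of "x # I" "\<lambda>c. c \<in> X"] by metis
  then have eq: "x # I @ [z] = as @ c # bs @ [z]" and sub: "set bs \<subseteq> set (x # I)" by auto
  have "distinct (c # bs @ [z])" "successively R (c # bs @ [z])"
    using I(2,3) unfolding eq by (auto simp: successively_append_iff)
  moreover have "set bs \<inter> (X \<union> Y) = {}"
    using sub I(4) c(2) assms(2) by auto
  ultimately show ?thesis using that c(1) I(1) by blast
qed

lemma successively_adj_verts:
  assumes "simple_graph G" "successively (adj G) (x # y # xs)"
  shows "set (x # y # xs) \<subseteq> verts G"
  using assms(2)
proof (induction xs arbitrary: x y)
  case Nil
  then show ?case using adjD[OF assms(1)] by simp
next
  case (Cons z xs)
  then have "set (y # z # xs) \<subseteq> verts G" using Cons.IH[of y z] by simp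
  moreover have "x \<in> verts G" using Cons.prems adjD[OF assms(1), of x y] by simp
  ultimately show ?case by simp
qed

section \<open>Induced subgraphs and their fibers\<close>

lemma joined_connected: "connected_graph G \<Longrightarrow> u \<in> verts G \<Longrightarrow> v \<in> verts G \<Longrightarrow> joined G u v"
  by (auto simp: connected_graph_def disconnected_graph_def)

lemma simple_induced: "simple_graph G \<Longrightarrow> U \<subseteq> verts G \<Longrightarrow> simple_graph (induced G U)"
  by (auto simp: simple_graph_def induced_def intro: finite_subset)

lemma adj_induced: "adj (induced G U) u v \<longleftrightarrow> adj G u v \<and> u \<in> U \<and> v \<in> U"
  by (auto simp: induced_def)

lemma verts_induced [simp]: "verts (induced G U) = U"
  by (simp add: induced_def)

lemma matchable_induced:
  assumes "U \<subseteq> verts G"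
  shows "matchable_sets (induced G U) = {S \<in> matchable_sets G. S \<subseteq> U}"
proof -
  have "induced (induced G U) S = induced G S" if "S \<subseteq> U" for S
    using that by (auto simp: induced_def)
  then show ?thesis using assms by (auto simp: matchable_sets_def)
qed

text \<open>The fiber of \<open>D\<close> does not grow in the larger family: degrees outside
  \<open>U\<close> vanish, so no member can leave \<open>U\<close>.\<close>

lemma obstructed_induced:
  assumes "finite (matchable_sets G)" "U \<subseteq> verts G" "obstructed (matchable_sets (induced G U))"
  shows "obstructed (matchable_sets G)"
proof -
  let ?W = "matchable_sets G" and ?V = "matchable_sets (induced G U)"
  have V: "?V = {S \<in> ?W. S \<subseteq> U}" by (rule matchable_induced[OF assms(2)])
  obtain D A T M N where *: "A \<in> D \<and> T \<in> ?V \<and> T \<noteq> A \<and> set_mset M = D \<and> D \<subseteq> ?V \<and>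
     set_mset N \<subseteq> ?V \<and> same_fiber M (add_mset T N) \<and>
     (\<forall>E. set_mset E \<subseteq> ?V \<and> same_fiber E (mset_set D) \<longrightarrow>
        T \<notin># E \<and> (A \<in># E \<longrightarrow> E = mset_set D))"
    using assms(3) unfolding obstructed_def by (elim exE) (rule that)
  then have w: "A \<in> D" "T \<in> ?V" "T \<noteq> A" "set_mset M = D" "D \<subseteq> ?V"
     "set_mset N \<subseteq> ?V" "same_fiber M (add_mset T N)" by simp_all
  have E: "T \<notin># E \<and> (A \<in># E \<longrightarrow> E = mset_set D)"
    if "set_mset E \<subseteq> ?V" "same_fiber E (mset_set D)" for E
    using * that by simp
  have fin: "finite D" using w(4) by auto
  show ?thesis
  proof (rule obstructedI[OF w(1) _ w(3,4) _ _ w(7)])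
    fix E assume *: "set_mset E \<subseteq> ?W" "same_fiber E (mset_set D)"
    have "S \<subseteq> U" if "S \<in># E" for S
    proof
      fix i assume "i \<in> S"
      then have "deg E i \<noteq> 0" using that by (auto simp: deg_eq_0_iff)
      then have "deg (mset_set D) i \<noteq> 0" using *(2) by (simp add: same_fiber_def)
      then obtain S' where "S' \<in> D" "i \<in> S'" using fin by (auto simp: deg_eq_0_iff)
      then show "i \<in> U" using w(5) V by blast
    qed
    then have "set_mset E \<subseteq> ?V" using * V by blast
    then show "T \<notin># E \<and> (A \<in># E \<longrightarrow> E = mset_set D)" by (rule E[OF _ *(2)])
  next
    show "T \<in> ?W" using w(2) V by simp
    show "D \<subseteq> ?W" "set_mset N \<subseteq> ?W" using w(5,6) V by auto
  qed
qed

text \<open>Odd cycles are factor-critical, since deleting a vertex leaves a path with an even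
  number of vertices. The first five vertices serve as \<open>p, q, r, s, t\<close>, the rest of the
  cycle as \<open>R\<close>.\<close>

lemma odd_cycle_obstructed:
  assumes G: "simple_graph G"
    and xs: "distinct xs" "successively (adj G) xs" "adj G (last xs) (hd xs)"
      "odd (length xs)" "length xs \<ge> 5"
  shows "obstructed (matchable_sets G)"
proof -
  obtain p q r s t ys where ys: "xs = p # q # r # s # t # ys"
    using xs(5) by (auto simp: numeral_eq_Suc Suc_le_length_iff)
  have minus: "set xs - {x} \<in> matchable_sets G" if x: "x \<in> set xs" for x
  proof -
    obtain as bs where eq: "xs = as @ x # bs" using split_list[OF x] by blast
    have "successively (adj G) as" "successively (adj G) bs"
      using xs(2) unfolding eq by (auto simp: successively_append_iff successively_Cons)
    moreover have "adj G (last bs) (hd as)" if "as \<noteq> []" "bs \<noteq> []"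
      using xs(3) that unfolding eq by simp
    ultimately have "successively (adj G) (bs @ as)" unfolding successively_append_iff by blast
    moreover have "distinct (bs @ as)" "even (length (bs @ as))"
      using xs(1,4) unfolding eq by auto
    moreover have "set xs - {x} = set (bs @ as)" using xs(1) unfolding eq by auto
    ultimately show ?thesis using path_matchable[OF G, of "bs @ as"] by simp
  qed
  have H: "set xs = set ys \<union> {p, q, r, s, t}" using ys by auto
  have ys_match: "set ys \<in> matchable_sets G" "set (s # t # ys) \<in> matchable_sets G"
    using xs unfolding ys by (intro path_matchable[OF G]; auto simp: successively_Cons)+
  have st: "set ys \<union> {s, t} \<in> matchable_sets G"
    using ys_match(2) by (simp add: insert_commute)
  have dist: "distinct [p, q, r, s, t]" "set ys \<inter> {p, q, r, s, t} = {}"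
    using xs(1) unfolding ys by auto
  have "set ys \<union> {p, q, r, s, t} - {x} \<in> matchable_sets G" if "x \<in> {p, q, r, s, t}" for x
    using minus[of x] that unfolding H by blast
  note * = this
  show ?thesis
    by (rule obstructed_factor_critical[OF even_card_matchable[OF G] finite_set dist ys_match(1) st])
      (assumption, rule *)
qed

text \<open>Even interiors of both arcs mean that \<open>u\<close> and \<open>w\<close> are at odd
  distance along the cycle. The arcs are matchable with and without their ends, so only the
  adjacency of \<open>u\<close> and \<open>w\<close> can avert
  \<open>obstructed_exchange\<close>.\<close>

lemma even_cycle_adj:
  assumes G: "simple_graph G" "\<not> obstructed (matchable_sets G)"
    and "successively (adj G) (u # P @ [w])" "successively (adj G) (w # Q @ [u])"
      "distinct (u # P @ w # Q)" "even (length P)" "even (length Q)"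
  shows "adj G u w"
proof (rule ccontr)
  assume "\<not> adj G u w"
  then have uw: "{u, w} \<notin> matchable_sets G"
    using pair_matchable_iff[OF G(1)] assms(5) by auto
  have "set (u # P @ [w]) \<in> matchable_sets G" "set (w # Q @ [u]) \<in> matchable_sets G"
    "set P \<in> matchable_sets G" "set Q \<in> matchable_sets G"
    using assms(3-) by (intro path_matchable[OF G(1)]; auto simp: successively_append_iff successively_Cons)+
  moreover have "set (u # P @ [w]) = set P \<union> {u, w}" "set (w # Q @ [u]) = set Q \<union> {u, w}" by auto
  moreover have "set P \<inter> set Q = {}" using assms(5) by auto
  moreover from this have "set P \<union> set Q \<in> matchable_sets G"
    using calculation union_matchable by blast
  ultimately have "obstructed (matchable_sets G)"
    using obstructed_exchange[of "set P" "set Q" u w "matchable_sets G"] uw assms(5) by auto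
  with G(2) show False by simp
qed

section \<open>Pairs of triangles\<close>

definition triangle :: "'v sgraph \<Rightarrow> 'v \<Rightarrow> 'v \<Rightarrow> 'v \<Rightarrow> bool" where
  "triangle G a b c \<longleftrightarrow> adj G a b \<and> adj G b c \<and> adj G a c"

lemma triangle_with_apex:
  assumes "triangle G a b c" "z \<in> {a, b, c}"
  obtains x y where "triangle G x y z" "{x, y, z} = {a, b, c}"
proof -
  consider "z = a" | "z = b" | "z = c" using assms(2) by blast
  then show ?thesis
    by cases (use assms(1) in \<open>auto simp: triangle_def insert_commute
      intro: that[of b c] that[of a c] that[of a b]\<close>)
qed

text \<open>The five vertices are factor-critical: without \<open>c\<close> two disjoint edges
  remain, and without another vertex its partner is matched with \<open>c\<close>. Here
  \<open>R\<close> is empty.\<close>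

lemma bowtie_obstructed:
  assumes G: "simple_graph G" and "triangle G a b c" "triangle G x y c" "{a, b} \<inter> {x, y} = {}"
  shows "obstructed (matchable_sets G)"
proof -
  have ne: "a \<noteq> b" "b \<noteq> c" "a \<noteq> c" "x \<noteq> y" "y \<noteq> c" "x \<noteq> c"
    using assms adjD[OF G] unfolding triangle_def by blast+
  have e: "adj G a b" "adj G b c" "adj G a c" "adj G x y" "adj G y c" "adj G x c"
    using assms unfolding triangle_def by blast+
  have two: "{u, v, u', v'} \<in> matchable_sets G"
    if "adj G u v" "adj G u' v'" "{u, v} \<inter> {u', v'} = {}" for u v u' v'
    using union_matchable[OF edge_matchable[OF G that(1)] edge_matchable[OF G that(2)] that(3)]
    by (simp add: insert_commute)
  show ?thesis
  proof (rule obstructed_factor_critical[of _ "{}" c a b x y])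
    fix z assume "z \<in> {c, a, b, x, y}"
    then consider "z = c" | "z = a" | "z = b" | "z = x" | "z = y" by blast
    then show "{} \<union> {c, a, b, x, y} - {z} \<in> matchable_sets G"
    proof cases
      case 1
      then have "{} \<union> {c, a, b, x, y} - {z} = {a, b, x, y}" using ne by auto
      then show ?thesis using two[of a b x y] e assms(4) ne by simp
    next
      case 2
      then have "{} \<union> {c, a, b, x, y} - {z} = {b, c, x, y}" using ne assms(4) by auto
      then show ?thesis using two[of b c x y] e assms(4) ne by simp
    next
      case 3
      then have "{} \<union> {c, a, b, x, y} - {z} = {a, c, x, y}" using ne assms(4) by auto
      then show ?thesis using two[of a c x y] e assms(4) ne by simp
    next
      case 4
      then have "{} \<union> {c, a, b, x, y} - {z} = {a, b, y, c}" using ne assms(4) by auto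
      then show ?thesis using two[of a b y c] e assms(4) ne by simp
    next
      case 5
      then have "{} \<union> {c, a, b, x, y} - {z} = {a, b, x, c}" using ne assms(4) by auto
      then show ?thesis using two[of a b x c] e assms(4) ne by simp
    qed
  qed (use edge_matchable[OF G e(4)] even_card_matchable[OF G] ne assms(4) in auto)
qed

lemma matchable_neighbour:
  assumes "simple_graph G" "S \<in> matchable_sets G" "x \<in> S"
  shows "\<exists>y\<in>S. adj G x y"
  using assms
proof (induction rule: matchable_induct)
  case (edge u v S)
  consider "x = u" | "x = v" | "x \<in> S" using edge.prems by blast
  then show ?case
  proof cases
    case 2
    then show ?thesis using adj_sym[OF edge.hyps(1)] by (intro bexI[of _ u]) simp_all
  next
    case 3
    then show ?thesis using edge.IH by blast
  qed (use edge.hyps(1) in simp)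
qed simp

lemma triangle_neq:
  assumes "simple_graph G" "triangle G a b c"
  shows "a \<noteq> b" "b \<noteq> c" "a \<noteq> c"
  using assms(2) adjD(1)[OF assms(1)] unfolding triangle_def by blast+

lemma triangle_adj:
  assumes "triangle G a b c"
  shows "adj G a b" "adj G b a" "adj G b c" "adj G c b" "adj G a c" "adj G c a"
  using assms by (simp_all add: triangle_def insert_commute)

lemma two_edges_path_matchable:
  assumes "simple_graph G" "adj G u v" "adj G x y" "successively (adj G) p" "even (length p)"
    "distinct (u # v # x # y # p)"
  shows "set (u # v # x # y # p) \<in> matchable_sets G"
proof -
  have "insert u (insert v (insert x (insert y (set p)))) \<in> matchable_sets G"
    using assms by (intro insert_edge_matchable path_matchable) simp_all
  then show ?thesis by simp
qed

text \<open>Deleting \<open>a\<close> or \<open>b\<close> leaves an edge at \<open>c\<close>, the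
  edge from \<open>x\<close> to \<open>y\<close>, and the path \<open>I @ [z]\<close>, which has an
  even number of vertices; deleting \<open>x\<close> or \<open>y\<close> is symmetric, with the path
  \<open>c # I\<close>. The parity in the name counts the edges of the path.\<close>

lemma even_path_triangles_obstructed:
  assumes G: "simple_graph G"
    and t: "triangle G a b c" "triangle G x y z" "{a, b, c} \<inter> {x, y, z} = {}"
    and I: "distinct (c # I @ [z])" "successively (adj G) (c # I @ [z])"
      "set I \<inter> ({a, b, c} \<union> {x, y, z}) = {}" "odd (length I)"
  shows "obstructed (matchable_sets G)"
proof -
  let ?H = "set (a # b # c # x # y # z # I)"
  note e = triangle_adj[OF t(1)] triangle_adj[OF t(2)]
  have dist: "distinct (a # b # c # x # y # z # I)"
    using triangle_neq[OF G t(1)] triangle_neq[OF G t(2)] t(3) I(1,3) by auto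
  have "I \<noteq> []" using I(4) by auto
  then have p: "successively (adj G) (c # I)" "successively (adj G) (I @ [z])"
    using I(2) by (auto simp: successively_append_iff successively_Cons)
  have "set (b # c # x # y # I @ [z]) \<in> matchable_sets G"
    "set (a # c # x # y # I @ [z]) \<in> matchable_sets G"
    "set (a # b # y # z # c # I) \<in> matchable_sets G"
    "set (a # b # x # z # c # I) \<in> matchable_sets G"
    using e p I(4) dist by (intro two_edges_path_matchable[OF G]; force)+
  moreover have "set (b # c # x # y # I @ [z]) = ?H - {a}" "set (a # c # x # y # I @ [z]) = ?H - {b}"
    "set (a # b # y # z # c # I) = ?H - {x}" "set (a # b # x # z # c # I) = ?H - {y}"
    using dist by auto
  ultimately have minus: "?H - {a} \<in> matchable_sets G" "?H - {b} \<in> matchable_sets G"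
    "?H - {x} \<in> matchable_sets G" "?H - {y} \<in> matchable_sets G" by simp_all
  have four: "{a, b, x, y} \<in> matchable_sets G"
    using two_edges_path_matchable[OF G e(1) e(7), of "[]"] dist by simp
  have "card ?H = length (a # b # c # x # y # z # I)"
    using dist by (rule distinct_card)
  then have odd: "odd (card ?H)" using I(4) by simp
  have sub: "{a, b, x, y} \<subseteq> ?H" "distinct [a, b, x, y]" using dist by auto
  show ?thesis
    by (rule obstructed_even_path[OF even_card_matchable[OF G] finite_set odd sub empty_matchable
        edge_matchable[OF G e(1)] minus four])
qed

text \<open>If \<open>{a, b, c, x}\<close> is not matchable, \<open>obstructed_odd_path\<close>
  applies. Otherwise \<open>x\<close> has a neighbour among \<open>a\<close>, \<open>b\<close>,
  \<open>c\<close>. Together with the path this closes an odd cycle with at least five vertices,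
  except when \<open>I\<close> is empty and the neighbour is \<open>c\<close>: then
  \<open>x, z, c\<close> is a triangle meeting the first one in \<open>c\<close> only.\<close>

lemma odd_path_triangles_obstructed:
  assumes G: "simple_graph G"
    and t: "triangle G a b c" "triangle G x y z" "{a, b, c} \<inter> {x, y, z} = {}"
    and I: "distinct (c # I @ [z])" "successively (adj G) (c # I @ [z])"
      "set I \<inter> ({a, b, c} \<union> {x, y, z}) = {}" "even (length I)"
  shows "obstructed (matchable_sets G)"
proof (cases "{a, b, c, x} \<in> matchable_sets G")
  note e = triangle_adj[OF t(1)] triangle_adj[OF t(2)]
  have dist: "distinct (a # b # c # x # y # z # I)"
    using triangle_neq[OF G t(1)] triangle_neq[OF G t(2)] t(3) I(1,3) by auto
  have p: "successively (adj G) I"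
    using I(2) by (auto simp: successively_append_iff successively_Cons)
  have q: "successively (adj G) (c # I @ [z, x])"
    using I(2) e(12) successively_append_iff[of "adj G" "c # I @ [z]" "[x]"] by simp
  {
    case True
    have "\<not> adj G x x" using adjD(1)[OF G] by blast
    then consider "adj G x c" | "adj G x a" | "adj G x b"
      using matchable_neighbour[OF G True, of x] by blast
    then show ?thesis
    proof cases
      case 1
      show ?thesis
      proof (cases "I = []")
        case True
        then have "triangle G x z c"
          using 1 e adj_sym[of c z G] adj_sym[of x c G] I(2) by (simp add: triangle_def)
        then show ?thesis using bowtie_obstructed[OF G t(1)] t(3) by auto
      next
        case False
        then have "length I \<ge> 2" using I(4) by (cases I; cases "tl I") auto
        then show ?thesis
          using odd_cycle_obstructed[OF G, of "c # I @ [z, x]"] q I(4) e 1 dist by auto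
      qed
    next
      case 2
      then show ?thesis
        using odd_cycle_obstructed[OF G, of "a # b # c # I @ [z, x]"] q I(4) e dist by auto
    next
      case 3
      then show ?thesis
        using odd_cycle_obstructed[OF G, of "b # a # c # I @ [z, x]"] q I(4) e dist by auto
    qed
  next
    case False
    have "set (c # I @ [z]) \<in> matchable_sets G"
      using I by (intro path_matchable[OF G]) simp_all
    then have 1: "{c, z} \<union> set I \<in> matchable_sets G" by (simp add: insert_commute)
    have 2: "{a, b, x, y} \<in> matchable_sets G"
      using two_edges_path_matchable[OF G e(1) e(7), of "[]"] dist by simp
    have "insert y (insert z (set I)) \<in> matchable_sets G"
      using I dist by (intro insert_edge_matchable[OF G e(9)] path_matchable[OF G p]) simp_all
    then have 3: "set I \<union> {y, z} \<in> matchable_sets G" by simp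
    have "set (b # c # x # z # I) \<in> matchable_sets G"
      using e p I(4) dist by (intro two_edges_path_matchable[OF G]) auto
    then have 4: "set I \<union> {b, c, x, z} \<in> matchable_sets G" by simp
    have "distinct [a, b, c, x, y, z]" "set I \<inter> {a, b, c, x, y, z} = {}" using dist by auto
    then show ?thesis
      by (rule obstructed_odd_path[OF _ _ 1 2 3 edge_matchable[OF G e(5)] 4 False])
  }
qed

text \<open>Disjoint triangles are joined by a path with interior off both, and the parity of the
  path decides which obstruction occurs. One common vertex gives a bowtie.\<close>

lemma triangles_share_two:
  assumes G: "simple_graph G" "connected_graph G" "\<not> obstructed (matchable_sets G)"
    and t: "triangle G a b c" "triangle G x y z"
  shows "card ({a, b, c} \<inter> {x, y, z}) \<ge> 2"
proof (rule ccontr)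
  assume "\<not> card ({a, b, c} \<inter> {x, y, z}) \<ge> 2"
  then consider "card ({a, b, c} \<inter> {x, y, z}) = 0" | "card ({a, b, c} \<inter> {x, y, z}) = 1" by linarith
  then show False
  proof cases
    case 1
    then have disj: "{a, b, c} \<inter> {x, y, z} = {}" by simp
    have "a \<in> verts G" "x \<in> verts G" using t adjD[OF G(1)] unfolding triangle_def by blast+
    then have "(a, x) \<in> {(u, v). adj G u v}\<^sup>*"
      using joined_connected[OF G(2)] by (simp add: joined_def)
    moreover have "a \<in> {a, b, c}" "x \<in> {x, y, z}" by simp_all
    ultimately obtain c' I z' where I: "c' \<in> {a, b, c}" "z' \<in> {x, y, z}" "distinct (c' # I @ [z'])"
      "successively (adj G) (c' # I @ [z'])" "set I \<inter> ({a, b, c} \<union> {x, y, z}) = {}"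
      using disj by (rule path_between_sets)
    obtain a' b' where 1: "triangle G a' b' c'" "{a', b', c'} = {a, b, c}"
      by (rule triangle_with_apex[OF t(1) I(1)])
    obtain x' y' where 2: "triangle G x' y' z'" "{x', y', z'} = {x, y, z}"
      by (rule triangle_with_apex[OF t(2) I(2)])
    show False
      using even_path_triangles_obstructed[OF G(1) 1(1) 2(1) _ I(3,4)]
        odd_path_triangles_obstructed[OF G(1) 1(1) 2(1) _ I(3,4)] disj I(5) G(3)
      unfolding 1(2) 2(2) by blast
  next
    case 2
    then obtain v where v: "{a, b, c} \<inter> {x, y, z} = {v}" by (rule card_1_singletonE)
    then have "v \<in> {a, b, c}" "v \<in> {x, y, z}" by blast+
    obtain a' b' where 1: "triangle G a' b' v" "{a', b', v} = {a, b, c}"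
      by (rule triangle_with_apex[OF t(1) \<open>v \<in> {a, b, c}\<close>])
    obtain x' y' where 2: "triangle G x' y' v" "{x', y', v} = {x, y, z}"
      by (rule triangle_with_apex[OF t(2) \<open>v \<in> {x, y, z}\<close>])
    have "{a', b'} \<inter> {x', y'} \<subseteq> {v}" using v 1(2) 2(2) by blast
    then have "{a', b'} \<inter> {x', y'} = {}"
      using triangle_neq[OF G(1) 1(1)] by blast
    then show False using bowtie_obstructed[OF G(1) 1(1) 2(1)] G(3) by blast
  qed
qed

section \<open>Ears and blocks\<close>

lemma path_verts:
  assumes "simple_graph G" "successively (adj G) (x # I @ [z])"
  shows "set (x # I @ [z]) \<subseteq> verts G"
proof (cases I)
  case Nil
  then show ?thesis using assms(2) successively_adj_verts[OF assms(1), of x z "[]"] by simp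
next
  case (Cons y J)
  then show ?thesis using assms(2) successively_adj_verts[OF assms(1), of x y "J @ [z]"] by simp
qed

text \<open>A path leaves \<open>K\<close> at some \<open>k\<close> through an outside neighbour
  \<open>z\<close>. As \<open>k\<close> is not a cut vertex, \<open>z\<close> can still reach
  another vertex of \<open>K\<close> without passing \<open>k\<close>; stopping there closes the
  ear.\<close>

lemma ear_exists:
  assumes B: "simple_graph B" "conn_without_cut_vertex B"
    and K: "K \<subseteq> verts B" "K \<noteq> verts B" "k1 \<in> K" "k2 \<in> K" "k1 \<noteq> k2"
  obtains k zs k' where "k \<in> K" "k' \<in> K" "zs \<noteq> []" "set zs \<inter> K = {}" "distinct (k # zs @ [k'])"
    "successively (adj B) (k # zs @ [k'])"
proof -
  have conn: "connected_graph B" and nocut: "\<And>v. \<not> cut_vertex B v"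
    using B(2) by (auto simp: conn_without_cut_vertex_def)
  obtain z0 where z0: "z0 \<in> verts B" "z0 \<notin> K" using K by blast
  have p: "(k1, z0) \<in> {(x, y). adj B x y}\<^sup>*"
    using joined_connected[OF conn] K z0 by (auto simp: joined_def)
  have d: "K \<inter> {z0} = {}" using z0 by simp
  obtain k I y where I: "k \<in> K" "y \<in> {z0}" "distinct (k # I @ [y])" "successively (adj B) (k # I @ [y])"
    "set I \<inter> (K \<union> {z0}) = {}"
    by (rule path_between_sets[OF p K(3) singletonI d])
  define z where "z = hd (I @ [y])"
  have z: "z \<notin> K" "adj B k z"
    using I z0 unfolding z_def by (cases I; auto)+
  then have zv: "z \<in> verts B" "z \<noteq> k" using adjD[OF B(1)] I(1) by blast+
  let ?B = "induced B (verts B - {k})"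
  obtain k3 where k3: "k3 \<in> K - {k}" using K by blast
  have "\<not> disconnected_graph ?B"
    using nocut[of k] I(1) K(1) by (auto simp: cut_vertex_def)
  then have "joined ?B z k3" using zv k3 K(1) by (auto simp: disconnected_graph_def)
  then have p: "(z, k3) \<in> {(x, y). adj ?B x y}\<^sup>*" by (simp add: joined_def)
  have d: "{z} \<inter> (K - {k}) = {}" using z by simp
  obtain z' J k' where J: "z' \<in> {z}" "k' \<in> K - {k}" "distinct (z' # J @ [k'])"
    "successively (adj ?B) (z' # J @ [k'])" "set J \<inter> ({z} \<union> (K - {k})) = {}"
    by (rule path_between_sets[OF p singletonI k3 d])
  have sB: "simple_graph ?B" by (rule simple_induced[OF B(1)]) simp
  have "set (z' # J @ [k']) \<subseteq> verts B - {k}"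
    using path_verts[OF sB J(4)] by simp
  then have nk: "k \<notin> set (z # J @ [k'])" using J(1) by auto
  have "successively (adj B) (z # J @ [k'])"
    using J(4) unfolding singletonD[OF J(1)] by (rule successively_mono) (auto simp: adj_induced)
  then have "successively (adj B) (k # (z # J) @ [k'])" using z(2) by simp
  moreover have "distinct (k # (z # J) @ [k'])" using nk J(1,3) by auto
  moreover have "set (z # J) \<inter> K = {}" using z J nk by auto
  ultimately show ?thesis using that[of k k' "z # J"] I(1) J(2) by blast
qed

section \<open>Ears in an unobstructed block, and blocks with a triangle\<close>

locale unobstructed_block =
  fixes B :: "'v sgraph"
  assumes simple: "simple_graph B" and block: "conn_without_cut_vertex B"
    and unobstructed: "\<not> obstructed (matchable_sets B)"
begin

lemma adj_irrefl: "\<not> adj B x x"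
  using adjD(1)[OF simple] by blast

lemma adj_commute: "adj B x y \<longleftrightarrow> adj B y x"
  by (simp add: insert_commute)

lemma adj_verts: "adj B x y \<Longrightarrow> x \<in> verts B" "adj B x y \<Longrightarrow> y \<in> verts B"
  using adjD[OF simple] by blast+

lemma finite_verts: "finite (verts B)"
  using simple by (simp add: simple_graph_def)

lemma edges_eq: "edges B = {{x, y} | x y. adj B x y}"
proof -
  have "e \<in> {{x, y} | x y. adj B x y}" if "e \<in> edges B" for e
  proof -
    have "card e = 2" using that simple unfolding simple_graph_def by blast
    then obtain x y where "e = {x, y}" by (auto simp: card_2_iff)
    then show ?thesis using that by blast
  qed
  then show ?thesis by blast
qed

lemma no_odd_cycle:
  "\<lbrakk>distinct xs; successively (adj B) xs; adj B (last xs) (hd xs); odd (length xs); length xs \<ge> 5\<rbrakk> \<Longrightarrow> False"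
  using odd_cycle_obstructed[OF simple] unobstructed by blast

lemma ear_append:
  assumes "successively (adj B) (k # zs @ [k'])" "successively (adj B) (k' # ys)"
  shows "successively (adj B) (k # zs @ k' # ys)"
  using assms successively_append_iff[of "adj B" "k # zs @ [k']" ys]
  by (cases ys) auto

text \<open>The ear \<open>zs\<close> and the way back \<open>ys\<close> close up to a cycle with
  two more vertices, \<open>k\<close> and \<open>k'\<close>; the bound 3 thus means cycle length at
  least 5.\<close>

lemma odd_ear:
  assumes "distinct (k # zs @ [k'])" "successively (adj B) (k # zs @ [k'])"
    and "successively (adj B) (k' # ys @ [k])" "distinct ys" "set ys \<inter> set (k # zs @ [k']) = {}"
    and "odd (length zs + length ys)" "length zs + length ys \<ge> 3"
  shows False
proof (rule no_odd_cycle)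
  have "successively (adj B) (k' # ys)"
    using assms(3) successively_append_iff[of "adj B" "k' # ys" "[k]"] by simp
  then show "successively (adj B) (k # zs @ k' # ys)" by (rule ear_append[OF assms(2)])
  have "adj B (last (k' # ys)) k"
    using assms(3) successively_append_iff[of "adj B" "k' # ys" "[k]"] by simp
  then show "adj B (last (k # zs @ k' # ys)) (hd (k # zs @ k' # ys))" by simp
qed (use assms in auto)

text \<open>An ear on the complete graph \<open>K\<close> can be closed through one or both of the
  two remaining vertices of \<open>K\<close>, whichever makes the cycle odd. Its length is then at
  least 5, so no ear exists.\<close>

lemma complete_4:
  assumes K: "card K = 4" "K \<subseteq> verts B" "\<And>x y. x \<in> K \<Longrightarrow> y \<in> K \<Longrightarrow> x \<noteq> y \<Longrightarrow> adj B x y"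
  shows "is_complete 4 B"
proof -
  have fin: "finite K" using K(1) by (simp add: card_ge_0_finite)
  have "K = verts B"
  proof (rule ccontr)
    assume "K \<noteq> verts B"
    moreover obtain k1 k2 where "k1 \<in> K" "k2 \<in> K" "k1 \<noteq> k2"
      using K(1) card_le_Suc0_iff_eq[OF fin] by fastforce
    ultimately obtain k zs k' where ear: "k \<in> K" "k' \<in> K" "zs \<noteq> []" "set zs \<inter> K = {}"
      "distinct (k # zs @ [k'])" "successively (adj B) (k # zs @ [k'])"
      by (rule ear_exists[OF simple block K(2)])
    have "card (K - {k, k'}) = 2" using ear K(1) fin by (simp add: card_Diff_subset)
    then obtain x y where xy: "K - {k, k'} = {x, y}" "x \<noteq> y" by (auto simp: card_2_iff)
    then have "x \<in> K" "y \<in> K" "x \<notin> {k, k'}" "y \<notin> {k, k'}" by blast+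
    then have a: "adj B k' x" "adj B x y" "adj B y k" "adj B x k" "x \<notin> set zs" "y \<notin> set zs"
      using K(3) xy(2) ear(1,2,4) by blast+
    have "length zs \<ge> 1" using ear(3) by (cases zs) auto
    then show False
      using odd_ear[OF ear(5,6), of "[x, y]"] odd_ear[OF ear(5,6), of "[x]"] a xy(2)
        \<open>x \<notin> {k, k'}\<close> \<open>y \<notin> {k, k'}\<close>
      by (cases "odd (length zs)") (auto elim: oddE evenE)
  qed
  moreover have "edges B = {e. e \<subseteq> K \<and> card e = 2}"
  proof
    show "edges B \<subseteq> {e. e \<subseteq> K \<and> card e = 2}"
      using simple \<open>K = verts B\<close> by (auto simp: simple_graph_def)
    show "{e. e \<subseteq> K \<and> card e = 2} \<subseteq> edges B"
      using K(3) by (auto simp: card_2_iff)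
  qed
  ultimately show ?thesis using K(1) finite_verts by (simp add: is_complete_def)
qed

text \<open>The apices \<open>u\<close>, \<open>v\<close> are the ends of an edge with the largest
  number of common neighbours. These neighbours are pairwise nonadjacent, since an edge between two
  of them would give a complete graph on four vertices. It remains to exclude every ear on
  \<open>{u, v} \<union> L u v\<close>.\<close>

lemma multipartite_1_1:
  assumes ab: "triangle B a b c" and no4: "\<not> is_complete 4 B"
  shows "\<exists>n\<ge>1. is_complete_multipartite [1, 1, n] B"
proof -
  define L where "L u v = {l. adj B u l \<and> adj B v l}" for u v
  have L_sub: "L u v \<subseteq> verts B" for u v using adj_verts by (auto simp: L_def)
  then have fin: "finite (L u v)" for u v using finite_verts finite_subset by blast
  have "\<exists>p. adj B (fst p) (snd p) \<and>
    (\<forall>q. adj B (fst q) (snd q) \<longrightarrow> card (L (fst q) (snd q)) \<le> card (L (fst p) (snd p)))"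
    by (rule ex_has_greatest_nat[of _ "(a, b)" _ "card (verts B) + 1"])
      (use ab card_mono[OF finite_verts L_sub] in \<open>auto simp: triangle_def less_Suc_eq_le\<close>)
  then obtain u v where uv: "adj B u v"
    and max: "\<And>x y. adj B x y \<Longrightarrow> card (L x y) \<le> card (L u v)" by auto
  have "c \<in> L a b" using ab adj_sym by (auto simp: triangle_def L_def)
  then have "card (L a b) > 0" using fin[of a b] card_gt_0_iff by blast
  then have L1: "card (L u v) \<ge> 1" using max[of a b] ab by (auto simp: triangle_def)
  have uvL: "u \<noteq> v" "u \<notin> L u v" "v \<notin> L u v"
    using adj_irrefl uv by (auto simp: L_def)
  have L: "adj B u l" "adj B l u" "adj B v l" "adj B l v" if "l \<in> L u v" for l
    using that adj_sym by (auto simp: L_def)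
  have indep: "\<not> adj B l l'" if "l \<in> L u v" "l' \<in> L u v" for l l'
  proof
    assume ll: "adj B l l'"
    then have "distinct [u, v, l, l']" using that uvL adj_irrefl by auto
    then have "card {u, v, l, l'} = 4" by simp
    moreover have "{u, v, l, l'} \<subseteq> verts B" using L_sub that uv adj_verts by auto
    moreover have "adj B x y" if "x \<in> {u, v, l, l'}" "y \<in> {u, v, l, l'}" "x \<noteq> y" for x y
      using that L[OF \<open>l \<in> L u v\<close>] L[OF \<open>l' \<in> L u v\<close>] uv ll adj_sym[OF uv] adj_sym[OF ll] by blast
    ultimately show False using complete_4 no4 by blast
  qed
  let ?K = "{u, v} \<union> L u v"
  \<comment> \<open>An ear from an apex to \<open>L u v\<close> can be closed directly or through
    the other apex \<open>w\<close>. Avoiding long odd cycles leaves a single inner vertex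
    \<open>z\<close>.\<close>
  have mixed: False if ear: "k \<in> {u, v}" "k' \<in> L u v" "zs \<noteq> []" "set zs \<inter> ?K = {}"
      "distinct (k # zs @ [k'])" "successively (adj B) (k # zs @ [k'])" for k k' zs
  proof -
    obtain w where w: "{k, w} = {u, v}" "w \<noteq> k" using ear(1) uvL(1) by (metis doubleton_eq_iff insertE singletonD)
    then have kw: "adj B k w" "adj B w k" "w \<in> {u, v}" "L k w = L u v"
      using uv adj_sym[OF uv] by (auto simp: doubleton_eq_iff L_def)
    have w': "adj B l k" "adj B k l" "adj B l w" "adj B w l" if "l \<in> L u v" for l
      using L[OF that] ear(1) kw(3) by auto
    have "w \<notin> set zs" "w \<noteq> k'" using ear kw(3) uvL by auto
    then have "odd (length zs) \<or> length zs < 2"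
      using odd_ear[OF ear(5,6), of "[w]"] kw w'[OF ear(2)] w(2) by (auto; presburger)
    moreover have "even (length zs) \<or> \<not> length zs \<ge> 3"
      using odd_ear[OF ear(5,6), of "[]"] w'[OF ear(2)] by (cases "even (length zs)") auto
    ultimately have "length zs = 1" using ear(3) by (cases zs; cases "tl zs"; auto; presburger)
    then obtain z where z: "zs = [z]" by (auto simp: length_Suc_conv)
    show False
    proof (cases "\<exists>l. l \<in> L u v \<and> l \<noteq> k'")
      \<comment> \<open>A further common neighbour \<open>l\<close> yields a 5-cycle through both
        apices.\<close>
      case True
      then obtain l where l: "l \<in> L u v" "l \<noteq> k'" by blast
      have "z \<noteq> l" "w \<noteq> l" "k \<noteq> l" "z \<noteq> w" using ear l uvL kw(3) unfolding z by auto
      show False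
      proof (rule no_odd_cycle[of "[z, k, l, w, k']"])
        have "adj B k z" "adj B z k'" using ear(6) z by simp_all
        then show "successively (adj B) [z, k, l, w, k']" "adj B (last [z, k, l, w, k']) (hd [z, k, l, w, k'])"
          using w'[OF l(1)] w'[OF ear(2)] by (simp_all add: adj_commute)
        show "distinct [z, k, l, w, k']"
          using \<open>z \<noteq> l\<close> \<open>w \<noteq> l\<close> \<open>k \<noteq> l\<close> \<open>z \<noteq> w\<close> \<open>w \<noteq> k'\<close> ear(5) w(2) l(2)
          unfolding z by auto
      qed simp_all
    next
      case False
      \<comment> \<open>Here the choice of \<open>u\<close> and \<open>v\<close> matters: the edge
        from \<open>k\<close> to \<open>k'\<close> has the two common neighbours \<open>z\<close>
        and \<open>w\<close>, one more than the supposed maximum.\<close>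
      then have "L u v = {k'}" using ear(2) by blast
      then have "card (L u v) = 1" by simp
      moreover have "{z, w} \<subseteq> L k k'"
        using ear(6) kw w'[OF ear(2)] adj_sym[of z k' B] unfolding z by (auto simp: L_def)
      then have "card {z, w} \<le> card (L k k')" by (rule card_mono[OF fin])
      moreover have "z \<noteq> w" using ear kw(3) unfolding z by auto
      ultimately show False using max[of k k'] w'[OF ear(2)] by simp
    qed
  qed
  have "?K = verts B"
  proof (rule ccontr)
    assume "?K \<noteq> verts B"
    moreover have "?K \<subseteq> verts B" using L_sub adj_verts uv by auto
    moreover have "u \<in> ?K" "v \<in> ?K" by simp_all
    ultimately obtain k zs k' where ear: "k \<in> ?K" "k' \<in> ?K" "zs \<noteq> []" "set zs \<inter> ?K = {}"
      "distinct (k # zs @ [k'])" "successively (adj B) (k # zs @ [k'])"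
      using ear_exists[OF simple block _ _ _ _ uvL(1)] by metis
    have r: "length zs \<ge> 1" using ear(3) by (cases zs) auto
    consider "k \<in> {u, v}" "k' \<in> {u, v}" | "k \<in> {u, v}" "k' \<in> L u v"
      | "k' \<in> {u, v}" "k \<in> L u v" | "k \<in> L u v" "k' \<in> L u v" using ear(1,2) by blast
    then show False
    proof cases
      case 1
      then have kk: "adj B k' k" "adj B k k'" using ear(5) uv adj_sym[OF uv] by auto
      obtain l where l: "l \<in> L u v" using L1 by fastforce
      then have lk: "adj B k' l" "adj B l k" "l \<notin> set zs" "l \<noteq> k" "l \<noteq> k'"
        using 1 L ear(4) uvL by auto
      have "odd (length zs) \<or> length zs < 2"
        using odd_ear[OF ear(5,6), of "[l]"] lk by (auto; presburger)
      moreover have "even (length zs) \<or> \<not> length zs \<ge> 3"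
        using odd_ear[OF ear(5,6), of "[]"] kk by (cases "even (length zs)") auto
      ultimately have "length zs = 1" using r by presburger
      then obtain z where z: "zs = [z]" by (auto simp: length_Suc_conv)
      \<comment> \<open>A one-vertex ear between the apices is a common neighbour and so was never
        outside.\<close>
      then have "z \<in> L u v" using ear(6) 1 ear(5) adj_sym[of z k' B] by (auto simp: L_def)
      then show False using ear(4) z by auto
    next
      case 2
      then show False using mixed ear by blast
    next
      case 3
      have "rev (k # zs @ [k']) = k' # rev zs @ [k]" by simp
      moreover have "successively (adj B) (rev (k # zs @ [k']))"
        unfolding successively_rev using ear(6)
        by (rule successively_mono) (simp add: insert_commute)
      ultimately show False using mixed[of k' k "rev zs"] 3 ear by auto
    next
      case 4
      then have "adj B k' u" "adj B u k" "adj B v k" "u \<notin> set zs" "v \<notin> set zs"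
        "u \<noteq> k" "u \<noteq> k'" "v \<noteq> k" "v \<noteq> k'"
        using L ear(4) uvL by auto
      then show False
        using odd_ear[OF ear(5,6), of "[u, v]"] odd_ear[OF ear(5,6), of "[u]"] r uv uvL(1)
        by (cases "odd (length zs)") (auto elim: oddE evenE)
    qed
  qed
  moreover have "edges B = {{x, y} | x y i j. i < length [{u}, {v}, L u v] \<and>
     j < length [{u}, {v}, L u v] \<and> i \<noteq> j \<and> x \<in> [{u}, {v}, L u v] ! i \<and> y \<in> [{u}, {v}, L u v] ! j}"
    (is "_ = ?E")
  proof
    show "?E \<subseteq> edges B"
      using L uv adj_sym[OF uv] by (auto simp: less_Suc_eq numeral_eq_Suc)
    show "edges B \<subseteq> ?E"
    proof
      fix e assume "e \<in> edges B"
      then obtain x y where e: "e = {x, y}" "adj B x y" using edges_eq by blast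
      have mem: "{x, y} \<in> ?E" if "i < 3" "j < 3" "i \<noteq> j" "x \<in> [{u}, {v}, L u v] ! i" "y \<in> [{u}, {v}, L u v] ! j" for x y i j
        using that by (auto simp: numeral_eq_Suc)
      have "x \<in> ?K" "y \<in> ?K" using adj_verts e(2) \<open>?K = verts B\<close> by blast+
      moreover have "x \<noteq> y" "\<not> (x \<in> L u v \<and> y \<in> L u v)" using e(2) indep adj_irrefl by blast+
      ultimately consider "x = u" "y = v" | "x = v" "y = u" | "x = u" "y \<in> L u v" | "x = v" "y \<in> L u v"
        | "x \<in> L u v" "y = u" | "x \<in> L u v" "y = v" by blast
      then show "e \<in> ?E" unfolding e(1)
        by cases (rule mem[of 0 1] mem[of 1 0] mem[of 0 2] mem[of 1 2] mem[of 2 0] mem[of 2 1]; simp; fail)+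
    qed
  qed
  ultimately have "is_complete_multipartite [1, 1, card (L u v)] B"
    unfolding is_complete_multipartite_def using uvL fin
    by (intro exI[of _ "[{u}, {v}, L u v]"]) (auto simp: less_Suc_eq numeral_eq_Suc)
  then show ?thesis using L1 by blast
qed

end

context unobstructed_block
begin

lemma even_cycle:
  "\<lbrakk>successively (adj B) (u # P @ [w]); successively (adj B) (w # Q @ [u]);
    distinct (u # P @ w # Q); even (length P); even (length Q)\<rbrakk> \<Longrightarrow> adj B u w"
  by (rule even_cycle_adj[OF simple unobstructed])

text \<open>Edges inside \<open>X\<close> or inside \<open>Y\<close> are allowed while the biclique
  grows; triangle-freeness removes them once it is spanning.\<close>

definition biclique :: "'v set \<Rightarrow> 'v set \<Rightarrow> bool" where
  "biclique X Y \<longleftrightarrow> X \<inter> Y = {} \<and> X \<subseteq> verts B \<and> Y \<subseteq> verts B \<and> (\<forall>x\<in>X. \<forall>y\<in>Y. adj B x y)"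

lemma biclique_sym:
  assumes "biclique X Y"
  shows "biclique Y X"
proof -
  have "adj B y x" if "x \<in> X" "y \<in> Y" for x y
    using adj_sym[of x y B] that assms by (simp add: biclique_def)
  then show ?thesis using assms unfolding biclique_def by blast
qed

lemma complete_bipartite_if_biclique:
  assumes "biclique X Y" "X \<union> Y = verts B"
    and indep: "\<And>x x'. x \<in> X \<Longrightarrow> x' \<in> X \<Longrightarrow> \<not> adj B x x'" "\<And>y y'. y \<in> Y \<Longrightarrow> y' \<in> Y \<Longrightarrow> \<not> adj B y y'"
  shows "complete_bipartite B"
proof -
  have XY: "X \<inter> Y = {}" "\<And>x y. x \<in> X \<Longrightarrow> y \<in> Y \<Longrightarrow> adj B x y"
    using assms(1) by (auto simp: biclique_def)
  have YX: "\<And>x y. x \<in> Y \<Longrightarrow> y \<in> X \<Longrightarrow> adj B x y"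
    using biclique_sym[OF assms(1)] by (auto simp: biclique_def)
  have fin: "finite X" "finite Y" using finite_verts assms(2) by (metis finite_Un)+
  have "edges B = {{x, y} | x y i j. i < length [X, Y] \<and> j < length [X, Y] \<and> i \<noteq> j \<and>
      x \<in> [X, Y] ! i \<and> y \<in> [X, Y] ! j}" (is "_ = ?E")
  proof
    show "?E \<subseteq> edges B"
      using XY(2) YX by (auto simp: less_Suc_eq numeral_eq_Suc)
    show "edges B \<subseteq> ?E"
    proof
      fix e assume "e \<in> edges B"
      then obtain x y where e: "e = {x, y}" "adj B x y" using edges_eq by blast
      have mem: "{x, y} \<in> ?E" if "i < 2" "j < 2" "i \<noteq> j" "x \<in> [X, Y] ! i" "y \<in> [X, Y] ! j" for x y i j
        using that by (auto simp: numeral_eq_Suc)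
      have "x \<in> X \<union> Y" "y \<in> X \<union> Y" using adj_verts e(2) assms(2) by blast+
      then consider "x \<in> X" "y \<in> Y" | "x \<in> Y" "y \<in> X" using indep e(2) by blast
      then show "e \<in> ?E" unfolding e(1)
        by cases (rule mem[of 0 1] mem[of 1 0]; simp; fail)+
    qed
  qed
  then have "is_complete_multipartite [card X, card Y] B"
    unfolding is_complete_multipartite_def using XY(1) fin assms(2)
    by (intro exI[of _ "[X, Y]"]) (auto simp: less_Suc_eq numeral_eq_Suc)
  then show ?thesis unfolding complete_bipartite_def by blast
qed

end

section \<open>Triangle-free blocks\<close>

locale triangle_free_block = unobstructed_block +
  assumes no_triangle: "\<not> triangle B a b c"
begin

lemma odd_ear':
  assumes "distinct (k # zs @ [k'])" "successively (adj B) (k # zs @ [k'])"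
    and "successively (adj B) (k' # ys @ [k])" "distinct ys" "set ys \<inter> set (k # zs @ [k']) = {}"
    and "odd (length zs + length ys)"
  shows False
proof (cases "length zs + length ys \<ge> 3")
  case False
  then have "length zs + length ys = 1" using assms(6) by presburger
  then consider z where "zs = [z]" "ys = []" | y where "zs = []" "ys = [y]"
    by (cases zs; cases ys) auto
  then show False
  proof cases
    case (1 z)
    then show False using no_triangle[of k z k'] assms adj_commute by (auto simp: triangle_def)
  next
    case (2 y)
    then show False using no_triangle[of k y k'] assms adj_commute by (auto simp: triangle_def)
  qed
qed (use odd_ear assms in blast)

text \<open>Excluding odd cycles fixes the parity of the ear. For each \<open>x\<close> in
  \<open>X\<close>, the ear and a detour through the biclique then form an even cycle on which
  \<open>z\<close> and \<open>x\<close> are at odd distance, so \<open>even_cycle\<close> supplies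
  the edge. The second vertex of \<open>Y\<close> keeps the two arcs disjoint.\<close>

lemma ear_attaches:
  assumes XY: "biclique X Y" "card X \<ge> 2" "card Y \<ge> 2"
    and ear: "k \<in> X" "k' \<in> X \<union> Y" "set (z # zs) \<inter> (X \<union> Y) = {}"
      "distinct (k # (z # zs) @ [k'])" "successively (adj B) (k # (z # zs) @ [k'])"
    and x: "x \<in> X"
  shows "adj B z x"
proof (cases "x = k")
  case True
  then show ?thesis using ear(5) by (simp add: insert_commute)
next
  case xk: False
  have disj: "X \<inter> Y = {}" and adjXY: "\<And>x y. x \<in> X \<Longrightarrow> y \<in> Y \<Longrightarrow> adj B x y \<and> adj B y x"
    using XY(1) adj_commute by (auto simp: biclique_def)
  have fin: "finite Y" using XY(3) by (metis card.infinite not_numeral_le_zero)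
  have other: "\<exists>j'\<in>Y. j' \<noteq> j" for j
  proof (rule ccontr)
    assume "\<not> (\<exists>j'\<in>Y. j' \<noteq> j)"
    then have "Y \<subseteq> {j}" by blast
    then have "card Y \<le> card {j}" by (intro card_mono) auto
    then show False using XY(3) by simp
  qed
  have tail: "successively (adj B) (z # zs @ [k'])" using ear(5) by simp
  have zk: "adj B k z" using ear(5) by simp
  note e = ear(1-4) x xk disj
  consider "k' \<in> X" | "k' \<in> Y" using ear(2) by blast
  then show ?thesis
  proof cases
    case kX: 1
    obtain j where j: "j \<in> Y" using other by blast
    obtain j' where j': "j' \<in> Y" "j' \<noteq> j" using other by blast
    have new: "j \<notin> X" "j' \<notin> X" "j \<notin> set (z # zs)" "j' \<notin> set (z # zs)" "x \<notin> set (z # zs)"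
      "k' \<notin> Y" "k \<notin> Y" "x \<notin> Y" using e kX j j' by blast+
    have "\<not> odd (length (z # zs) + length [j])"
    proof
      assume "odd (length (z # zs) + length [j])"
      then show False
        using odd_ear'[OF ear(4,5), of "[j]"] adjXY[OF kX j] adjXY[OF ear(1) j] new j e kX by auto
    qed
    then have zs: "even (length zs)" by simp
    show ?thesis
    proof (cases "x = k'")
      case True
      show ?thesis unfolding True
      proof (rule even_cycle[of _ zs _ "[j, k]"])
        show "distinct (z # zs @ k' # [j, k])" using ear(4) new j e by auto
      qed (use tail zs zk adjXY[OF kX j] adjXY[OF ear(1) j] in auto)
    next
      case False
      show ?thesis
      \<comment> \<open>One arc follows the ear to \<open>k'\<close> and crosses to \<open>x\<close>
        through \<open>j\<close>; the other returns through \<open>j'\<close> and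
        \<open>k\<close>.\<close>
      proof (rule even_cycle[of _ "zs @ [k', j]" _ "[j', k]"])
        show "distinct (z # (zs @ [k', j]) @ x # [j', k])"
          using ear(4) new j j' e kX False by auto
        have "successively (adj B) [k', j, x]" using adjXY[OF kX j] adjXY[OF x j] by simp
        then show "successively (adj B) (z # (zs @ [k', j]) @ [x])"
          using ear_append[OF tail, of "[j, x]"] by simp
      qed (use zs zk adjXY[OF x j'(1)] adjXY[OF ear(1) j'(1)] in auto)
    qed
  next
    case kY: 2
    obtain j where j: "j \<in> Y" "j \<noteq> k'" using other by blast
    have new: "j \<notin> X" "j \<notin> set (z # zs)" "x \<notin> set (z # zs)" "k' \<notin> X" "k \<notin> Y" "x \<notin> Y"
      using e kY j by blast+
    have "\<not> odd (length (z # zs) + length ([] :: 'a list))"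
    proof
      assume "odd (length (z # zs) + length ([] :: 'a list))"
      then show False using odd_ear'[OF ear(4,5), of "[]"] adjXY[OF ear(1) kY] by auto
    qed
    then have zs: "odd (length zs)" by simp
    show ?thesis
    proof (rule even_cycle[of _ "zs @ [k']" _ "[j, k]"])
      show "distinct (z # (zs @ [k']) @ x # [j, k])"
        using ear(4) new j e kY by auto
      show "successively (adj B) (z # (zs @ [k']) @ [x])"
        using ear_append[OF tail, of "[x]"] adjXY[OF x kY] by simp
    qed (use zs zk adjXY[OF x j(1)] adjXY[OF ear(1) j(1)] in auto)
  qed
qed

text \<open>Take a largest biclique with at least two vertices on each side. An ear on it would
  attach its first inner vertex to a whole side and enlarge the biclique, so it is spanning. One or
  two vertices form separate cases, because a starting biclique needs a cycle.\<close>

lemma complete_bipartite: "complete_bipartite B"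
proof -
  have conn: "connected_graph B" using block by (simp add: conn_without_cut_vertex_def)
  then obtain a0 where a0: "a0 \<in> verts B" by (auto simp: connected_graph_def)
  show ?thesis
  proof (cases "verts B = {a0}")
    case True
    show ?thesis
    proof (rule complete_bipartite_if_biclique[of "{a0}" "{}"])
      show "\<And>x x'. x \<in> {a0} \<Longrightarrow> x' \<in> {a0} \<Longrightarrow> \<not> adj B x x'" using adj_irrefl by blast
    qed (use True in \<open>auto simp: biclique_def\<close>)
  next
    case False
    then obtain b0 where b0: "b0 \<in> verts B" "b0 \<noteq> a0" using a0 by blast
    have "(a0, b0) \<in> {(x, y). adj B x y}\<^sup>*"
      using joined_connected[OF conn a0 b0(1)] by (simp add: joined_def)
    then obtain b where ab: "adj B a0 b" using b0(2) by (auto elim: converse_rtranclE)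
    show ?thesis
    proof (cases "verts B = {a0, b}")
      case True
      show ?thesis
      proof (rule complete_bipartite_if_biclique[of "{a0}" "{b}"])
        show "biclique {a0} {b}" using ab adj_irrefl adj_verts by (auto simp: biclique_def)
      qed (use True adj_irrefl in auto)
    next
      case False
      have "a0 \<noteq> b" "{a0, b} \<subseteq> verts B" using ab adj_irrefl adj_verts by auto
      then obtain k zs k' where ear: "k \<in> {a0, b}" "k' \<in> {a0, b}" "zs \<noteq> []" "set zs \<inter> {a0, b} = {}"
        "distinct (k # zs @ [k'])" "successively (adj B) (k # zs @ [k'])"
        using ear_exists[OF simple block _ False[symmetric], of a0 b] by (metis insertCI)
      have kk: "adj B k' k" "adj B k k'" using ear(1,2,5) ab adj_commute by auto
      have "\<not> odd (length zs + length ([] :: 'a list))"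
      proof
        assume "odd (length zs + length ([] :: 'a list))"
        then show False using odd_ear'[OF ear(5,6), of "[]"] kk by auto
      qed
      then have even: "even (length zs)" by simp
      then obtain z1 z2 zs' where zs: "zs = z1 # z2 # zs'"
        using ear(3) by (cases zs; cases "tl zs") auto
      \<comment> \<open>On the even cycle \<open>k', k, z1, z2, zs'\<close> the vertices
        \<open>k'\<close> and \<open>z2\<close> are at odd distance. The edge between them cuts off
        the 4-cycle that starts the maximisation.\<close>
      have kz2: "adj B k' z2"
      proof (rule even_cycle[of _ "[k, z1]" _ zs'])
        show "distinct (k' # [k, z1] @ z2 # zs')" using ear(5) zs by auto
      qed (use ear(6) zs kk even in auto)
      have "biclique {k, z2} {z1, k'}"
        using ear(5,6) kk kz2 adj_commute adj_verts unfolding zs biclique_def by auto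
      moreover have "card {k, z2} \<ge> 2" "card {z1, k'} \<ge> 2" using ear(5) unfolding zs by auto
      ultimately have ex: "biclique {k, z2} {z1, k'} \<and> card {k, z2} \<ge> 2 \<and> card {z1, k'} \<ge> 2" by blast
      have bound: "biclique X Y \<Longrightarrow> card X + card Y \<le> card (verts B)" for X Y
        using card_Un_disjoint[of X Y] finite_subset[OF _ finite_verts] card_mono[OF finite_verts, of "X \<union> Y"]
        by (auto simp: biclique_def)
      let ?Q = "\<lambda>p. biclique (fst p) (snd p) \<and> card (fst p) \<ge> 2 \<and> card (snd p) \<ge> 2"
      have "\<exists>p. ?Q p \<and> (\<forall>q. ?Q q \<longrightarrow> card (fst q) + card (snd q) \<le> card (fst p) + card (snd p))"
        by (rule ex_has_greatest_nat[of ?Q "({k, z2}, {z1, k'})" _ "card (verts B) + 1"])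
          (use ex bound in \<open>auto simp: less_Suc_eq_le\<close>)
      then obtain X Y where XY: "biclique X Y" "card X \<ge> 2" "card Y \<ge> 2"
        and max: "\<And>X' Y'. biclique X' Y' \<Longrightarrow> card X' \<ge> 2 \<Longrightarrow> card Y' \<ge> 2 \<Longrightarrow>
          card X' + card Y' \<le> card X + card Y" by auto
      \<comment> \<open>Formulated for any biclique of maximal total size, so that it also applies
        with the two sides interchanged when the ear begins in \<open>Y\<close>.\<close>
      have no_ear: False
        if XY: "biclique X' Y'" "card X' \<ge> 2" "card Y' \<ge> 2" "card X' + card Y' = card X + card Y"
          and ear: "k \<in> X'" "k' \<in> X' \<union> Y'" "zs \<noteq> []" "set zs \<inter> (X' \<union> Y') = {}"
           "distinct (k # zs @ [k'])" "successively (adj B) (k # zs @ [k'])" for X' Y' k k' zs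
      proof -
        obtain z zs' where zs: "zs = z # zs'" using ear(3) by (cases zs) auto
        have "adj B z x" if "x \<in> X'" for x
          using ear_attaches[OF XY(1-3) ear(1,2) _ _ _ that, of z zs'] ear zs by simp
        then have "biclique X' (insert z Y')"
          using XY(1) ear(4) adj_verts XY(2) adj_commute ear(1) unfolding zs biclique_def by auto
        moreover have "finite Y'" using XY(3) by (metis card.infinite not_numeral_le_zero)
        then have "card (insert z Y') = Suc (card Y')" using ear(4) zs by auto
        ultimately show False using max[of X' "insert z Y'"] XY by simp
      qed
      have "X \<union> Y = verts B"
      proof (rule ccontr)
        assume neq: "X \<union> Y \<noteq> verts B"
        obtain x1 x2 where "x1 \<in> X" "x2 \<in> X" "x1 \<noteq> x2"
          using XY(2) card_le_Suc0_iff_eq[of X]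
          by (metis card.infinite not_less_eq_eq not_numeral_le_zero numeral_2_eq_2)
        moreover have "X \<union> Y \<subseteq> verts B" using XY(1) by (auto simp: biclique_def)
        ultimately obtain k zs k' where ear: "k \<in> X \<union> Y" "k' \<in> X \<union> Y" "zs \<noteq> []" "set zs \<inter> (X \<union> Y) = {}"
          "distinct (k # zs @ [k'])" "successively (adj B) (k # zs @ [k'])"
          using ear_exists[OF simple block _ neq, of x1 x2] by (metis UnCI)
        show False
        proof (cases "k \<in> X")
          case True
          then show False using no_ear[OF XY refl True ear(2-)] by blast
        next
          case False
          then show False
            using no_ear[OF biclique_sym[OF XY(1)] XY(3,2), of k k' zs] ear by (auto simp: Un_commute)
        qed
      qed
      moreover obtain x0 y0 where "x0 \<in> X" "y0 \<in> Y" using XY(2,3) by fastforce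
      ultimately show ?thesis
      proof (intro complete_bipartite_if_biclique[OF XY(1)])
        fix x x' assume "x \<in> X" "x' \<in> X"
        then show "\<not> adj B x x'"
          using no_triangle[of x x' y0] XY(1) \<open>y0 \<in> Y\<close> by (auto simp: biclique_def triangle_def)
      next
        fix y y' assume "y \<in> Y" "y' \<in> Y"
        then show "\<not> adj B y y'"
          using no_triangle[of y y' x0] biclique_sym[OF XY(1)] \<open>x0 \<in> X\<close>
          by (auto simp: biclique_def triangle_def)
      qed auto
    qed
  qed
qed

end

lemma block_classification:
  assumes "simple_graph B" "conn_without_cut_vertex B" "\<not> obstructed (matchable_sets B)"
  shows "complete_bipartite B \<or>
    (\<exists>a b c. triangle B a b c) \<and> (is_complete 4 B \<or> (\<exists>n\<ge>1. is_complete_multipartite [1, 1, n] B))"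
proof -
  interpret unobstructed_block B by unfold_locales (fact assms)+
  show ?thesis
  proof (cases "\<exists>a b c. triangle B a b c")
    case True
    then show ?thesis using multipartite_1_1 by blast
  next
    case False
    then interpret triangle_free_block B by unfold_locales blast
    show ?thesis using complete_bipartite by blast
  qed
qed

section \<open>Maximality of blocks\<close>

lemma edge_conn_without_cut_vertex:
  assumes "simple_graph G" "adj G u v"
  shows "subgraph_of (induced G {u, v}) G" "conn_without_cut_vertex (induced G {u, v})"
proof -
  have uv: "u \<noteq> v" "u \<in> verts G" "v \<in> verts G" using adjD[OF assms] by blast+
  let ?E = "induced G {u, v}"
  show "subgraph_of ?E G"
    using uv assms(1) by (auto simp: subgraph_of_def induced_def simple_graph_def)
  have "adj ?E u v" "adj ?E v u" using assms(2) by (auto simp: adj_induced insert_commute)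
  then have "joined ?E x y" if "x \<in> {u, v}" "y \<in> {u, v}" for x y
    using that by (auto simp: joined_def)
  moreover have "\<not> cut_vertex ?E w" for w
    by (auto simp: cut_vertex_def disconnected_graph_def joined_def)
  ultimately show "conn_without_cut_vertex ?E"
    by (auto simp: conn_without_cut_vertex_def connected_graph_def disconnected_graph_def)
qed

lemma subgraph_trans: "subgraph_of A B \<Longrightarrow> subgraph_of B C \<Longrightarrow> subgraph_of A C"
  by (auto simp: subgraph_of_def)

lemma joined_mono:
  assumes "joined H x y" "edges H \<subseteq> edges H'"
  shows "joined H' x y"
proof -
  have "{(x, y). {x, y} \<in> edges H}\<^sup>* \<subseteq> {(x, y). {x, y} \<in> edges H'}\<^sup>*"
    using assms(2) by (intro rtrancl_mono) auto
  then show ?thesis using assms(1) by (auto simp: joined_def)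
qed

lemma joined_trans: "joined H x y \<Longrightarrow> joined H y z \<Longrightarrow> joined H x z"
  by (auto simp: joined_def)

lemma joined_sym:
  assumes "joined H x y"
  shows "joined H y x"
proof -
  have "sym {(x, y). {x, y} \<in> edges H}" by (auto simp: sym_def insert_commute)
  then show ?thesis using assms by (auto simp: joined_def dest: sym_rtrancl[THEN symD])
qed

lemma conn_without_cut_vertex_mono:
  assumes "conn_without_cut_vertex H" "verts H' = verts H" "edges H \<subseteq> edges H'"
  shows "conn_without_cut_vertex H'"
proof -
  have sub: "edges (induced H U) \<subseteq> edges (induced H' U)" for U
    using assms(3) by (auto simp: induced_def)
  have "joined H' x y" if "x \<in> verts H'" "y \<in> verts H'" for x y
    using that assms(1,2) joined_connected[of H x y]
    by (intro joined_mono[OF _ assms(3)]) (simp add: conn_without_cut_vertex_def)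
  moreover have "verts H' \<noteq> {}"
    using assms(1,2) by (simp add: conn_without_cut_vertex_def connected_graph_def)
  moreover have "\<not> cut_vertex H' v" for v
  proof
    assume v: "cut_vertex H' v"
    then obtain x y where xy: "x \<in> verts H' - {v}" "y \<in> verts H' - {v}"
      "\<not> joined (induced H' (verts H' - {v})) x y"
      by (auto simp: cut_vertex_def disconnected_graph_def)
    then have "\<not> joined (induced H (verts H - {v})) x y"
      using joined_mono[OF _ sub] assms(2) by metis
    then have "cut_vertex H v"
      using xy v assms(2) by (auto simp: cut_vertex_def disconnected_graph_def)
    then show False using assms(1) by (simp add: conn_without_cut_vertex_def)
  qed
  ultimately show ?thesis
    by (simp add: conn_without_cut_vertex_def connected_graph_def disconnected_graph_def)
qed

lemma induced_self:
  assumes "simple_graph H"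
  shows "induced H (verts H) = H"
proof -
  have "{e \<in> edges H. e \<subseteq> verts H} = edges H" using assms by (auto simp: simple_graph_def)
  then show ?thesis by (simp add: induced_def)
qed

lemma blocksD:
  assumes "B \<in> blocks G"
  shows "subgraph_of B G" "conn_without_cut_vertex B"
    "\<And>B'. subgraph_of B' G \<Longrightarrow> conn_without_cut_vertex B' \<Longrightarrow> subgraph_of B B' \<Longrightarrow> B' = B"
  using assms by (auto simp: blocks_def)

text \<open>Adding edges on the same vertex set creates no cut vertex, so a subgraph that is maximal
  already has all of them.\<close>

lemma block_induced:
  assumes "simple_graph G" "B \<in> blocks G"
  shows "B = induced G (verts B)"
proof (rule sym, rule blocksD(3)[OF assms(2)])
  have sub: "simple_graph B" "verts B \<subseteq> verts G" "edges B \<subseteq> edges G"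
    using blocksD(1)[OF assms(2)] by (auto simp: subgraph_of_def)
  have e: "edges B \<subseteq> edges (induced G (verts B))"
    using sub by (auto simp: induced_def simple_graph_def)
  show "subgraph_of (induced G (verts B)) G"
    using simple_induced[OF assms(1) sub(2)] sub by (auto simp: subgraph_of_def induced_def)
  show "conn_without_cut_vertex (induced G (verts B))"
    by (rule conn_without_cut_vertex_mono[OF blocksD(2)[OF assms(2)] _ e]) simp
  show "subgraph_of B (induced G (verts B))"
    using sub e by (auto simp: subgraph_of_def)
qed

text \<open>The subgraph induced on the union has no cut vertex: whichever vertex is deleted, one of
  \<open>x\<close> and \<open>y\<close> survives and connects what is left of both blocks.
  Maximality makes each block equal to it.\<close>

lemma blocks_share_two_eq:
  assumes G: "simple_graph G" and B: "B1 \<in> blocks G" "B2 \<in> blocks G"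
    and two: "x \<noteq> y" "x \<in> verts B1" "y \<in> verts B1" "x \<in> verts B2" "y \<in> verts B2"
  shows "B1 = B2"
proof -
  let ?U = "verts B1 \<union> verts B2"
  let ?H = "induced G ?U"
  note d1 = blocksD[OF B(1)] and d2 = blocksD[OF B(2)]
  have s: "simple_graph B1" "simple_graph B2" "verts B1 \<subseteq> verts G" "verts B2 \<subseteq> verts G"
    "edges B1 \<subseteq> edges G" "edges B2 \<subseteq> edges G"
    using d1(1) d2(1) by (auto simp: subgraph_of_def)
  have e: "edges B1 \<subseteq> edges ?H" "edges B2 \<subseteq> edges ?H"
    using s by (auto simp: induced_def simple_graph_def)
  have sH: "subgraph_of ?H G"
    using simple_induced[OF G, of ?U] s by (auto simp: subgraph_of_def induced_def)
  have minus: "joined (induced ?H (?U - {v})) p q"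
    if pq: "p \<in> ?U - {v}" "q \<in> ?U - {v}" for v p q
  proof -
    let ?J = "joined (induced ?H (?U - {v}))"
    have side: "?J p' q'" if "B \<in> {B1, B2}" "p' \<in> verts B - {v}" "q' \<in> verts B - {v}" for B p' q'
    proof -
      have B: "conn_without_cut_vertex B" "simple_graph B" "verts B \<subseteq> ?U" "edges B \<subseteq> edges ?H"
        using that(1) d1(2) d2(2) s e by auto
      have "joined (induced B (verts B - {v})) p' q'"
      proof (cases "v \<in> verts B")
        case True
        then show ?thesis using B(1) that(2,3)
          by (auto simp: conn_without_cut_vertex_def cut_vertex_def disconnected_graph_def)
      next
        case False
        have "induced B (verts B - {v}) = B"
          using False induced_self[OF B(2)] by simp
        then show ?thesis using joined_connected[of B] B(1) that(2,3)
          by (simp add: conn_without_cut_vertex_def)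
      qed
      then show ?thesis by (rule joined_mono) (use B(3,4) in \<open>auto simp: induced_def\<close>)
    qed
    obtain w where w: "w \<in> verts B1 - {v}" "w \<in> verts B2 - {v}" using two by (cases "x = v") blast+
    have to_w: "?J r w" if "r \<in> ?U - {v}" for r
      using that side[of B1 r w] side[of B2 r w] w by blast
    show ?thesis by (rule joined_trans[OF to_w[OF pq(1)] joined_sym[OF to_w[OF pq(2)]]])
  qed
  have "joined ?H p q" if "p \<in> ?U" "q \<in> ?U" for p q
  proof -
    have B: "joined ?H p' q'" if "B \<in> {B1, B2}" "p' \<in> verts B" "q' \<in> verts B" for B p' q'
    proof (rule joined_mono)
      have "connected_graph B" using that(1) d1(2) d2(2) by (auto simp: conn_without_cut_vertex_def)
      then show "joined B p' q'" using that(2,3) by (rule joined_connected)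
      show "edges B \<subseteq> edges ?H" using that(1) e by blast
    qed
    have to_x: "joined ?H r x" if "r \<in> ?U" for r
      using that B[of B1 r x] B[of B2 r x] two by blast
    show ?thesis by (rule joined_trans[OF to_x[OF that(1)] joined_sym[OF to_x[OF that(2)]]])
  qed
  then have "connected_graph ?H"
    using two by (auto simp: connected_graph_def disconnected_graph_def)
  moreover have "\<not> cut_vertex ?H v" for v
    using minus[of _ v] by (auto simp: cut_vertex_def disconnected_graph_def)
  ultimately have c: "conn_without_cut_vertex ?H" by (simp add: conn_without_cut_vertex_def)
  have "subgraph_of B1 ?H" "subgraph_of B2 ?H" using s e by (auto simp: subgraph_of_def)
  then have "?H = B1" "?H = B2" using d1(3)[OF sH c] d2(3)[OF sH c] by blast+
  then show ?thesis by simp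
qed

text \<open>The exceptional set consists of the blocks that are not complete bipartite. Each
  contains a triangle, any two triangles share two vertices, and two common vertices identify the
  blocks.\<close>

theorem block_structure_if_unobstructed:
  assumes G: "simple_graph G" "connected_graph G" "\<not> obstructed (matchable_sets G)"
  shows "\<exists>X. X \<subseteq> blocks G \<and> finite X \<and> card X \<le> 1 \<and>
       (\<forall>B \<in> blocks G - X. complete_bipartite B) \<and>
       (\<forall>B \<in> X. is_complete 4 B \<or> (\<exists>n\<ge>1. is_complete_multipartite [1, 1, n] B))"
proof -
  have fin: "finite (matchable_sets G)"
    using G(1) by (auto simp: matchable_sets_def simple_graph_def intro: finite_subset[of _ "Pow (verts G)"])
  have cls: "complete_bipartite B \<or>
    (\<exists>a b c. triangle B a b c) \<and> (is_complete 4 B \<or> (\<exists>n\<ge>1. is_complete_multipartite [1, 1, n] B))"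
    if B: "B \<in> blocks G" for B
  proof (rule block_classification)
    show "simple_graph B" "conn_without_cut_vertex B"
      using blocksD[OF B] by (auto simp: subgraph_of_def)
    have "verts B \<subseteq> verts G" using blocksD[OF B] by (auto simp: subgraph_of_def)
    then show "\<not> obstructed (matchable_sets B)"
      using obstructed_induced[OF fin, of "verts B"] block_induced[OF G(1) B] G(3) by auto
  qed
  let ?X = "{B \<in> blocks G. \<not> complete_bipartite B}"
  have one: "B1 = B2" if B: "B1 \<in> ?X" "B2 \<in> ?X" for B1 B2
  proof -
    obtain a b c x y z where t: "triangle B1 a b c" "triangle B2 x y z"
      using cls B by blast
    have s: "simple_graph B1" "simple_graph B2" "edges B1 \<subseteq> edges G" "edges B2 \<subseteq> edges G"
      using B blocksD(1) by (auto simp: subgraph_of_def)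
    have "card ({a, b, c} \<inter> {x, y, z}) \<ge> 2"
      using t s by (intro triangles_share_two[OF G]) (auto simp: triangle_def)
    then have "\<not> card ({a, b, c} \<inter> {x, y, z}) \<le> Suc 0" by simp
    then obtain p q where "p \<noteq> q" "p \<in> {a, b, c} \<inter> {x, y, z}" "q \<in> {a, b, c} \<inter> {x, y, z}"
      by (subst (asm) card_le_Suc0_iff_eq) auto
    moreover have "{a, b, c} \<subseteq> verts B1" "{x, y, z} \<subseteq> verts B2"
      using t adjD[OF s(1)] adjD[OF s(2)] unfolding triangle_def by blast+
    ultimately show ?thesis using blocks_share_two_eq[OF G(1), of B1 B2 p q] B by blast
  qed
  have "finite ?X \<and> card ?X \<le> 1"
  proof (cases "?X = {}")
    case True
    show ?thesis unfolding True by simp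
  next
    case False
    then obtain B where "B \<in> ?X" by blast
    then have X: "?X = {B}" using one by blast
    show ?thesis unfolding X by simp
  qed
  then show ?thesis using cls by (intro exI[of _ ?X]) blast
qed

section \<open>Exchange in balanced and in even sets\<close>

text \<open>Whether a degree is zero, or equal to the size, depends only on which sets occur and not
  on their multiplicities. So the bounds that \<open>T\<close> imposes on \<open>M\<close> pass to
  \<open>D\<close>.\<close>

lemma exchange_bounds:
  assumes "same_fiber M (add_mset T N)" "set_mset D = set_mset M"
  shows "of_bool (i \<in> T) \<le> deg D i" "deg D i + 1 \<le> size D + of_bool (i \<in> T)" "D \<noteq> {#}"
proof -
  have size: "size M = Suc (size N)" and deg: "deg M i = of_bool (i \<in> T) + deg N i"
    using assms(1) by (simp_all add: same_fiber_def)
  have "M \<noteq> {#}" using size by auto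
  then show "D \<noteq> {#}" using assms(2) by auto
  show "of_bool (i \<in> T) \<le> deg D i"
  proof (cases "i \<in> T")
    case True
    then have "deg M i \<noteq> 0" using deg by simp
    then have "deg D i \<noteq> 0" unfolding deg_eq_0_iff assms(2) .
    then show ?thesis using True by simp
  qed simp
  show "deg D i + 1 \<le> size D + of_bool (i \<in> T)"
  proof (cases "i \<in> T")
    case True
    then show ?thesis using deg_le_size[of D i] by simp
  next
    case False
    then have "deg M i \<noteq> size M" using deg size deg_le_size[of N i] by simp
    then have "deg D i \<noteq> size D" unfolding deg_eq_size_iff assms(2) .
    then show ?thesis using False deg_le_size[of D i] by simp
  qed
qed

text \<open>For finite disjoint \<open>X\<close> and \<open>Y\<close> these are the matchable sets
  of the complete bipartite graph with these parts.\<close>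

definition balanced_sets :: "'a set \<Rightarrow> 'a set \<Rightarrow> 'a set set" where
  "balanced_sets X Y = {S. S \<subseteq> X \<union> Y \<and> card (S \<inter> X) = card (S \<inter> Y)}"

text \<open>After multiplication by \<open>k\<close> the two sides are separated by the common value
  of the sums. It is also used with \<open>X = Y\<close>, so that one cardinality fits between all
  full sets and all supports.\<close>

lemma card_full_le_card_support:
  fixes x :: "'a \<Rightarrow> nat"
  assumes "finite X" "finite Y" "k > 0" "\<forall>i\<in>Y. x i \<le> k" "sum x X = sum x Y"
  shows "card {i \<in> X. x i = k} \<le> card {i \<in> Y. x i \<ge> 1}"
proof -
  have "card {i \<in> X. x i = k} * k = sum x {i \<in> X. x i = k}" by simp
  also have "\<dots> \<le> sum x X" using assms(1) by (intro sum_mono2) auto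
  also have "\<dots> = sum x Y" by (rule assms(5))
  also have "\<dots> = sum x {i \<in> Y. x i \<ge> 1}" using assms(2) by (intro sum.mono_neutral_right) auto
  also have "\<dots> \<le> card {i \<in> Y. x i \<ge> 1} * k"
    using sum_bounded_above[of "{i \<in> Y. x i \<ge> 1}" x k] assms(4) by simp
  finally show ?thesis using assms(3) by simp
qed

text \<open>To split a vector into \<open>k\<close> balanced sets, a single one of them may be taken first as soon
  as it contains every index of full weight \<open>k\<close> and lies in the support.\<close>

lemma balanced_peel:
  fixes x :: "'a \<Rightarrow> nat"
  assumes "finite X" "finite Y" "X \<inter> Y = {}" "k > 0" "\<forall>i\<in>X \<union> Y. x i \<le> k" "sum x X = sum x Y"
  obtains S where "S \<in> balanced_sets X Y" "\<And>i. i \<in> X \<union> Y \<Longrightarrow> x i = k \<Longrightarrow> i \<in> S"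
    "\<And>i. i \<in> S \<Longrightarrow> x i \<ge> 1"
proof -
  define F where "F Z = {i \<in> Z. x i = k}" for Z
  define P where "P Z = {i \<in> Z. x i \<ge> 1}" for Z
  \<comment> \<open>The common cardinality of the two halves: the least that accommodates the full
    indices on both sides.\<close>
  define c where "c = max (card (F X)) (card (F Y))"
  have "card (F Z) \<le> card (P Z')" if "Z \<in> {X, Y}" "Z' \<in> {X, Y}" for Z Z'
    unfolding F_def P_def by (rule card_full_le_card_support) (use that assms in auto)
  then have c: "c \<le> card (P X)" "c \<le> card (P Y)" "card (F X) \<le> c" "card (F Y) \<le> c"
    by (auto simp: c_def)
  have FP: "F Z \<subseteq> P Z" "finite (P X)" "finite (P Y)" for Z
    using assms(1,2,4) by (auto simp: F_def P_def)
  obtain A where A: "F X \<subseteq> A" "A \<subseteq> P X" "card A = c"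
    using exists_subset_between[OF c(3,1) FP(1,2)] by blast
  obtain C where C: "F Y \<subseteq> C" "C \<subseteq> P Y" "card C = c"
    using exists_subset_between[OF c(4,2) FP(1,3)] by blast
  have "A \<subseteq> X" "C \<subseteq> Y" using A C by (auto simp: P_def)
  then have "(A \<union> C) \<inter> X = A" "(A \<union> C) \<inter> Y = C" using assms(3) by blast+
  then have "A \<union> C \<in> balanced_sets X Y"
    using A(3) C(3) \<open>A \<subseteq> X\<close> \<open>C \<subseteq> Y\<close> by (auto simp: balanced_sets_def)
  moreover have "\<And>i. i \<in> X \<union> Y \<Longrightarrow> x i = k \<Longrightarrow> i \<in> A \<union> C" using A C by (auto simp: F_def)
  moreover have "\<And>i. i \<in> A \<union> C \<Longrightarrow> x i \<ge> 1" using A C by (auto simp: P_def)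
  ultimately show ?thesis by (rule that)
qed

text \<open>An integer decomposition property: peeling off one balanced set lowers the bound
  \<open>k\<close> by one and keeps the two sums equal.\<close>

lemma balanced_decomposition:
  fixes x :: "'a \<Rightarrow> nat"
  assumes "finite X" "finite Y" "X \<inter> Y = {}" "\<forall>i\<in>X \<union> Y. x i \<le> k" "sum x X = sum x Y"
  shows "\<exists>N. set_mset N \<subseteq> balanced_sets X Y \<and> size N = k \<and> (\<forall>i\<in>X \<union> Y. deg N i = x i)"
  using assms(4,5)
proof (induction k arbitrary: x)
  case 0
  then show ?case by (intro exI[of _ "{#}"]) auto
next
  case (Suc k)
  obtain S where S: "S \<in> balanced_sets X Y" "\<And>i. i \<in> X \<union> Y \<Longrightarrow> x i = Suc k \<Longrightarrow> i \<in> S"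
    "\<And>i. i \<in> S \<Longrightarrow> x i \<ge> 1"
    using balanced_peel[OF assms(1-3) _ Suc.prems] by blast
  define x' where "x' i = x i - of_bool (i \<in> S)" for i
  have x: "x i = x' i + of_bool (i \<in> S)" for i using S(3)[of i] by (auto simp: x'_def)
  have sum: "sum x Z = sum x' Z + card (S \<inter> Z)" if "finite Z" for Z
    using that by (simp add: x sum.distrib Int_commute)
  have "sum x' X = sum x' Y"
    using sum[OF assms(1)] sum[OF assms(2)] Suc.prems(2) S(1) by (simp add: balanced_sets_def)
  moreover have "\<forall>i\<in>X \<union> Y. x' i \<le> k"
  proof
    fix i assume i: "i \<in> X \<union> Y"
    then have "x i \<le> Suc k" using Suc.prems(1) by blast
    then show "x' i \<le> k" using S(2)[OF i] by (cases "x i = Suc k") (auto simp: x'_def)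
  qed
  ultimately obtain N where "set_mset N \<subseteq> balanced_sets X Y" "size N = k" "\<forall>i\<in>X \<union> Y. deg N i = x' i"
    using Suc.IH by blast
  then show ?case using S(1) x by (intro exI[of _ "add_mset S N"]) auto
qed

text \<open>Subtracting \<open>T\<close> from the degree vector of \<open>D\<close> leaves a vector
  with entries between 0 and \<open>size D - 1\<close>, by \<open>exchange_bounds\<close>, and with
  equal sums over \<open>X\<close> and \<open>Y\<close>. Such a vector decomposes.\<close>

lemma exchange_balanced:
  assumes "finite X" "finite Y" "X \<inter> Y = {}"
  shows "exchange_property (balanced_sets X Y)"
proof (rule exchange_propertyI)
  fix T M N D
  let ?W = "balanced_sets X Y"
  assume T: "T \<in> ?W" and M: "set_mset M \<subseteq> ?W" and N: "set_mset N \<subseteq> ?W"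
    and MN: "same_fiber M (add_mset T N)" and D: "set_mset D = set_mset M"
  note b = exchange_bounds[OF MN D]
  define x where "x i = deg D i - of_bool (i \<in> T)" for i
  have x: "deg D i = x i + of_bool (i \<in> T)" for i using b(1)[of i] by (simp add: x_def)
  have sum: "sum x Z + card (T \<inter> Z) = (\<Sum>S\<in>#D. card (S \<inter> Z))" if "finite Z" for Z
    unfolding sum_deg[OF that, symmetric] x using that by (simp add: sum.distrib Int_commute)
  have "(\<Sum>S\<in>#D. card (S \<inter> X)) = (\<Sum>S\<in>#D. card (S \<inter> Y))"
    using D M by (intro arg_cong[of _ _ sum_mset] image_mset_cong) (auto simp: balanced_sets_def)
  then have "sum x X = sum x Y"
    using sum[OF assms(1)] sum[OF assms(2)] T by (simp add: balanced_sets_def)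
  moreover have "\<forall>i\<in>X \<union> Y. x i \<le> size D - 1"
  proof
    fix i
    show "x i \<le> size D - 1" using b(2)[of i] x[of i] by linarith
  qed
  ultimately obtain N' where N': "set_mset N' \<subseteq> ?W" "size N' = size D - 1" "\<forall>i\<in>X \<union> Y. deg N' i = x i"
    using balanced_decomposition[OF assms] by blast
  have "deg D i = deg (add_mset T N') i" for i
  proof (cases "i \<in> X \<union> Y")
    case False
    then have "deg D i = 0" "deg N' i = 0" "i \<notin> T"
      using D M N'(1) T unfolding deg_eq_0_iff by (auto simp: balanced_sets_def)
    then show ?thesis by simp
  qed (use N'(3) x in simp)
  moreover have "size D = Suc (size N')" using b(3) N'(2) by (simp add: nonempty_has_size)
  ultimately show "\<exists>N'. set_mset N' \<subseteq> ?W \<and> same_fiber D (add_mset T N')"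
    using N'(1) by (auto simp: same_fiber_def)
qed

lemma exchange_mem:
  assumes "T \<in># D" "set_mset D \<subseteq> W"
  shows "\<exists>N'. set_mset N' \<subseteq> W \<and> same_fiber D (add_mset T N')"
  using assms by (intro exI[of _ "D - {#T#}"]) (auto dest: in_diffD)

lemma split_count: "filter_mset (\<lambda>S. S \<noteq> U) M + replicate_mset (count M U) U = M"
  by (rule multiset_eqI) auto

text \<open>The excess of the degree sum over \<open>{u, v}\<close> over that on \<open>L\<close> is
  twice the multiplicity of \<open>{u, v}\<close>. This multiplicity is therefore a fiber invariant;
  its copies can be stripped, and exchange takes place among balanced sets.\<close>

lemma exchange_balanced_insert:
  assumes L: "finite L" "u \<noteq> v" "{u, v} \<inter> L = {}"
  shows "exchange_property (insert {u, v} (balanced_sets {u, v} L))"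
proof (rule exchange_propertyI)
  fix T M N D
  let ?U = "{u, v}" and ?B = "balanced_sets {u, v} L"
  let ?f = "filter_mset (\<lambda>S. S \<noteq> ?U)"
  assume T: "T \<in> insert ?U ?B" and M: "set_mset M \<subseteq> insert ?U ?B" and N: "set_mset N \<subseteq> insert ?U ?B"
    and MN: "same_fiber M (add_mset T N)" and D: "set_mset D = set_mset M"
  have U: "?U \<notin> ?B" using L by (auto simp: balanced_sets_def)
  have count: "(\<Sum>i\<in>?U. deg M i) = (\<Sum>i\<in>L. deg M i) + 2 * count M ?U"
    if "set_mset M \<subseteq> insert ?U ?B" for M
    unfolding sum_deg[OF L(1)] sum_deg[of ?U, simplified] using that
  proof (induction M)
    case (add S M)
    show ?case
    proof (cases "S = ?U")
      case True
      then have "card (S \<inter> ?U) = 2" "card (S \<inter> L) = 0" using L by auto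
      then show ?thesis using add True by simp
    next
      case False
      then have "card (S \<inter> ?U) = card (S \<inter> L)" using add.prems by (auto simp: balanced_sets_def)
      then show ?thesis using add False by simp
    qed
  qed simp
  have sub: "set_mset (add_mset T N) \<subseteq> insert ?U ?B" using T N by simp
  have "(\<Sum>i\<in>Z. deg M i) = (\<Sum>i\<in>Z. deg (add_mset T N) i)" for Z
    using MN unfolding same_fiber_def by metis
  then have c: "count M ?U = count (add_mset T N) ?U"
    using count[OF M] count[OF sub] by (metis add_left_cancel mult_cancel1 zero_neq_numeral)
  show "\<exists>N'. set_mset N' \<subseteq> insert ?U ?B \<and> same_fiber D (add_mset T N')"
  proof (cases "T = ?U")
    case True
    then have "count M ?U \<noteq> 0" using c by simp
    then have "T \<in># D" using True D by simp
    then show ?thesis using exchange_mem D M by metis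
  next
    case False
    have "same_fiber (?f M + replicate_mset (count M ?U) ?U)
        (?f (add_mset T N) + replicate_mset (count M ?U) ?U)"
      using MN split_count[of ?U M] split_count[of ?U "add_mset T N"] c by simp
    then have "same_fiber (?f M) (?f (add_mset T N))" by simp
    then have "same_fiber (?f M) (add_mset T (?f N))" using False by simp
    moreover have "set_mset (?f M) \<subseteq> ?B" "set_mset (?f N) \<subseteq> ?B" "set_mset (?f D) = set_mset (?f M)"
      using M N D by auto
    moreover have "T \<in> ?B" using T False by blast
    moreover have "exchange_property ?B" using L by (intro exchange_balanced) auto
    ultimately obtain N' where N': "set_mset N' \<subseteq> ?B" "same_fiber (?f D) (add_mset T N')"
      using exchange_propertyD by metis
    let ?N = "N' + replicate_mset (count D ?U) ?U"
    have "same_fiber (?f D + replicate_mset (count D ?U) ?U) (add_mset T N' + replicate_mset (count D ?U) ?U)"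
      using N'(2) by (simp only: same_fiber_add_cancel)
    then have "same_fiber D (add_mset T ?N)" unfolding split_count by simp
    moreover have "set_mset ?N \<subseteq> insert ?U ?B" using N'(1) by (auto split: if_splits)
    ultimately show ?thesis by blast
  qed
qed

section \<open>Even subsets of a 4-set\<close>

definition even_sets :: "'a set \<Rightarrow> 'a set set" where
  "even_sets V = {S. S \<subseteq> V \<and> even (card S)}"

text \<open>The even subsets of a 4-set are the vertices of a 16-cell, with complementary sets as
  antipodal vertices. All linear relations between them come from \<open>S + (V - S) = V\<close>.\<close>

lemma even_sets_count:
  assumes V: "card V = 4" and S: "S \<in> even_sets V" and M: "set_mset M \<subseteq> even_sets V"
  shows "(\<Sum>i\<in>S. deg M i) + card (V - S) * size M + 2 * count M (V - S) =
    2 * size M + 2 * count M S + (\<Sum>i\<in>V - S. deg M i)"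
proof -
  have fin: "finite V" using V by (simp add: card_ge_0_finite)
  then have finS: "finite S" "finite (V - S)" using S by (auto simp: even_sets_def intro: finite_subset)
  have cV: "card S + card (V - S) = 4"
    using S V fin card_Diff_subset[OF finS(1), of V] card_mono[OF fin, of S] by (simp add: even_sets_def)
  have arith: "a + t = 2 + b"
    if h: "a \<le> s" "b \<le> t" "s + t = 4" "\<not> (a = s \<and> b = 0)" "\<not> (a = 0 \<and> b = t)" "even (a + b)" "even s"
    for a b s t :: nat
  proof -
    have "s = 0 \<or> s = 1 \<or> s = 2 \<or> s = 3 \<or> s = 4" using h(3) by linarith
    then consider "s = 0" "t = 4" | "s = 2" "t = 2" | "s = 4" "t = 0"
      using h(3,7) by auto
    then show ?thesis
    proof cases
      case 1
      then have "a = 0" "b = 0 \<or> b = 1 \<or> b = 2 \<or> b = 3 \<or> b = 4" using h(1,2) by linarith+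
      then show ?thesis using h(4-6) 1 by auto
    next
      case 2
      then have "a = 0 \<or> a = 1 \<or> a = 2" "b = 0 \<or> b = 1 \<or> b = 2" using h(1,2) by linarith+
      then show ?thesis using h(4-6) 2 by auto
    next
      case 3
      then have "b = 0" "a = 0 \<or> a = 1 \<or> a = 2 \<or> a = 3 \<or> a = 4" using h(1,2) by linarith+
      then show ?thesis using h(4-6) 3 by auto
    qed
  qed
  \<comment> \<open>Written without subtraction:
    \<open>card (R \<inter> S) - card (R - S) + card (V - S) - 2\<close> is 2 at
    \<open>R = S\<close>, -2 at the antipode and 0 at the other even sets. Up to scaling it is the
    coordinate along the axis through \<open>S\<close>.\<close>
  have one: "card (R \<inter> S) + card (V - S) + 2 * of_bool (R = V - S) =
      2 + 2 * of_bool (R = S) + card (R \<inter> (V - S))" if R: "R \<in> even_sets V" for R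
  proof -
    let ?a = "card (R \<inter> S)" and ?b = "card (R \<inter> (V - S))"
    have finR: "finite R" using R fin by (auto simp: even_sets_def intro: finite_subset)
    have "R = (R \<inter> S) \<union> (R \<inter> (V - S))" using R by (auto simp: even_sets_def)
    then have "card R = ?a + ?b"
      using finR by (metis card_Un_disjoint finite_Int Diff_disjoint inf_assoc inf_bot_right inf_left_commute)
    then have ev: "even (?a + ?b)" using R by (simp add: even_sets_def)
    have le: "?a \<le> card S" "?b \<le> card (V - S)" using finS by (auto intro: card_mono)
    have RS: "R = S \<longleftrightarrow> ?a = card S \<and> ?b = 0"
    proof
      assume *: "?a = card S \<and> ?b = 0"
      have "R \<inter> S = S" using * finS by (intro card_subset_eq) auto
      moreover have "R \<inter> (V - S) = {}" using * finR by simp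
      ultimately show "R = S" using R by (auto simp: even_sets_def)
    qed auto
    have RV: "R = V - S \<longleftrightarrow> ?a = 0 \<and> ?b = card (V - S)"
    proof
      assume *: "?a = 0 \<and> ?b = card (V - S)"
      have "R \<inter> (V - S) = V - S" using * finS by (intro card_subset_eq) auto
      moreover have "R \<inter> S = {}" using * finR by simp
      ultimately show "R = V - S" using R by (auto simp: even_sets_def)
    next
      assume "R = V - S"
      then have "R \<inter> S = {}" "R \<inter> (V - S) = V - S" by auto
      then show "?a = 0 \<and> ?b = card (V - S)" by simp
    qed
    have evS: "even (card S)" using S by (simp add: even_sets_def)
    show ?thesis
    proof (cases "R = S")
      case True
      then have "R \<noteq> V - S" using RS RV cV by auto
      then show ?thesis using True RS cV by auto
    next
      case RS': False
      show ?thesis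
      proof (cases "R = V - S")
        case True
        then show ?thesis using RV RS' cV by auto
      next
        case False
        have "\<not> (?a = card S \<and> ?b = 0)" "\<not> (?a = 0 \<and> ?b = card (V - S))"
          using RS RS' RV False by blast+
        then have "?a + card (V - S) = 2 + ?b" using arith le cV ev evS by blast
        then show ?thesis using RS' False by simp
      qed
    qed
  qed
  show ?thesis
    unfolding sum_deg[OF finS(1)] sum_deg[OF finS(2)] using M
  proof (induction M)
    case (add R M)
    have ne: "S \<noteq> V - S" using V S by (metis Diff_disjoint Diff_empty Int_absorb card.empty zero_neq_numeral)
    show ?case
      using add one[of R] ne by (cases "R = S"; cases "R = V - S") simp_all
  qed simp
qed

text \<open>An antipodal pair in \<open>D\<close> may be replaced by \<open>T\<close> and
  \<open>V - T\<close>. If \<open>M\<close> has no such pair, its axis coordinates determine it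
  within the fiber, so \<open>T\<close> must occur in \<open>M\<close> itself and hence in
  \<open>D\<close>.\<close>

lemma exchange_even_sets:
  assumes V: "card V = 4"
  shows "exchange_property (even_sets V)"
proof (rule exchange_propertyI)
  fix T M N D
  let ?W = "even_sets V"
  assume T: "T \<in> ?W" and M: "set_mset M \<subseteq> ?W" and N: "set_mset N \<subseteq> ?W"
    and MN: "same_fiber M (add_mset T N)" and D: "set_mset D = set_mset M"
  have fin: "finite V" using V by (simp add: card_ge_0_finite)
  have compl: "V - S \<in> ?W" "V - (V - S) = S" if "S \<in> ?W" for S
  proof -
    have S: "S \<subseteq> V" "even (card S)" using that by (simp_all add: even_sets_def)
    then have "card (V - S) = 4 - card S" "card S \<le> 4"
      using V fin card_mono[OF fin, of S] by (simp_all add: card_Diff_subset finite_subset)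
    then show "V - S \<in> ?W" using S(2) by (auto simp: even_sets_def)
    show "V - (V - S) = S" using S(1) by blast
  qed
  show "\<exists>N'. set_mset N' \<subseteq> ?W \<and> same_fiber D (add_mset T N')"
  proof (cases "T \<in># M")
    case True
    then show ?thesis using exchange_mem D M by metis
  next
    case TM: False
    have "\<exists>S. S \<in># M \<and> V - S \<in># M"
    proof (rule ccontr)
      assume no: "\<nexists>S. S \<in># M \<and> V - S \<in># M"
      let ?N = "add_mset T N"
      have sub: "set_mset ?N \<subseteq> ?W" using T N by simp
      have size: "size M = size ?N" and deg: "deg M = deg ?N"
        using MN unfolding same_fiber_def by (auto simp del: deg_simps)
      \<comment> \<open>Differences of multiplicities at antipodes are fiber invariants. In
        \<open>M\<close> one multiplicity of each pair is zero, so \<open>M\<close> has the least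
        possible sum on every axis.\<close>
      have diff: "count M S + count ?N (V - S) = count ?N S + count M (V - S)" if "S \<in> ?W" for S
        using even_sets_count[OF V that M] even_sets_count[OF V that sub] unfolding deg size by linarith
      have zero: "count M S = 0 \<or> count M (V - S) = 0" for S
        using no by (meson count_inI)
      have finW: "finite ?W" using fin by (auto simp: even_sets_def)
      \<comment> \<open>On the axis of \<open>T\<close> the comparison is strict, because
        \<open>T\<close> occurs only on the right. The totals, each twice the size of a multiset,
        would then differ.\<close>
      have less: "(\<Sum>S\<in>?W. count M S + count M (V - S)) < (\<Sum>S\<in>?W. count ?N S + count ?N (V - S))"
      proof (rule sum_strict_mono_ex1[OF finW])
        show "\<forall>S\<in>?W. count M S + count M (V - S) \<le> count ?N S + count ?N (V - S)"
        proof
          fix S assume "S \<in> ?W"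
          then show "count M S + count M (V - S) \<le> count ?N S + count ?N (V - S)"
            using diff[of S] zero[of S] by linarith
        qed
        have "count M T = 0" "count ?N T \<ge> 1" using TM by (simp_all add: not_in_iff)
        then show "\<exists>S\<in>?W. count M S + count M (V - S) < count ?N S + count ?N (V - S)"
          using diff[OF T] T by (intro bexI[of _ T]) linarith+
      qed
      have total: "(\<Sum>S\<in>?W. count K S + count K (V - S)) = 2 * size K" if K: "set_mset K \<subseteq> ?W" for K
      proof -
        have "(\<Sum>S\<in>?W. count K S) = size K"
          unfolding size_multiset_overloaded_eq using K finW
          by (intro sum.mono_neutral_right) (auto simp: not_in_iff)
        moreover have "(\<Sum>S\<in>?W. count K (V - S)) = (\<Sum>S\<in>?W. count K S)"
          by (rule sum.reindex_bij_witness[of _ "\<lambda>S. V - S" "\<lambda>S. V - S"]) (use compl in auto)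
        ultimately show ?thesis by (simp add: sum.distrib)
      qed
      show False using less total[OF M] total[OF sub] size by linarith
    qed
    then obtain S where S: "S \<in># M" "V - S \<in># M" by blast
    then have SW: "S \<in> ?W" "S \<subseteq> V" "T \<subseteq> V" using M T by (auto simp: even_sets_def)
    have "V \<noteq> {}" using V by auto
    then have "S \<noteq> V - S" using SW(2) by blast
    then obtain K where K: "D = add_mset S (add_mset (V - S) K)"
      using S D by (metis insert_DiffM insert_noteq_member)
    have "same_fiber D (add_mset T (add_mset (V - T) K))"
      unfolding K same_fiber_def
    proof (intro conjI allI)
      fix i
      show "deg (add_mset S (add_mset (V - S) K)) i = deg (add_mset T (add_mset (V - T) K)) i"
        using SW(2,3) by (cases "i \<in> V"; cases "i \<in> S"; cases "i \<in> T") auto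
    qed simp
    moreover have "set_mset K \<subseteq> ?W" using K D M by auto
    ultimately show ?thesis using compl(1)[OF T] by (intro exI[of _ "add_mset (V - T) K"]) auto
  qed
qed

section \<open>Gluing at a point\<close>

text \<open>Two families of sets sharing one point \<open>v\<close> are glued along it: a glued set uses \<open>v\<close> on at
  most one side. If the members of one family are balanced with respect to \<open>X\<close>, then the side
  that uses \<open>v\<close> is a linear function of the glued set, so that fibers split.\<close>

definition glue :: "'a set set \<Rightarrow> 'a set set \<Rightarrow> 'a set set" where
  "glue W1 W2 = {S1 \<union> S2 |S1 S2. S1 \<in> W1 \<and> S2 \<in> W2 \<and> S1 \<inter> S2 = {}}"

lemma glueI: "S1 \<in> W1 \<Longrightarrow> S2 \<in> W2 \<Longrightarrow> S1 \<inter> S2 = {} \<Longrightarrow> S1 \<union> S2 \<in> glue W1 W2"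
  unfolding glue_def by blast

lemma glueE:
  assumes "S \<in> glue W1 W2"
  obtains S1 S2 where "S = S1 \<union> S2" "S1 \<in> W1" "S2 \<in> W2" "S1 \<inter> S2 = {}"
  using assms unfolding glue_def by blast

text \<open>Members of \<open>A\<close> and \<open>C\<close> are paired greedily so that never both
  contain \<open>v\<close>. The bound on the two degrees at \<open>v\<close> guarantees a partner,
  and it persists because each pair uses up an occurrence of \<open>v\<close> while any is
  left.\<close>

lemma glue_multisets:
  assumes V: "\<And>S. S \<in> W1 \<Longrightarrow> S \<subseteq> V1" "\<And>S. S \<in> W2 \<Longrightarrow> S \<subseteq> V2" "V1 \<inter> V2 \<subseteq> {v}"
    and "set_mset A \<subseteq> W1" "set_mset C \<subseteq> W2" "size A = n" "size C = n" "deg A v + deg C v \<le> n"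
  shows "\<exists>N. set_mset N \<subseteq> glue W1 W2 \<and> size N = n \<and>
    (\<forall>i. deg N i = deg A i + deg C i)"
  using assms(4-)
proof (induction n arbitrary: A C)
  case 0
  then show ?case by (intro exI[of _ "{#}"]) auto
next
  case (Suc n)
  have "A \<noteq> {#}" "C \<noteq> {#}" using Suc.prems by auto
  have "\<exists>S1 S2. S1 \<in># A \<and> S2 \<in># C \<and> \<not> (v \<in> S1 \<and> v \<in> S2) \<and>
    (deg A v + deg C v = 0 \<or> v \<in> S1 \<or> v \<in> S2)"
  proof -
    consider "deg A v > 0" | "deg A v = 0" "deg C v > 0" | "deg A v = 0" "deg C v = 0" by blast
    then show ?thesis
    proof cases
      case 1
      then have "deg A v \<noteq> 0" by simp
      then obtain S1 where "S1 \<in># A" "v \<in> S1" unfolding deg_eq_0_iff by blast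
      moreover have "deg C v \<noteq> size C" using 1 Suc.prems by linarith
      then obtain S2 where "S2 \<in># C" "v \<notin> S2" unfolding deg_eq_size_iff by blast
      ultimately show ?thesis by blast
    next
      case 2
      then have "deg C v \<noteq> 0" by simp
      then obtain S2 where "S2 \<in># C" "v \<in> S2" unfolding deg_eq_0_iff by blast
      moreover obtain S1 where "S1 \<in># A" using \<open>A \<noteq> {#}\<close> by blast
      moreover have "v \<notin> S1" using 2 \<open>S1 \<in># A\<close> by (simp add: deg_eq_0_iff)
      ultimately show ?thesis by blast
    next
      case 3
      obtain S1 S2 where "S1 \<in># A" "S2 \<in># C" using \<open>A \<noteq> {#}\<close> \<open>C \<noteq> {#}\<close> by blast
      moreover have "v \<notin> S1" using 3 \<open>S1 \<in># A\<close> by (simp add: deg_eq_0_iff)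
      ultimately show ?thesis using 3 by auto
    qed
  qed
  then obtain S1 S2 where S: "S1 \<in># A" "S2 \<in># C" "\<not> (v \<in> S1 \<and> v \<in> S2)"
    "deg A v + deg C v = 0 \<or> v \<in> S1 \<or> v \<in> S2" by blast
  obtain A' where A': "A = add_mset S1 A'" using S(1) by (metis insert_DiffM)
  obtain C' where C': "C = add_mset S2 C'" using S(2) by (metis insert_DiffM)
  have "deg A' v + deg C' v \<le> n" using S(3,4) Suc.prems(5) unfolding A' C' by auto
  then obtain N where N: "set_mset N \<subseteq> glue W1 W2"
    "size N = n" "\<forall>i. deg N i = deg A' i + deg C' i"
    using Suc.IH[of A' C'] Suc.prems unfolding A' C' by auto
  have SW: "S1 \<in> W1" "S2 \<in> W2" using S Suc.prems by auto
  then have disj: "S1 \<inter> S2 = {}" using V S(3) by blast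
  have "deg (add_mset (S1 \<union> S2) N) i = deg A i + deg C i" for i
    using N(3) disj unfolding A' C' by (cases "i \<in> S1"; cases "i \<in> S2") auto
  moreover have "S1 \<union> S2 \<in> glue W1 W2" by (rule glueI[OF SW disj])
  ultimately show ?case using N by (intro exI[of _ "add_mset (S1 \<union> S2) N"]) auto
qed

text \<open>Once the degrees at \<open>v\<close> are known to split, fibers project to both sides,
  the exchange is carried out on each, and the results are paired again by
  \<open>glue_multisets\<close>.\<close>

lemma exchange_glue:
  assumes fin: "finite V2" and V: "\<And>S. S \<in> W1 \<Longrightarrow> S \<subseteq> V1" "\<And>S. S \<in> W2 \<Longrightarrow> S \<subseteq> V2" "V1 \<inter> V2 = {v}"
    and X: "v \<in> X" "\<And>S. S \<in> W2 \<Longrightarrow> card (S \<inter> X) = card (S - X)"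
    and ex: "exchange_property W1" "exchange_property W2"
  shows "exchange_property (glue W1 W2)"
proof (rule exchange_propertyI)
  fix T M N D
  let ?W = "glue W1 W2"
  assume T: "T \<in> ?W" and M: "set_mset M \<subseteq> ?W" and N: "set_mset N \<subseteq> ?W"
    and MN: "same_fiber M (add_mset T N)" and D: "set_mset D = set_mset M"
  have "\<exists>q. fst q \<in> W1 \<and> snd q \<in> W2 \<and> fst q \<inter> snd q = {} \<and> S = fst q \<union> snd q" if "S \<in> ?W" for S
  proof -
    obtain S1 S2 where "S = S1 \<union> S2" "S1 \<in> W1" "S2 \<in> W2" "S1 \<inter> S2 = {}"
      using \<open>S \<in> ?W\<close> by (rule glueE)
    then show ?thesis by (intro exI[of _ "(S1, S2)"]) simp
  qed
  then have "\<exists>p. \<forall>S\<in>?W. fst (p S) \<in> W1 \<and> snd (p S) \<in> W2 \<and> fst (p S) \<inter> snd (p S) = {} \<and>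
    S = fst (p S) \<union> snd (p S)"
    by (intro bchoice ballI)
  then obtain p where p: "\<forall>S\<in>?W. fst (p S) \<in> W1 \<and> snd (p S) \<in> W2 \<and> fst (p S) \<inter> snd (p S) = {} \<and>
    S = fst (p S) \<union> snd (p S)" by (elim exE) (rule that)
  \<comment> \<open>A decomposition is fixed for every glued set, so that projecting multisets is a
    plain image.\<close>
  define p1 p2 where "p1 S = fst (p S)" and "p2 S = snd (p S)" for S
  have pW: "p1 S \<in> W1" "p2 S \<in> W2" "p1 S \<inter> p2 S = {}" "p1 S \<union> p2 S = S" if "S \<in> ?W" for S
    using p that unfolding p1_def p2_def by metis+
  have v: "v \<in> V1" "v \<in> V2" using V(3) by auto
  have split: "deg K i = deg (image_mset p1 K) i + deg (image_mset p2 K) i" if "set_mset K \<subseteq> ?W" for K i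
    using that
  proof (induction K)
    case (add S K)
    then have S: "S \<in> ?W" "set_mset K \<subseteq> ?W" by simp_all
    have "of_bool (i \<in> S) = (of_bool (i \<in> p1 S) + of_bool (i \<in> p2 S) :: nat)"
      using pW(3,4)[OF S(1)] by (cases "i \<in> p1 S"; cases "i \<in> p2 S") auto
    then show ?case using add.IH[OF S(2)] by simp
  qed simp
  have off1: "deg (image_mset p1 K) i = 0" if K: "set_mset K \<subseteq> ?W" and i: "i \<notin> V1" for K i
    unfolding deg_eq_0_iff
  proof
    fix S assume "S \<in># image_mset p1 K"
    then obtain R where "R \<in> ?W" "S = p1 R" using K by auto
    then show "i \<notin> S" using pW(1)[of R] V(1)[of S] i by blast
  qed
  have off2: "deg (image_mset p2 K) i = 0" if K: "set_mset K \<subseteq> ?W" and i: "i \<notin> V2" for K i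
    unfolding deg_eq_0_iff
  proof
    fix S assume "S \<in># image_mset p2 K"
    then obtain R where "R \<in> ?W" "S = p2 R" using K by auto
    then show "i \<notin> S" using pW(2)[of R] V(2)[of S] i by blast
  qed
  \<comment> \<open>Degrees at points of \<open>V2\<close> other than \<open>v\<close> come from the
    second side alone, and the degree sums on and off \<open>X\<close> agree there. The share of
    \<open>v\<close> is the only unknown in this equation.\<close>
  have at_v: "deg (image_mset p2 K) v + (\<Sum>i\<in>V2 \<inter> X - {v}. deg K i) = (\<Sum>i\<in>V2 - X. deg K i)"
    if K: "set_mset K \<subseteq> ?W" for K
  proof -
    let ?K = "image_mset p2 K"
    have K2: "set_mset ?K \<subseteq> W2" using K pW(2) by auto
    have eq: "deg K i = deg ?K i" if "i \<in> V2" "i \<noteq> v" for i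
      using split[OF K, of i] off1[OF K, of i] that V(3) by auto
    have "(\<Sum>S\<in>#?K. card (S \<inter> (V2 \<inter> X))) = (\<Sum>S\<in>#?K. card (S \<inter> (V2 - X)))"
    proof (intro arg_cong[of _ _ sum_mset] image_mset_cong)
      fix S assume "S \<in># ?K"
      then have "S \<in> W2" using K2 by blast
      moreover from this have "S \<inter> (V2 \<inter> X) = S \<inter> X" "S \<inter> (V2 - X) = S - X" using V(2) by blast+
      ultimately show "card (S \<inter> (V2 \<inter> X)) = card (S \<inter> (V2 - X))" using X(2) by simp
    qed
    then have "(\<Sum>i\<in>V2 \<inter> X. deg ?K i) = (\<Sum>i\<in>V2 - X. deg ?K i)"
      using fin by (simp add: sum_deg)
    moreover have "(\<Sum>i\<in>V2 \<inter> X. deg ?K i) = deg ?K v + (\<Sum>i\<in>V2 \<inter> X - {v}. deg ?K i)"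
      using fin v X(1) by (intro sum.remove) auto
    moreover have "(\<Sum>i\<in>V2 \<inter> X - {v}. deg ?K i) = (\<Sum>i\<in>V2 \<inter> X - {v}. deg K i)"
      by (intro sum.cong refl) (use eq in auto)
    moreover have "(\<Sum>i\<in>V2 - X. deg ?K i) = (\<Sum>i\<in>V2 - X. deg K i)"
      by (intro sum.cong refl) (metis Diff_iff X(1) eq)
    ultimately show ?thesis by simp
  qed
  have fibers: "same_fiber (image_mset p1 K) (image_mset p1 L) \<and> same_fiber (image_mset p2 K) (image_mset p2 L)"
    if K: "set_mset K \<subseteq> ?W" and L: "set_mset L \<subseteq> ?W" and KL: "same_fiber K L" for K L
  proof -
    have deg: "deg K i = deg L i" and size: "size K = size L" for i
      using KL by (simp_all add: same_fiber_def)
    have 2: "deg (image_mset p2 K) i = deg (image_mset p2 L) i" for i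
    proof -
      consider "i = v" | "i \<notin> V2" | "i \<in> V2" "i \<noteq> v" by blast
      then show ?thesis
      proof cases
        case 1
        then show ?thesis using at_v[OF K] at_v[OF L] unfolding deg by simp
      next
        case 2
        then show ?thesis using off2 K L by simp
      next
        case 3
        then have "i \<notin> V1" using V(3) by blast
        then show ?thesis using split[OF K, of i] split[OF L, of i] off1 K L deg[of i] by simp
      qed
    qed
    then have "deg (image_mset p1 K) i = deg (image_mset p1 L) i" for i
      using split[OF K, of i] split[OF L, of i] deg[of i] by simp
    then show ?thesis using 2 size by (simp add: same_fiber_def)
  qed
  have TN: "set_mset (add_mset T N) \<subseteq> ?W" using T N by simp
  have DW: "set_mset D \<subseteq> ?W" using D M by simp
  have f: "same_fiber (image_mset p1 M) (add_mset (p1 T) (image_mset p1 N))"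
    "same_fiber (image_mset p2 M) (add_mset (p2 T) (image_mset p2 N))"
    using fibers[OF M TN MN] by simp_all
  have sub: "set_mset (image_mset p1 K) \<subseteq> W1" "set_mset (image_mset p2 K) \<subseteq> W2" if "set_mset K \<subseteq> ?W" for K
    using that pW by auto
  have D': "set_mset (image_mset p1 D) = set_mset (image_mset p1 M)"
    "set_mset (image_mset p2 D) = set_mset (image_mset p2 M)" using D by simp_all
  obtain N1 where N1: "set_mset N1 \<subseteq> W1" "same_fiber (image_mset p1 D) (add_mset (p1 T) N1)"
    by (rule exchange_propertyD[OF ex(1) pW(1)[OF T] sub(1)[OF M] sub(1)[OF N] f(1) D'(1)])
  obtain N2 where N2: "set_mset N2 \<subseteq> W2" "same_fiber (image_mset p2 D) (add_mset (p2 T) N2)"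
    by (rule exchange_propertyD[OF ex(2) pW(2)[OF T] sub(2)[OF M] sub(2)[OF N] f(2) D'(2)])
  have d1: "deg (image_mset p1 D) i = of_bool (i \<in> p1 T) + deg N1 i" for i
    using N1(2) by (simp add: same_fiber_def)
  have d2: "deg (image_mset p2 D) i = of_bool (i \<in> p2 T) + deg N2 i" for i
    using N2(2) by (simp add: same_fiber_def)
  have sz: "size D = Suc (size N1)" "size D = Suc (size N2)"
    using N1(2) N2(2) by (simp_all add: same_fiber_def)
  have dT: "of_bool (i \<in> T) = (of_bool (i \<in> p1 T) + of_bool (i \<in> p2 T) :: nat)" for i
    using split[of "{#T#}" i] T by simp
  have dD: "deg D i = of_bool (i \<in> T) + (deg N1 i + deg N2 i)" for i
    using split[OF DW, of i] d1[of i] d2[of i] dT[of i] by simp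
  \<comment> \<open>If all members of \<open>D\<close> contain \<open>v\<close>, then so does
    \<open>T\<close>; this leaves the room at \<open>v\<close> that the pairing needs.\<close>
  have "deg N1 v + deg N2 v \<le> size N1"
    using exchange_bounds(2)[OF MN D, of v] dD[of v] sz by simp
  then have "\<exists>N'. set_mset N' \<subseteq> ?W \<and> size N' = size N1 \<and> (\<forall>i. deg N' i = deg N1 i + deg N2 i)"
    using V(3) sz by (intro glue_multisets[OF V(1,2) _ N1(1) N2(1)]) auto
  then show "\<exists>N'. set_mset N' \<subseteq> ?W \<and> same_fiber D (add_mset T N')"
    using dD sz by (auto simp: same_fiber_def)
qed

section \<open>Splitting a graph at a cut vertex\<close>

definition colouring :: "'v sgraph \<Rightarrow> 'v set \<Rightarrow> bool" where
  "colouring G X \<longleftrightarrow> (\<forall>x y. adj G x y \<longrightarrow> (x \<in> X \<longleftrightarrow> y \<notin> X))"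

lemma colouring_balanced:
  assumes "simple_graph G" "colouring G X" "S \<in> matchable_sets G"
  shows "card (S \<inter> X) = card (S - X)"
  using assms(1,3)
proof (induction rule: matchable_induct)
  case (edge u v S)
  have "finite S" using edge finite_matchable assms(1) by blast
  moreover have "u \<in> X \<longleftrightarrow> v \<notin> X" using edge assms(2) by (simp add: colouring_def)
  ultimately show ?case using edge
    by (cases "u \<in> X") (simp_all add: insert_Diff_if)
qed simp

text \<open>Neither side is \<open>{v}\<close>, so both are proper parts of the vertex set and an
  induction on the number of vertices can descend to them.\<close>

definition separation :: "'v sgraph \<Rightarrow> 'v \<Rightarrow> 'v set \<Rightarrow> 'v set \<Rightarrow> bool" where
  "separation G v V1 V2 \<longleftrightarrow> V1 \<union> V2 = verts G \<and> V1 \<inter> V2 = {v} \<and> V1 \<noteq> {v} \<and> V2 \<noteq> {v} \<and>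
     (\<forall>x y. adj G x y \<longrightarrow> {x, y} \<subseteq> V1 \<or> {x, y} \<subseteq> V2)"

lemma separation_sym: "separation G v V1 V2 \<Longrightarrow> separation G v V2 V1"
  by (auto simp: separation_def Un_commute Int_commute)

text \<open>One side is a component \<open>C\<close> of the graph without \<open>v\<close>, together
  with \<open>v\<close>; the other is everything outside \<open>C\<close>.\<close>

lemma cut_vertex_separation:
  assumes G: "simple_graph G" and v: "cut_vertex G v"
  obtains V1 V2 where "separation G v V1 V2"
proof -
  let ?H = "induced G (verts G - {v})"
  obtain x y where xy: "x \<in> verts G - {v}" "y \<in> verts G - {v}" "\<not> joined ?H x y"
    using v by (auto simp: cut_vertex_def disconnected_graph_def)
  define C where "C = {z \<in> verts G - {v}. joined ?H x z}"
  have same: "z \<in> C \<longleftrightarrow> w \<in> C" if "adj G z w" "z \<noteq> v" "w \<noteq> v" for z w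
  proof -
    have "adj ?H z w" "adj ?H w z" using that adjD[OF G that(1)] adj_sym[OF that(1)] by (auto simp: adj_induced)
    then have "joined ?H z w" "joined ?H w z" by (auto simp: joined_def)
    then show ?thesis
      using adjD(2,3)[OF G that(1)] that(2,3) joined_trans[of ?H x z w] joined_trans[of ?H x w z]
      unfolding C_def by auto
  qed
  have e: "{z, w} \<subseteq> insert v C \<or> {z, w} \<subseteq> verts G - C" if "adj G z w" for z w
  proof -
    have "z \<in> verts G" "w \<in> verts G" "v \<notin> C" using adjD[OF G that] by (auto simp: C_def)
    then show ?thesis using same[OF that] by blast
  qed
  have "x \<in> C" "y \<notin> C" "v \<notin> C" "C \<subseteq> verts G" using xy by (auto simp: C_def joined_def)
  moreover have "v \<in> verts G" using v by (simp add: cut_vertex_def)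
  ultimately have "separation G v (insert v C) (verts G - C)"
    unfolding separation_def using xy(1,2)
  proof (intro conjI allI impI)
    show "insert v C \<noteq> {v}" using \<open>x \<in> C\<close> xy(1) by blast
    show "verts G - C \<noteq> {v}" using \<open>y \<notin> C\<close> xy(2) by blast
  qed (use e in blast)+
  then show ?thesis by (rule that)
qed

text \<open>A walk from \<open>V1\<close> to \<open>v\<close> cannot leave \<open>V1\<close> before
  it first reaches \<open>v\<close>.\<close>

lemma connected_separation_side:
  assumes G: "simple_graph G" "connected_graph G" and s: "separation G v V1 V2"
  shows "connected_graph (induced G V1)"
proof -
  let ?H = "induced G V1"
  have v: "v \<in> V1" "V1 \<subseteq> verts G" "v \<in> verts G" using s by (auto simp: separation_def)
  have to_v: "joined ?H x v" if "x \<in> V1" for x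
  proof -
    have "joined G x v" using joined_connected[OF G(2)] that v by blast
    then have "(x, v) \<in> {(x, y). adj G x y}\<^sup>*" by (simp add: joined_def)
    then show ?thesis using that
    proof (induction rule: converse_rtrancl_induct)
      case base
      then show ?case by (simp add: joined_def)
    next
      case (step x z)
      show ?case
      proof (cases "x = v")
        case True
        then show ?thesis by (simp add: joined_def)
      next
        case False
        have xz: "adj G x z" using step.hyps(1) by simp
        moreover have "x \<notin> V2" using s False step.prems by (auto simp: separation_def)
        ultimately have z: "z \<in> V1" using s by (auto simp: separation_def)
        then have "adj ?H x z" using xz step.prems by (simp add: adj_induced)
        then have "joined ?H x z" by (auto simp: joined_def)
        then show ?thesis using joined_trans step.IH[OF z] by metis
      qed
    qed
  qed
  have "joined ?H x y" if "x \<in> V1" "y \<in> V1" for x y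
    by (rule joined_trans[OF to_v[OF that(1)] joined_sym[OF to_v[OF that(2)]]])
  then show ?thesis using v by (auto simp: connected_graph_def disconnected_graph_def)
qed

text \<open>Every edge lies on one side, so a matching divides into two; \<open>v\<close> is covered
  on at most one of them.\<close>

lemma matchable_separation:
  assumes G: "simple_graph G" and s: "separation G v V1 V2"
  shows "matchable_sets G = glue (matchable_sets (induced G V1)) (matchable_sets (induced G V2))" (is "_ = ?R")
proof
  have sub: "V1 \<subseteq> verts G" "V2 \<subseteq> verts G" using s by (auto simp: separation_def)
  note m = matchable_induced[OF sub(1)] matchable_induced[OF sub(2)]
  show "?R \<subseteq> matchable_sets G" unfolding m glue_def using union_matchable by blast
  show "matchable_sets G \<subseteq> ?R"
  proof
    fix S assume "S \<in> matchable_sets G"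
    with G show "S \<in> ?R"
    proof (induction rule: matchable_induct)
      case empty
      have "{} \<union> {} = ({} :: 'a set)" "{} \<inter> {} = ({} :: 'a set)" by simp_all
      then show ?case unfolding m glue_def using empty_matchable[of G] by blast
    next
      case (edge x y S)
      then obtain S1 S2 where S: "S = S1 \<union> S2" "S1 \<in> matchable_sets G" "S1 \<subseteq> V1"
        "S2 \<in> matchable_sets G" "S2 \<subseteq> V2" "S1 \<inter> S2 = {}" unfolding m glue_def by blast
      have S': "insert x (insert y S1) \<in> matchable_sets G" "insert x (insert y S2) \<in> matchable_sets G"
        using insert_edge_matchable[OF G edge.hyps(1)] S edge.hyps by auto
      have "{x, y} \<subseteq> V1 \<or> {x, y} \<subseteq> V2" using s edge.hyps(1) by (simp add: separation_def)
      then show ?case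
      proof
        assume "{x, y} \<subseteq> V1"
        then have "insert x (insert y S1) \<subseteq> V1" "insert x (insert y S1) \<inter> S2 = {}"
          "insert x (insert y S) = insert x (insert y S1) \<union> S2" using S edge.hyps by auto
        then show ?thesis unfolding m glue_def using S S' by blast
      next
        assume "{x, y} \<subseteq> V2"
        then have "insert x (insert y S2) \<subseteq> V2" "S1 \<inter> insert x (insert y S2) = {}"
          "insert x (insert y S) = S1 \<union> insert x (insert y S2)" using S edge.hyps by auto
        then show ?thesis unfolding m glue_def using S S' by blast
      qed
    qed
  qed
qed

text \<open>Otherwise \<open>v\<close> separates two vertices of \<open>B\<close>. Removing
  \<open>v\<close> changes nothing if \<open>v\<close> is not in \<open>B\<close>, so one argument
  covers the cut vertex and the disconnected graph.\<close>

lemma connected_in_separation: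
  assumes G: "simple_graph G" and s: "separation G v V1 V2"
    and B: "subgraph_of B G" "conn_without_cut_vertex B"
  shows "verts B \<subseteq> V1 \<or> verts B \<subseteq> V2"
proof (rule ccontr)
  assume "\<not> (verts B \<subseteq> V1 \<or> verts B \<subseteq> V2)"
  then obtain x y where x: "x \<in> verts B" "x \<notin> V2" and y: "y \<in> verts B" "y \<notin> V1"
    by blast
  have sB: "simple_graph B" "verts B \<subseteq> verts G" "edges B \<subseteq> edges G" using B(1) by (auto simp: subgraph_of_def)
  let ?H = "induced B (verts B - {v})"
  have v: "v \<in> V1" "v \<in> V2" and un: "V1 \<union> V2 = verts G" "V1 \<inter> V2 = {v}"
    using s by (auto simp: separation_def)
  have stay: "b \<in> V1 \<and> b \<noteq> v" if "joined ?H a b" "a \<in> V1" "a \<noteq> v" for a b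
    using that(1) unfolding joined_def
  proof (induction rule: rtrancl_induct)
    case (step b c)
    then have "adj G b c" "b \<noteq> v" "c \<noteq> v" using sB by (auto simp: adj_induced)
    then show ?case using step.IH s un by (auto simp: separation_def)
  qed (use that in simp)
  have ne: "x \<in> V1" "x \<noteq> v" "y \<noteq> v" using x y v un sB(2) by blast+
  have "joined ?H x y"
  proof (cases "v \<in> verts B")
    case True
    then show ?thesis using B(2) x y ne
      by (auto simp: conn_without_cut_vertex_def cut_vertex_def disconnected_graph_def)
  next
    case False
    then have "?H = B" using induced_self[OF sB(1)] by simp
    then show ?thesis using joined_connected[of B] B(2) x y by (simp add: conn_without_cut_vertex_def)
  qed
  then show False using stay ne y by blast
qed

lemma subgraph_refl: "simple_graph G \<Longrightarrow> subgraph_of G G"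
  by (simp add: subgraph_of_def)

text \<open>A single vertex is itself connected without cut vertex, but here it lies on an edge,
  which is larger and has no cut vertex either.\<close>

lemma block_not_single:
  assumes G: "simple_graph G" "connected_graph G" "v \<in> verts G" "verts G \<noteq> {v}" and B: "B \<in> blocks G"
  shows "\<not> verts B \<subseteq> {v}"
proof
  assume sub: "verts B \<subseteq> {v}"
  have "verts B \<noteq> {}"
    using blocksD(2)[OF B] by (simp add: conn_without_cut_vertex_def connected_graph_def)
  then have vB: "verts B = {v}" using sub by blast
  obtain w where w: "w \<in> verts G" "w \<noteq> v" using G(3,4) by blast
  have "(v, w) \<in> {(x, y). adj G x y}\<^sup>*" using joined_connected[OF G(2,3) w(1)] by (simp add: joined_def)
  then obtain u where u: "adj G v u" using w(2) by (auto elim: converse_rtranclE)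
  note e = edge_conn_without_cut_vertex[OF G(1) u]
  have sB: "simple_graph B" using blocksD(1)[OF B] by (simp add: subgraph_of_def)
  have "edges B = {}"
  proof (rule ccontr)
    assume "edges B \<noteq> {}"
    then obtain e where "e \<subseteq> {v}" "card e = 2" using sB vB by (auto simp: simple_graph_def)
    then show False using card_mono[of "{v}" e] by simp
  qed
  then have "subgraph_of B (induced G {v, u})" using sB vB by (simp add: subgraph_of_def)
  then have "induced G {v, u} = B" by (rule blocksD(3)[OF B e])
  then have "{v, u} = {v}" using vB by (metis verts_induced)
  then show False using adjD(1)[OF G(1) u] by blast
qed

text \<open>An enlargement of \<open>B\<close> in \<open>G\<close> lies on one side of the
  separation. On the wrong side, \<open>B\<close> would shrink to \<open>{v}\<close>, which
  \<open>block_not_single\<close> forbids.\<close>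

lemma blocks_separation_side:
  assumes G: "simple_graph G" "connected_graph G" and s: "separation G v V1 V2"
  shows "blocks (induced G V1) \<subseteq> blocks G"
proof
  let ?H = "induced G V1"
  fix B assume B: "B \<in> blocks ?H"
  note d = blocksD[OF B]
  have v: "v \<in> V1" "V1 \<subseteq> verts G" "V1 \<noteq> {v}" "V1 \<inter> V2 = {v}" using s by (auto simp: separation_def)
  have sH: "simple_graph ?H" by (rule simple_induced[OF G(1) v(2)])
  have HG: "subgraph_of ?H G" using sH v(2) by (auto simp: subgraph_of_def induced_def)
  have "B' = B" if B': "subgraph_of B' G" "conn_without_cut_vertex B'" "subgraph_of B B'" for B'
  proof -
    have "verts B \<subseteq> V1" using d(1) by (simp add: subgraph_of_def)
    have "verts B' \<subseteq> V1"
    proof (rule ccontr)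
      assume "\<not> verts B' \<subseteq> V1"
      then have "verts B' \<subseteq> V2" using connected_in_separation[OF G(1) s B'(1,2)] by blast
      then have "verts B \<subseteq> {v}" using B'(3) \<open>verts B \<subseteq> V1\<close> v(4) by (auto simp: subgraph_of_def)
      then show False
        using block_not_single[OF sH connected_separation_side[OF G s] _ _ B, of v] v by simp
    qed
    then have "subgraph_of B' ?H"
      using B'(1) by (auto simp: subgraph_of_def simple_graph_def induced_def)
    then show "B' = B" by (rule d(3)[OF _ B'(2,3)])
  qed
  then show "B \<in> blocks G"
    using d(2) subgraph_trans[OF d(1) HG] by (simp add: blocks_def)
qed

section \<open>Exchange in matchable sets\<close>

lemma complete_bipartiteE:
  assumes "complete_bipartite H"
  obtains X Y where "X \<inter> Y = {}" "finite X" "finite Y" "verts H = X \<union> Y"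
    "\<forall>x y. adj H x y \<longleftrightarrow> x \<in> X \<and> y \<in> Y \<or> x \<in> Y \<and> y \<in> X"
proof -
  obtain p q Vs where Vs: "map card Vs = [p, q]" "\<forall>V\<in>set Vs. finite V"
    "\<forall>i<length Vs. \<forall>j<length Vs. i \<noteq> j \<longrightarrow> Vs ! i \<inter> Vs ! j = {}" "verts H = \<Union> (set Vs)"
    "edges H = {{u, v} | u v i j. i < length Vs \<and> j < length Vs \<and> i \<noteq> j \<and> u \<in> Vs ! i \<and> v \<in> Vs ! j}"
    using assms unfolding complete_bipartite_def is_complete_multipartite_def by (elim exE conjE) (rule that)
  obtain X Y where XY: "Vs = [X, Y]" using Vs(1) by auto
  have "X \<inter> Y = {}" using Vs(3) unfolding XY by (auto simp: numeral_eq_Suc less_Suc_eq)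
  moreover have "adj H x y \<longleftrightarrow> x \<in> X \<and> y \<in> Y \<or> x \<in> Y \<and> y \<in> X" for x y
  proof -
    have "adj H x y \<longleftrightarrow> (\<exists>u v. {x, y} = {u, v} \<and> (u \<in> X \<and> v \<in> Y \<or> u \<in> Y \<and> v \<in> X))"
      unfolding Vs(5) XY by (auto simp: less_Suc_eq) (force | fastforce)+
    then show ?thesis by (auto simp: doubleton_eq_iff)
  qed
  then have "\<forall>x y. adj H x y \<longleftrightarrow> x \<in> X \<and> y \<in> Y \<or> x \<in> Y \<and> y \<in> X" by blast
  ultimately show ?thesis using that[of X Y] Vs(2,4) unfolding XY by simp
qed

lemma multipartite_1_1E:
  assumes "is_complete_multipartite [1, 1, n] H"
  obtains u v L where "u \<noteq> v" "{u, v} \<inter> L = {}" "finite L" "card L = n" "verts H = {u, v} \<union> L"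
    "\<forall>x y. adj H x y \<longleftrightarrow> {x, y} = {u, v} \<or> x \<in> {u, v} \<and> y \<in> L \<or> x \<in> L \<and> y \<in> {u, v}"
proof -
  obtain Vs where Vs: "map card Vs = [1, 1, n]" "\<forall>V\<in>set Vs. finite V"
    "\<forall>i<length Vs. \<forall>j<length Vs. i \<noteq> j \<longrightarrow> Vs ! i \<inter> Vs ! j = {}" "verts H = \<Union> (set Vs)"
    "edges H = {{u, v} | u v i j. i < length Vs \<and> j < length Vs \<and> i \<noteq> j \<and> u \<in> Vs ! i \<and> v \<in> Vs ! j}"
    using assms unfolding is_complete_multipartite_def by (elim exE conjE) (rule that)
  obtain U V L where UVL: "Vs = [U, V, L]" "card U = 1" "card V = 1" "card L = n" using Vs(1) by auto
  obtain u v where uv: "U = {u}" "V = {v}" using UVL(2,3) by (meson card_1_singletonE)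
  have disj: "u \<noteq> v" "{u, v} \<inter> L = {}"
    using Vs(3) unfolding UVL uv by (auto simp: numeral_eq_Suc less_Suc_eq all_conj_distrib)
  have len: "length Vs = 3" using UVL(1) by simp
  have e: "e \<in> edges H \<longleftrightarrow> e = {u, v} \<or> (\<exists>l\<in>L. e = {u, l} \<or> e = {v, l})" for e
  proof
    assume "e \<in> edges H"
    then obtain a b i j where "e = {a, b}" "i < 3" "j < 3" "i \<noteq> j" "a \<in> Vs ! i" "b \<in> Vs ! j"
      unfolding Vs(5) len by blast
    moreover from this have "(i = 0 \<or> i = 1 \<or> i = 2) \<and> (j = 0 \<or> j = 1 \<or> j = 2)" by linarith
    ultimately show "e = {u, v} \<or> (\<exists>l\<in>L. e = {u, l} \<or> e = {v, l})"
      unfolding UVL uv by (auto simp: insert_commute)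
  next
    have mem: "{a, b} \<in> edges H" if "i < 3" "j < 3" "i \<noteq> j" "a \<in> Vs ! i" "b \<in> Vs ! j" for a b i j
      unfolding Vs(5) len using that by blast
    assume "e = {u, v} \<or> (\<exists>l\<in>L. e = {u, l} \<or> e = {v, l})"
    then show "e \<in> edges H"
      using mem[of 0 1 u v] mem[of 0 2 u] mem[of 1 2 v] unfolding UVL(1) uv by auto
  qed
  have "adj H x y \<longleftrightarrow> {x, y} = {u, v} \<or> x \<in> {u, v} \<and> y \<in> L \<or> x \<in> L \<and> y \<in> {u, v}" for x y
    unfolding e by (auto simp: doubleton_eq_iff)
  then have "\<forall>x y. adj H x y \<longleftrightarrow> {x, y} = {u, v} \<or> x \<in> {u, v} \<and> y \<in> L \<or> x \<in> L \<and> y \<in> {u, v}" by blast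
  moreover have "finite L" "verts H = {u, v} \<union> L" using Vs(2,4) unfolding UVL(1) uv by auto
  ultimately show ?thesis using that[OF disj] UVL(4) by blast
qed

lemma balanced_matchable:
  assumes G: "simple_graph G" and XY: "finite X" "finite Y" "X \<inter> Y = {}"
    "\<And>x y. x \<in> X \<Longrightarrow> y \<in> Y \<Longrightarrow> adj G x y"
  shows "balanced_sets X Y \<subseteq> matchable_sets G"
proof -
  have "S \<in> matchable_sets G" if "S \<in> balanced_sets X Y" "card (S \<inter> X) = n" for S n
    using that
  proof (induction n arbitrary: S)
    case 0
    then have "S \<inter> X = {}" "S \<inter> Y = {}" using XY by (auto simp: balanced_sets_def)
    then have "S = {}" using 0 by (auto simp: balanced_sets_def)
    then show ?case by simp
  next
    case (Suc n)
    have "card (S \<inter> Y) = Suc n" using Suc.prems by (simp add: balanced_sets_def)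
    then obtain x y where xy: "x \<in> S" "x \<in> X" "y \<in> S" "y \<in> Y"
      using Suc.prems(2) by (metis Int_iff card.empty equals0I nat.distinct(1))
    let ?S = "S - {x, y}"
    have "?S \<inter> X = S \<inter> X - {x}" "?S \<inter> Y = S \<inter> Y - {y}" using xy XY(3) by auto
    then have "card (?S \<inter> X) = n" "card (?S \<inter> Y) = n"
      using xy Suc.prems(2) \<open>card (S \<inter> Y) = Suc n\<close> XY(1,2) by simp_all
    moreover have "?S \<subseteq> X \<union> Y" using Suc.prems(1) by (auto simp: balanced_sets_def)
    ultimately have "?S \<in> matchable_sets G" using Suc.IH[of ?S] by (simp add: balanced_sets_def)
    then have "insert x (insert y ?S) \<in> matchable_sets G"
      using insert_edge_matchable[OF G XY(4)[OF xy(2,4)]] by simp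
    moreover have "insert x (insert y ?S) = S" using xy by auto
    ultimately show ?case by simp
  qed
  then show ?thesis by blast
qed

lemma matchable_complete_bipartite:
  assumes G: "simple_graph G" and XY: "finite X" "finite Y" "X \<inter> Y = {}" "verts G = X \<union> Y"
    "\<And>x y. adj G x y \<longleftrightarrow> x \<in> X \<and> y \<in> Y \<or> x \<in> Y \<and> y \<in> X"
  shows "colouring G X" "matchable_sets G = balanced_sets X Y"
proof -
  show col: "colouring G X" using XY(3,5) by (auto simp: colouring_def)
  have "S \<in> balanced_sets X Y" if S: "S \<in> matchable_sets G" for S
  proof -
    have "S \<subseteq> X \<union> Y" using matchable_subset[OF S] XY(4) by simp
    moreover from this have "S - X = S \<inter> Y" using XY(3) by blast
    ultimately show ?thesis using colouring_balanced[OF G col S] by (simp add: balanced_sets_def)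
  qed
  then show "matchable_sets G = balanced_sets X Y" using balanced_matchable[OF G XY(1-3)] XY(5) by blast
qed

lemma matchable_complete_4:
  assumes G: "simple_graph G" and "is_complete 4 G"
  shows "matchable_sets G = even_sets (verts G)"
proof -
  have V: "finite (verts G)" "edges G = {e. e \<subseteq> verts G \<and> card e = 2}"
    using assms(2) by (auto simp: is_complete_def)
  have "S \<in> matchable_sets G" if "S \<subseteq> verts G" "card S = 2 * n" for S n
    using that
  proof (induction n arbitrary: S)
    case 0
    then have "finite S" "card S = 0" using V finite_subset by auto
    then have "S = {}" by simp
    then show ?case by simp
  next
    case (Suc n)
    have fS: "finite S" by (rule finite_subset[OF Suc.prems(1) V(1)])
    have "2 \<le> card S" using Suc.prems(2) by simp
    then obtain e where e: "e \<subseteq> S" "card e = 2"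
      by (elim obtain_subset_with_card_n) (rule that)
    then obtain x y where xy: "e = {x, y}" "x \<noteq> y" unfolding card_2_iff by blast
    have "card (S - e) = 2 * n" using e fS Suc.prems(2) by (simp add: card_Diff_subset finite_subset)
    then have "S - e \<in> matchable_sets G" using Suc.IH Suc.prems(1) by blast
    moreover have "adj G x y" using e xy Suc.prems(1) V(2) by auto
    ultimately have "insert x (insert y (S - e)) \<in> matchable_sets G"
      using insert_edge_matchable[OF G] xy by simp
    moreover have "insert x (insert y (S - e)) = S" using e xy by auto
    ultimately show ?case by simp
  qed
  then have "even_sets (verts G) \<subseteq> matchable_sets G" by (auto simp: even_sets_def elim!: evenE)
  moreover have "matchable_sets G \<subseteq> even_sets (verts G)"
    using even_card_matchable[OF G] matchable_subset by (auto simp: even_sets_def)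
  ultimately show ?thesis by blast
qed

text \<open>Every edge other than the one between the apices has one end in \<open>{u, v}\<close>
  and one in \<open>L\<close>. If the apices are matched to each other, nothing in \<open>L\<close>
  can be matched.\<close>

lemma matchable_multipartite_1_1:
  assumes G: "simple_graph G" and uvL: "u \<noteq> v" "{u, v} \<inter> L = {}" "finite L" "verts G = {u, v} \<union> L"
    "\<And>x y. adj G x y \<longleftrightarrow> {x, y} = {u, v} \<or> x \<in> {u, v} \<and> y \<in> L \<or> x \<in> L \<and> y \<in> {u, v}"
  shows "matchable_sets G = insert {u, v} (balanced_sets {u, v} L)"
proof
  have "adj G u v" using uvL(5) by simp
  moreover have "balanced_sets {u, v} L \<subseteq> matchable_sets G"
    by (rule balanced_matchable[OF G _ uvL(3,2)]) (use uvL(5) in auto)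
  ultimately show "insert {u, v} (balanced_sets {u, v} L) \<subseteq> matchable_sets G"
    using edge_matchable[OF G] by blast
  show "matchable_sets G \<subseteq> insert {u, v} (balanced_sets {u, v} L)"
  proof
    fix S assume "S \<in> matchable_sets G"
    with G show "S \<in> insert {u, v} (balanced_sets {u, v} L)"
    proof (induction rule: matchable_induct)
      case empty
      then show ?case by (simp add: balanced_sets_def)
    next
      case (edge x y S)
      have fS: "finite S" using edge finite_matchable[OF G] by blast
      consider "{x, y} = {u, v}" | "x \<in> {u, v}" "y \<in> L" | "x \<in> L" "y \<in> {u, v}"
        using edge.hyps(1) uvL(5) by blast
      then show ?case
      proof cases
        case 1
        then have "S \<inter> {u, v} = {}" using edge.hyps by auto
        then have "S \<subseteq> L" "card (S \<inter> L) = 0" using edge.IH by (auto simp: balanced_sets_def)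
        then have "S = {}" using fS by (simp add: Int_absorb2)
        then show ?thesis using 1 by simp
      next
        case 2
        then have "S \<noteq> {u, v}" using edge.hyps by auto
        then have "S \<in> balanced_sets {u, v} L" using edge.IH by blast
        moreover have "insert x (insert y S) \<inter> {u, v} = insert x (S \<inter> {u, v})"
          "insert x (insert y S) \<inter> L = insert y (S \<inter> L)" using 2 uvL(2) by auto
        ultimately have "insert x (insert y S) \<in> balanced_sets {u, v} L"
          using 2 edge.hyps fS by (auto simp: balanced_sets_def)
        then show ?thesis by blast
      next
        case 3
        then have "S \<noteq> {u, v}" using edge.hyps by auto
        then have "S \<in> balanced_sets {u, v} L" using edge.IH by blast
        moreover have "insert x (insert y S) \<inter> {u, v} = insert y (S \<inter> {u, v})"
          "insert x (insert y S) \<inter> L = insert x (S \<inter> L)" using 3 uvL(2) by auto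
        ultimately have "insert x (insert y S) \<in> balanced_sets {u, v} L"
          using 3 edge.hyps fS by (auto simp: balanced_sets_def)
        then show ?thesis by blast
      qed
    qed
  qed
qed

lemma colouring_compl: "colouring G X \<Longrightarrow> colouring G (- X)"
  by (auto simp: colouring_def)

lemma exchange_separation:
  assumes G: "simple_graph G" and s: "separation G v V1 V2"
    and ex: "exchange_property (matchable_sets (induced G V1))" "exchange_property (matchable_sets (induced G V2))"
    and col: "colouring (induced G V2) X"
  shows "exchange_property (matchable_sets G)"
proof -
  have sub: "V2 \<subseteq> verts G" "V1 \<inter> V2 = {v}" using s by (auto simp: separation_def)
  have sH: "simple_graph (induced G V2)" by (rule simple_induced[OF G sub(1)])
  obtain X' where X': "colouring (induced G V2) X'" "v \<in> X'"
    using col colouring_compl[OF col] by (cases "v \<in> X") auto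
  have "finite V2" using sH by (simp add: simple_graph_def)
  show ?thesis
    unfolding matchable_separation[OF G s]
  proof (rule exchange_glue[OF \<open>finite V2\<close> _ _ sub(2) X'(2) _ ex])
    show "S \<subseteq> V1" if "S \<in> matchable_sets (induced G V1)" for S
      using matchable_subset[OF that] by simp
    show "S \<subseteq> V2" "card (S \<inter> X') = card (S - X')" if "S \<in> matchable_sets (induced G V2)" for S
      using matchable_subset[OF that] colouring_balanced[OF sH X'(1) that] by simp_all
  qed
qed

lemma colouring_separation:
  assumes s: "separation G v V1 V2"
    and col: "colouring (induced G V1) X1" "colouring (induced G V2) X2"
  shows "\<exists>X. colouring G X"
proof -
  obtain X where X: "colouring (induced G V2) X" "v \<in> X1 \<longleftrightarrow> v \<in> X"
    using col(2) colouring_compl[OF col(2)] by (cases "v \<in> X1 \<longleftrightarrow> v \<in> X2") auto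
  have V: "V1 \<inter> V2 = {v}" "\<And>x y. adj G x y \<Longrightarrow> {x, y} \<subseteq> V1 \<or> {x, y} \<subseteq> V2"
    using s by (auto simp: separation_def)
  define Z where "Z = (X1 \<inter> V1) \<union> (X \<inter> V2)"
  have Z: "z \<in> Z \<longleftrightarrow> z \<in> X1" if "z \<in> V1" for z
    using that V(1) X(2) by (cases "z = v") (auto simp: Z_def)
  have Z': "z \<in> Z \<longleftrightarrow> z \<in> X" if "z \<in> V2" for z
    using that V(1) X(2) by (cases "z = v") (auto simp: Z_def)
  have "x \<in> Z \<longleftrightarrow> y \<notin> Z" if "adj G x y" for x y
    using V(2)[OF that]
  proof
    assume "{x, y} \<subseteq> V1"
    then have "adj (induced G V1) x y" using that by (simp add: adj_induced)
    then have "x \<in> X1 \<longleftrightarrow> y \<notin> X1" using col(1) by (simp add: colouring_def)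
    then show ?thesis using Z \<open>{x, y} \<subseteq> V1\<close> by simp
  next
    assume "{x, y} \<subseteq> V2"
    then have "adj (induced G V2) x y" using that by (simp add: adj_induced)
    then have "x \<in> X \<longleftrightarrow> y \<notin> X" using X(1) by (simp add: colouring_def)
    then show ?thesis using Z' \<open>{x, y} \<subseteq> V2\<close> by simp
  qed
  then show ?thesis unfolding colouring_def by blast
qed

text \<open>Induction over separations at cut vertices. The set \<open>E\<close> is fixed and need
  not consist of blocks of \<open>G\<close>, so the same \<open>E\<close> serves both sides. The
  colouring is carried along because gluing requires a balanced side.\<close>

lemma exchange_matchable:
  assumes "simple_graph G" "connected_graph G"
    and E: "finite E" "card E \<le> 1" "\<And>B. B \<in> blocks G - E \<Longrightarrow> complete_bipartite B"
      "\<And>B. B \<in> E \<Longrightarrow> is_complete 4 B \<or> (\<exists>n\<ge>1. is_complete_multipartite [1, 1, n] B)"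
  shows "exchange_property (matchable_sets G) \<and> (blocks G \<inter> E = {} \<longrightarrow> (\<exists>X. colouring G X))"
  using assms(1,2) E(3)
proof (induction "card (verts G)" arbitrary: G rule: less_induct)
  case (less G)
  note G = less.prems(1,2)
  have fin: "finite (verts G)" using G(1) by (simp add: simple_graph_def)
  show ?case
  proof (cases "conn_without_cut_vertex G")
    case True
    have "G \<in> blocks G"
      unfolding blocks_def using True subgraph_refl[OF G(1)] by (auto simp: subgraph_of_def)
    show ?thesis
    proof (cases "G \<in> E")
      case GE: True
      have "exchange_property (matchable_sets G)"
        using E(4)[OF GE]
      proof
        assume "is_complete 4 G"
        then show ?thesis
          unfolding matchable_complete_4[OF G(1) \<open>is_complete 4 G\<close>]
          by (intro exchange_even_sets) (simp add: is_complete_def)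
      next
        assume "\<exists>n\<ge>1. is_complete_multipartite [1, 1, n] G"
        then obtain n where "is_complete_multipartite [1, 1, n] G" by blast
        then obtain u v L where uvL: "u \<noteq> v" "{u, v} \<inter> L = {}" "finite L" "verts G = {u, v} \<union> L"
          "\<forall>x y. adj G x y \<longleftrightarrow> {x, y} = {u, v} \<or> x \<in> {u, v} \<and> y \<in> L \<or> x \<in> L \<and> y \<in> {u, v}"
          by (elim multipartite_1_1E) (rule that)
        show ?thesis
          unfolding matchable_multipartite_1_1[OF G(1) uvL(1-4) uvL(5)[rule_format]]
          by (rule exchange_balanced_insert[OF uvL(3,1,2)])
      qed
      then show ?thesis using GE \<open>G \<in> blocks G\<close> by blast
    next
      case False
      then have "complete_bipartite G" using less.prems(3) \<open>G \<in> blocks G\<close> by blast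
      then obtain X Y where XY: "X \<inter> Y = {}" "finite X" "finite Y" "verts G = X \<union> Y"
        "\<forall>x y. adj G x y \<longleftrightarrow> x \<in> X \<and> y \<in> Y \<or> x \<in> Y \<and> y \<in> X" by (rule complete_bipartiteE)
      note m = matchable_complete_bipartite[OF G(1) XY(2,3,1,4) XY(5)[rule_format]]
      show ?thesis using m exchange_balanced[OF XY(2,3,1)] by auto
    qed
  next
    case False
    then obtain v where "cut_vertex G v" using G(2) by (auto simp: conn_without_cut_vertex_def)
    then obtain V1 V2 where s: "separation G v V1 V2" using cut_vertex_separation[OF G(1)] by blast
    note s' = separation_sym[OF s]
    have step: "exchange_property (matchable_sets (induced G U1)) \<and>
       (blocks (induced G U1) \<inter> E = {} \<longrightarrow> (\<exists>X. colouring (induced G U1) X))"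
      if u: "separation G v U1 U2" for U1 U2
    proof (rule less.hyps)
      have "U1 \<subset> verts G" using u by (auto simp: separation_def)
      then show "card (verts (induced G U1)) < card (verts G)" using fin by (simp add: psubset_card_mono)
      show "simple_graph (induced G U1)" using simple_induced[OF G(1)] \<open>U1 \<subset> verts G\<close> by blast
      show "connected_graph (induced G U1)" by (rule connected_separation_side[OF G u])
      show "complete_bipartite B" if "B \<in> blocks (induced G U1) - E" for B
        using less.prems(3) blocks_separation_side[OF G u] that by blast
    qed
    \<comment> \<open>By \<open>card E \<le> 1\<close>, exceptional blocks on both sides would be
      the same graph, lying in \<open>V1 \<inter> V2 = {v}\<close>; but an exceptional block has at
      least two vertices.\<close>
    have one: "blocks (induced G V1) \<inter> E = {} \<or> blocks (induced G V2) \<inter> E = {}"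
    proof (rule ccontr)
      assume "\<not> ?thesis"
      then obtain B B' where B: "B \<in> blocks (induced G V1)" "B \<in> E" "B' \<in> blocks (induced G V2)" "B' \<in> E"
        by blast
      then have "B' = B" using E(1,2) by (metis One_nat_def card_le_Suc0_iff_eq)
      then have "verts B \<subseteq> V1 \<inter> V2"
        using blocksD(1)[OF B(1)] blocksD(1)[OF B(3)] by (simp add: subgraph_of_def)
      moreover have "V1 \<inter> V2 = {v}" using s by (simp add: separation_def)
      ultimately have sub: "verts B \<subseteq> {v}" by simp
      then have "card (verts B) \<le> 1" using card_mono[of "{v}" "verts B"] by simp
      moreover have "card (verts B) \<noteq> 1 \<and> card (verts B) \<noteq> 0"
        using E(4)[OF B(2)]
      proof
        assume "is_complete 4 B"
        then show ?thesis by (simp add: is_complete_def)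
      next
        assume "\<exists>n\<ge>1. is_complete_multipartite [1, 1, n] B"
        then obtain n where "is_complete_multipartite [1, 1, n] B" by blast
        then obtain u w L where "u \<noteq> w" "verts B = {u, w} \<union> L" by (rule multipartite_1_1E)
        then show ?thesis using sub by auto
      qed
      ultimately show False by linarith
    qed
    have ex: "exchange_property (matchable_sets G)"
      using one
    proof
      assume "blocks (induced G V2) \<inter> E = {}"
      then show ?thesis using exchange_separation[OF G(1) s] step[OF s] step[OF s'] by blast
    next
      assume "blocks (induced G V1) \<inter> E = {}"
      then show ?thesis using exchange_separation[OF G(1) s'] step[OF s] step[OF s'] by blast
    qed
    moreover have "\<exists>X. colouring G X" if "blocks G \<inter> E = {}"
      using that step[OF s] step[OF s'] blocks_separation_side[OF G s] blocks_separation_side[OF G s']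
        colouring_separation[OF s] by blast
    ultimately show ?thesis by blast
  qed
qed

section \<open>Monomial ideals\<close>

lemma carrier_mpoly_ring [simp]: "p \<in> carrier (mpoly_ring A) \<longleftrightarrow> Poly_Mapping.keys p \<subseteq> monoms_in A"
  by (simp add: mpoly_ring_def)

lemma mpoly_ring_ops [simp]:
  "p \<otimes>\<^bsub>mpoly_ring A\<^esub> q = p * q" "p \<oplus>\<^bsub>mpoly_ring A\<^esub> q = p + q"
  "\<zero>\<^bsub>mpoly_ring A\<^esub> = 0" "\<one>\<^bsub>mpoly_ring A\<^esub> = 1"
  by (simp_all add: mpoly_ring_def)

lemma monoms_in_zero [simp]: "0 \<in> monoms_in A"
  by (simp add: monoms_in_def)

lemma monoms_in_add [simp]: "m + m' \<in> monoms_in A \<longleftrightarrow> m \<in> monoms_in A \<and> m' \<in> monoms_in A"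
proof -
  have "Poly_Mapping.keys (m + m') = Poly_Mapping.keys m \<union> Poly_Mapping.keys m'"
    by (auto simp: in_keys_iff lookup_add)
  then show ?thesis by (simp add: monoms_in_def)
qed

lemma keys_mult_subset:
  fixes p q :: "('a \<Rightarrow>\<^sub>0 nat) \<Rightarrow>\<^sub>0 'k::field"
  assumes "Poly_Mapping.keys p \<subseteq> K" "Poly_Mapping.keys q \<subseteq> L"
    "\<And>a b. a \<in> K \<Longrightarrow> b \<in> L \<Longrightarrow> a + b \<in> J"
  shows "Poly_Mapping.keys (p * q) \<subseteq> J"
  using keys_mult[of p q] assms by blast

lemma ring_mpoly_ring: "ring (mpoly_ring A :: (('a \<Rightarrow>\<^sub>0 nat) \<Rightarrow>\<^sub>0 'k::field) ring)"
proof (rule ringI)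
  show "abelian_group (mpoly_ring A :: (('a \<Rightarrow>\<^sub>0 nat) \<Rightarrow>\<^sub>0 'k) ring)"
  proof (rule abelian_groupI)
    fix x y :: "('a \<Rightarrow>\<^sub>0 nat) \<Rightarrow>\<^sub>0 'k"
    assume "x \<in> carrier (mpoly_ring A)" "y \<in> carrier (mpoly_ring A)"
    then show "x \<oplus>\<^bsub>mpoly_ring A\<^esub> y \<in> carrier (mpoly_ring A)"
      using Poly_Mapping.keys_add[of x y] by auto
  next
    fix x :: "('a \<Rightarrow>\<^sub>0 nat) \<Rightarrow>\<^sub>0 'k"
    assume "x \<in> carrier (mpoly_ring A)"
    then show "\<exists>y\<in>carrier (mpoly_ring A). y \<oplus>\<^bsub>mpoly_ring A\<^esub> x = \<zero>\<^bsub>mpoly_ring A\<^esub>"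
      by (intro bexI[of _ "- x"]) auto
  qed (simp_all add: algebra_simps)
  show "monoid (mpoly_ring A :: (('a \<Rightarrow>\<^sub>0 nat) \<Rightarrow>\<^sub>0 'k) ring)"
  proof (rule monoidI)
    fix x y :: "('a \<Rightarrow>\<^sub>0 nat) \<Rightarrow>\<^sub>0 'k"
    assume "x \<in> carrier (mpoly_ring A)" "y \<in> carrier (mpoly_ring A)"
    then show "x \<otimes>\<^bsub>mpoly_ring A\<^esub> y \<in> carrier (mpoly_ring A)"
      using keys_mult_subset[of x "monoms_in A" y "monoms_in A" "monoms_in A"] by simp
  qed (simp_all add: algebra_simps)
qed (simp_all add: algebra_simps)

definition multiples :: "'a set \<Rightarrow> ('a \<Rightarrow>\<^sub>0 nat) set \<Rightarrow> ('a \<Rightarrow>\<^sub>0 nat) set" where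
  "multiples A M = {m \<in> monoms_in A. \<exists>m0\<in>M. \<exists>d. m = m0 + d}"

lemma poly_mapping_sum_single: "p = (\<Sum>m\<in>Poly_Mapping.keys p. Poly_Mapping.single m (Poly_Mapping.lookup p m))"
  by (rule poly_mapping_eqI)
    (auto simp: lookup_sum lookup_single when_def in_keys_iff sum.delta)

lemma genideal_monomials:
  fixes M :: "('a \<Rightarrow>\<^sub>0 nat) set"
  assumes M: "M \<subseteq> monoms_in A"
  shows "genideal (mpoly_ring A) (monomial ` M) =
    {p :: ('a \<Rightarrow>\<^sub>0 nat) \<Rightarrow>\<^sub>0 'k::field. Poly_Mapping.keys p \<subseteq> multiples A M}" (is "_ = ?J")
proof
  let ?R = "mpoly_ring A :: (('a \<Rightarrow>\<^sub>0 nat) \<Rightarrow>\<^sub>0 'k) ring"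
  interpret R: ring ?R by (rule ring_mpoly_ring)
  have J_sub: "multiples A M \<subseteq> monoms_in A" by (auto simp: multiples_def)
  have up: "a + b \<in> multiples A M" if a: "a \<in> multiples A M" and b: "b \<in> monoms_in A" for a b
  proof -
    obtain m0 d where "m0 \<in> M" "a = m0 + d" "a \<in> monoms_in A" using a by (auto simp: multiples_def)
    then show ?thesis using b by (auto simp: multiples_def add.assoc)
  qed
  have "ideal ?J ?R"
  proof (rule idealI)
    show "ring ?R" by (rule ring_mpoly_ring)
    show "subgroup ?J (add_monoid ?R)"
    proof
      show "?J \<subseteq> carrier (add_monoid ?R)" using J_sub by auto
      fix x assume x: "x \<in> ?J"
      then have "\<ominus>\<^bsub>?R\<^esub> x = - x" using J_sub by (intro R.minus_equality) auto
      then show "inv\<^bsub>add_monoid ?R\<^esub> x \<in> ?J" using x by (simp add: a_inv_def)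
      fix y assume "y \<in> ?J"
      then show "x \<otimes>\<^bsub>add_monoid ?R\<^esub> y \<in> ?J" using x Poly_Mapping.keys_add[of x y] by auto
    qed simp
    fix a x assume "a \<in> ?J" "x \<in> carrier ?R"
    then show "a \<otimes>\<^bsub>?R\<^esub> x \<in> ?J"
      using keys_mult_subset[of a "multiples A M" x "monoms_in A" "multiples A M"] up by simp
    then show "x \<otimes>\<^bsub>?R\<^esub> a \<in> ?J" by (simp add: mult.commute)
  qed
  moreover have "monomial ` M \<subseteq> ?J"
  proof
    fix p :: "('a \<Rightarrow>\<^sub>0 nat) \<Rightarrow>\<^sub>0 'k" assume "p \<in> monomial ` M"
    then obtain m where "m \<in> M" "p = monomial m" by blast
    moreover from this have "m \<in> multiples A M" using M unfolding multiples_def by (auto intro!: exI[of _ 0])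
    ultimately show "p \<in> ?J" by (simp add: monomial_def)
  qed
  ultimately show "genideal ?R (monomial ` M) \<subseteq> ?J" by (rule R.genideal_minimal)
  have carr: "monomial ` M \<subseteq> carrier ?R" using M by (auto simp: monomial_def)
  interpret I: ideal "genideal ?R (monomial ` M)" ?R by (rule R.genideal_ideal[OF carr])
  show "?J \<subseteq> genideal ?R (monomial ` M)"
  proof
    fix p assume "p \<in> ?J"
    then have p: "Poly_Mapping.keys p \<subseteq> multiples A M" by simp
    have single: "Poly_Mapping.single m c \<in> genideal ?R (monomial ` M)" if mult: "m \<in> multiples A M" for m c
    proof -
      obtain m0 d where m: "m0 \<in> M" "m = m0 + d" "m \<in> monoms_in A" using mult by (auto simp: multiples_def)
      have "monomial m0 \<in> genideal ?R (monomial ` M)" using R.genideal_self[OF carr] m(1) by blast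
      moreover have "Poly_Mapping.single d c \<in> carrier ?R" using m by auto
      ultimately have "monomial m0 \<otimes>\<^bsub>?R\<^esub> Poly_Mapping.single d c \<in> genideal ?R (monomial ` M)"
        by (rule I.I_r_closed)
      then show ?thesis by (simp add: monomial_def mult_single m(2))
    qed
    have zero: "0 \<in> genideal ?R (monomial ` M)" using I.zero_closed by simp
    have add: "x + y \<in> genideal ?R (monomial ` M)"
      if "x \<in> genideal ?R (monomial ` M)" "y \<in> genideal ?R (monomial ` M)" for x y
      using I.a_closed[OF that] by simp
    have "(\<Sum>m\<in>K. Poly_Mapping.single m (f m)) \<in> genideal ?R (monomial ` M)"
      if "finite K" "K \<subseteq> multiples A M" for K f
      using that by (induction K) (auto intro: zero add single)
    from this[OF finite_keys p] show "p \<in> genideal ?R (monomial ` M)"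
      using poly_mapping_sum_single[of p] by metis
  qed
qed

text \<open>A monomial ideal determines its monomials, and \<open>L\<close>, being closed under
  multiples, is exactly that set. If a squarefree generating set exists, all squarefree members of
  \<open>L\<close> form one.\<close>

lemma squarefree_generated_iff:
  assumes L: "L \<subseteq> monoms_in A" and up: "\<And>m d. m \<in> L \<Longrightarrow> d \<in> monoms_in A \<Longrightarrow> m + d \<in> L"
  shows "squarefree_generated A (genideal (mpoly_ring A) (monomial ` L) :: (('a \<Rightarrow>\<^sub>0 nat) \<Rightarrow>\<^sub>0 'k::field) set) \<longleftrightarrow>
    (\<forall>m\<in>L. \<exists>m0\<in>L. squarefree_monom m0 \<and> (\<exists>d. m = m0 + d))" (is "?l \<longleftrightarrow> ?r")
proof -
  have LL: "multiples A L = L"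
  proof
    show "multiples A L \<subseteq> L" using up by (auto simp: multiples_def)
    show "L \<subseteq> multiples A L" using L by (auto simp: multiples_def intro!: exI[of _ 0])
  qed
  \<comment> \<open>Tested on polynomials with a single term.\<close>
  have inj: "K = K'"
    if "{p :: ('a \<Rightarrow>\<^sub>0 nat) \<Rightarrow>\<^sub>0 'k. Poly_Mapping.keys p \<subseteq> K} = {p. Poly_Mapping.keys p \<subseteq> K'}" for K K'
  proof -
    have "m \<in> K \<longleftrightarrow> m \<in> K'" for m
    proof -
      have "Poly_Mapping.keys (Poly_Mapping.single m (1 :: 'k)) \<subseteq> K \<longleftrightarrow>
        Poly_Mapping.keys (Poly_Mapping.single m (1 :: 'k)) \<subseteq> K'" using that by blast
      then show ?thesis by simp
    qed
    then show ?thesis by blast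
  qed
  show ?thesis
  proof
    assume ?l
    then obtain M where M: "M \<subseteq> monoms_in A" "\<forall>m\<in>M. squarefree_monom m"
      "(genideal (mpoly_ring A) (monomial ` L) :: (('a \<Rightarrow>\<^sub>0 nat) \<Rightarrow>\<^sub>0 'k) set) =
       genideal (mpoly_ring A) (monomial ` M)" unfolding squarefree_generated_def by blast
    have eq: "L = multiples A M"
      using inj[of "multiples A L" "multiples A M"] M(3)
      unfolding genideal_monomials[OF L] genideal_monomials[OF M(1)] LL by blast
    show ?r
    proof
      fix m assume "m \<in> L"
      then obtain m0 d where "m0 \<in> M" "m = m0 + d" unfolding eq multiples_def by blast
      moreover from this have "m0 \<in> L" unfolding eq multiples_def using M(1) by (auto intro!: exI[of _ 0])
      ultimately show "\<exists>m0\<in>L. squarefree_monom m0 \<and> (\<exists>d. m = m0 + d)" using M(2) by blast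
    qed
  next
    assume r: ?r
    let ?M = "{m \<in> L. squarefree_monom m}"
    have M: "?M \<subseteq> monoms_in A" using L by blast
    have "multiples A ?M = L"
    proof
      show "multiples A ?M \<subseteq> L" using up by (auto simp: multiples_def)
      show "L \<subseteq> multiples A ?M" using r L unfolding multiples_def by blast
    qed
    then show ?l
      unfolding squarefree_generated_def genideal_monomials[OF L] LL
      by (intro exI[of _ ?M]) (simp add: genideal_monomials[OF M] M)
  qed
qed

section \<open>Monomials as multisets\<close>

definition mono_of :: "'a multiset \<Rightarrow> ('a \<Rightarrow>\<^sub>0 nat)" where
  "mono_of M = (\<Sum>a\<in>#M. Poly_Mapping.single a 1)"

lemma mono_of_simps [simp]:
  "mono_of {#} = 0" "mono_of (add_mset a M) = Poly_Mapping.single a 1 + mono_of M"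
  "mono_of (M + N) = mono_of M + mono_of N"
  by (simp_all add: mono_of_def)

lemma lookup_mono_of [simp]: "Poly_Mapping.lookup (mono_of M) a = count M a"
  by (induction M) (auto simp: lookup_add lookup_single when_def)

lemma keys_mono_of [simp]: "Poly_Mapping.keys (mono_of M) = set_mset M"
  by (auto simp: in_keys_iff not_in_iff[symmetric] count_inI)

lemma mono_of_eq_iff [simp]: "mono_of M = mono_of N \<longleftrightarrow> M = N"
  by (metis lookup_mono_of multiset_eqI)

lemma mono_of_surj: "\<exists>M. m = mono_of M"
proof -
  define M where "M = (\<Sum>a\<in>Poly_Mapping.keys m. replicate_mset (Poly_Mapping.lookup m a) a)"
  have "m = mono_of M"
    by (rule poly_mapping_eqI) (auto simp: M_def count_sum in_keys_iff)
  then show ?thesis by blast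
qed

lemma monoms_in_mono_of [simp]: "mono_of M \<in> monoms_in A \<longleftrightarrow> set_mset M \<subseteq> A"
  by (simp add: monoms_in_def)

lemma total_deg_mono_of [simp]: "total_deg (mono_of M) = size M"
  by (simp add: total_deg_def size_multiset_overloaded_eq)

lemma squarefree_mono_of [simp]: "squarefree_monom (mono_of M) \<longleftrightarrow> (\<forall>a. count M a \<le> 1)"
  by (simp add: squarefree_monom_def)

lemma mono_of_dvd_iff: "(\<exists>d. mono_of M = mono_of N + d) \<longleftrightarrow> N \<subseteq># M"
proof
  assume "\<exists>d. mono_of M = mono_of N + d"
  then obtain K where "mono_of M = mono_of (N + K)" using mono_of_surj by (metis mono_of_simps(3))
  then show "N \<subseteq># M" unfolding mono_of_eq_iff by simp
next
  assume "N \<subseteq># M"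
  then have "mono_of M = mono_of N + mono_of (M - N)"
    by (metis mono_of_simps(3) subset_mset.add_diff_inverse)
  then show "\<exists>d. mono_of M = mono_of N + d" by blast
qed

section \<open>The toric ideal\<close>

definition weight :: "(int^'n::finite) multiset \<Rightarrow> (int^'n) \<times> nat" where
  "weight M = (\<Sum>a\<in>#M. (a, 1))"

lemma weight_simps [simp]:
  "weight {#} = 0" "weight (add_mset a M) = (a, 1) + weight M" "weight (M + N) = weight M + weight N"
  by (simp_all add: weight_def)

lemma prod_mset_single:
  "(\<Prod>a\<in>#M. Poly_Mapping.single (a, 1) (1 :: 'k::field)) = Poly_Mapping.single (weight M) 1"
  by (induction M) (simp_all add: mult_single del: weight_simps(3))

definition term_weight :: "(int^'n::finite \<Rightarrow>\<^sub>0 nat) \<Rightarrow> (int^'n) \<times> nat" where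
  "term_weight m = weight (THE M. m = mono_of M)"

lemma term_weight_mono_of [simp]: "term_weight (mono_of M) = weight M"
  by (simp add: term_weight_def)

lemma toric_hom_term:
  "(\<Prod>a\<in>Poly_Mapping.keys m. Poly_Mapping.single (a, 1) (1 :: 'k::field) ^ Poly_Mapping.lookup m a) =
    Poly_Mapping.single (term_weight m) 1"
proof -
  obtain M where m: "m = mono_of M" using mono_of_surj by blast
  show ?thesis
    unfolding m keys_mono_of lookup_mono_of term_weight_mono_of
    by (simp only: image_prod_mset_multiplicity[symmetric] prod_mset_single)
qed

lemma lookup_toric_hom:
  fixes p :: "(int^'n::finite \<Rightarrow>\<^sub>0 nat) \<Rightarrow>\<^sub>0 'k::field"
  shows "Poly_Mapping.lookup (toric_hom p) w =
    (\<Sum>m\<in>{m \<in> Poly_Mapping.keys p. term_weight m = w}. Poly_Mapping.lookup p m)"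
proof -
  have "toric_hom p = (\<Sum>m\<in>Poly_Mapping.keys p. Poly_Mapping.single (term_weight m) (Poly_Mapping.lookup p m))"
    unfolding toric_hom_def toric_hom_term by (simp add: mult_single)
  then have "Poly_Mapping.lookup (toric_hom p) w =
    (\<Sum>m\<in>Poly_Mapping.keys p. if term_weight m = w then Poly_Mapping.lookup p m else 0)"
    by (simp add: lookup_sum lookup_single when_def)
  then show ?thesis by (simp add: sum.inter_filter)
qed

lemma toric_ideal_iff:
  "p \<in> toric_ideal P \<longleftrightarrow> Poly_Mapping.keys p \<subseteq> monoms_in (lattice_points P) \<and>
    (\<forall>w. (\<Sum>m\<in>{m \<in> Poly_Mapping.keys p. term_weight m = w}. Poly_Mapping.lookup p m) = 0)"
  unfolding toric_ideal_def by (auto simp: lookup_toric_hom[symmetric] intro: poly_mapping_eqI)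

text \<open>The coefficients of a member of the toric ideal sum to zero over each fiber, so its
  leading monomial shares its fiber with another, smaller one. Conversely, the difference of two
  monomials of a fiber lies in the ideal.\<close>

lemma lead_monoms_toric_ideal:
  assumes irrefl: "\<And>m. \<not> lt m m"
  shows "{monomial m | m p. p \<in> (toric_ideal P :: ((int^'n::finite \<Rightarrow>\<^sub>0 nat) \<Rightarrow>\<^sub>0 'k::field) set) \<and> is_lead_monom lt p m} =
    monomial ` {m \<in> monoms_in (lattice_points P). \<exists>m'\<in>monoms_in (lattice_points P).
      term_weight m' = term_weight m \<and> lt m' m}" (is "?l = monomial ` ?L")
proof -
  have "(\<exists>p \<in> (toric_ideal P :: ((int^'n \<Rightarrow>\<^sub>0 nat) \<Rightarrow>\<^sub>0 'k) set). is_lead_monom lt p m) \<longleftrightarrow> m \<in> ?L" for m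
  proof
    assume "\<exists>p \<in> (toric_ideal P :: ((int^'n \<Rightarrow>\<^sub>0 nat) \<Rightarrow>\<^sub>0 'k) set). is_lead_monom lt p m"
    then obtain p :: "(int^'n \<Rightarrow>\<^sub>0 nat) \<Rightarrow>\<^sub>0 'k" where p: "p \<in> toric_ideal P" "is_lead_monom lt p m" by blast
    let ?K = "{m' \<in> Poly_Mapping.keys p. term_weight m' = term_weight m}"
    have mK: "m \<in> Poly_Mapping.keys p" using p(2) by (simp add: is_lead_monom_def)
    have "\<exists>m'\<in>?K. m' \<noteq> m"
    proof (rule ccontr)
      assume "\<not> (\<exists>m'\<in>?K. m' \<noteq> m)"
      then have "?K = {m}" using mK by blast
      then have 1: "(\<Sum>m'\<in>?K. Poly_Mapping.lookup p m') = Poly_Mapping.lookup p m" by simp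
      have 2: "(\<Sum>m'\<in>?K. Poly_Mapping.lookup p m') = 0"
        using p(1) unfolding toric_ideal_iff by blast
      have "Poly_Mapping.lookup p m = 0" by (rule trans[OF 1[symmetric] 2])
      then show False using mK by (simp add: in_keys_iff)
    qed
    then obtain m' where "m' \<in> Poly_Mapping.keys p" "term_weight m' = term_weight m" "m' \<noteq> m" by blast
    then show "m \<in> ?L" using p mK unfolding toric_ideal_iff is_lead_monom_def by blast
  next
    assume "m \<in> ?L"
    then obtain m' where m: "m \<in> monoms_in (lattice_points P)" "m' \<in> monoms_in (lattice_points P)"
      "term_weight m' = term_weight m" "lt m' m" by blast
    have ne: "m' \<noteq> m" using m(4) irrefl by blast
    let ?p = "Poly_Mapping.single m 1 - Poly_Mapping.single m' (1 :: 'k)"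
    have look: "Poly_Mapping.lookup ?p k = (if k = m then 1 else if k = m' then - 1 else 0)" for k
      using ne by (auto simp: lookup_minus lookup_single when_def)
    have keys: "Poly_Mapping.keys ?p = {m, m'}" using look by (auto simp: in_keys_iff split: if_splits)
    have "?p \<in> toric_ideal P"
      unfolding toric_ideal_iff keys
    proof (intro conjI allI)
      show "{m, m'} \<subseteq> monoms_in (lattice_points P)" using m by simp
      fix w
      have "{k \<in> {m, m'}. term_weight k = w} = (if term_weight m = w then {m, m'} else {})"
        using m(3) by auto
      then show "(\<Sum>k\<in>{k \<in> {m, m'}. term_weight k = w}. Poly_Mapping.lookup ?p k) = 0"
        using ne by (simp add: look)
    qed
    moreover have "is_lead_monom lt ?p m" unfolding is_lead_monom_def keys using m(4) by simp
    ultimately show "\<exists>p \<in> (toric_ideal P :: ((int^'n \<Rightarrow>\<^sub>0 nat) \<Rightarrow>\<^sub>0 'k) set). is_lead_monom lt p m" by blast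
  qed
  then show ?thesis by blast
qed

section \<open>Lattice points and reverse lexicographic orders\<close>

definition ind :: "'n::finite set \<Rightarrow> int^'n" where
  "ind S = (\<chi> i. of_bool (i \<in> S))"

definition ones :: "int^'n::finite \<Rightarrow> 'n set" where
  "ones a = {i. a $ i = 1}"

lemma ones_ind [simp]: "ones (ind S) = S"
  by (auto simp: ones_def ind_def)

lemma inj_ind: "inj ind"
  by (metis injI ones_ind)

lemma rho_nth: "rho S $ j = of_bool (j \<in> S)"
  by (simp add: rho_def axis_def of_bool_def)

lemma vec_of_int_ind: "vec_of_int (ind S) = rho S"
  by (simp add: vec_eq_iff vec_of_int_def ind_def rho_nth)

text \<open>Lattice points of a polytope in the unit cube are 0/1 vectors, and these are vertices of
  the cube. So one of them lies in a convex hull of others only if it is among them.\<close>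

lemma lattice_points_pms_polytope:
  fixes G :: "'n::finite sgraph"
  shows "lattice_points (pms_polytope G) = ind ` matchable_sets G"
proof
  let ?W = "matchable_sets G"
  show "ind ` ?W \<subseteq> lattice_points (pms_polytope G)"
    by (auto simp: lattice_points_def pms_polytope_def vec_of_int_ind intro: hull_inc)
  show "lattice_points (pms_polytope G) \<subseteq> ind ` ?W"
  proof
    fix a assume "a \<in> lattice_points (pms_polytope G)"
    then have a: "vec_of_int a \<in> convex hull (rho ` ?W)" by (simp add: lattice_points_def pms_polytope_def)
    have "rho ` ?W \<subseteq> {x. \<forall>i. 0 \<le> x $ i \<and> x $ i \<le> 1}" by (auto simp: rho_nth)
    moreover have "convex {x :: real^'n. \<forall>i. 0 \<le> x $ i \<and> x $ i \<le> 1}"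
    proof (rule convex_box_cart)
      have "{y :: real. 0 \<le> y \<and> y \<le> 1} = {0..1}" by auto
      then show "convex {y :: real. 0 \<le> y \<and> y \<le> 1}" by simp
    qed
    ultimately have "convex hull (rho ` ?W) \<subseteq> {x. \<forall>i. 0 \<le> x $ i \<and> x $ i \<le> 1}" by (rule hull_minimal)
    then have "0 \<le> a $ i \<and> a $ i \<le> 1" for i using a by (auto simp: vec_of_int_def)
    then have a01: "a $ i = 0 \<or> a $ i = 1" for i by (metis int_one_le_iff_zero_less order_antisym_conv linorder_not_less zle_iff_zadd)
    define S where "S = ones a"
    have aS: "a = ind S" using a01 by (auto simp: vec_eq_iff ind_def S_def ones_def)
    \<comment> \<open>This functional attains its maximum over the cube, the cardinality of
      \<open>S\<close>, at the indicator vector of \<open>S\<close> only, and drops by at least 1 at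
      all other indicator vectors.\<close>
    define c :: "real^'n" where "c = (\<chi> i. if i \<in> S then 1 else - 1)"
    have c: "c \<bullet> rho T = real (card (T \<inter> S)) - real (card (T - S))" for T
    proof -
      have "c \<bullet> rho T = (\<Sum>i\<in>UNIV. if i \<in> T then c $ i else 0)"
        by (simp add: inner_vec_def rho_nth of_bool_def if_distrib cong: if_cong)
      also have "\<dots> = (\<Sum>i\<in>T. c $ i)" by (simp add: sum.If_cases)
      also have "\<dots> = (\<Sum>i\<in>T \<inter> S. c $ i) + (\<Sum>i\<in>T - S. c $ i)"
        by (subst sum.union_disjoint[symmetric]) (auto intro: sum.cong)
      also have "\<dots> = real (card (T \<inter> S)) - real (card (T - S))"
        by (simp add: c_def)
      finally show ?thesis .
    qed
    have "S \<in> ?W"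
    proof (rule ccontr)
      assume S: "S \<notin> ?W"
      have "c \<bullet> rho T \<le> real (card S) - 1" if "T \<in> ?W" for T
      proof -
        have "T \<noteq> S" using that S by blast
        have le: "card (T \<inter> S) \<le> card S" by (intro card_mono) auto
        show ?thesis
        proof (cases "T - S = {}")
          case True
          then have "T \<subset> S" using \<open>T \<noteq> S\<close> by blast
          then have "card (T \<inter> S) < card S" by (intro psubset_card_mono) auto
          then show ?thesis unfolding c by simp
        next
          case False
          then have "card (T - S) \<ge> 1" by (simp add: Suc_le_eq card_gt_0_iff)
          then show ?thesis unfolding c using le by linarith
        qed
      qed
      then have "rho ` ?W \<subseteq> {x. c \<bullet> x \<le> real (card S) - 1}" by auto
      then have "convex hull (rho ` ?W) \<subseteq> {x. c \<bullet> x \<le> real (card S) - 1}"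
        by (rule hull_minimal) (rule convex_halfspace_le)
      then have "c \<bullet> rho S \<le> real (card S) - 1" using a unfolding aS vec_of_int_ind by auto
      then show False unfolding c by simp
    qed
    then show "a \<in> ind ` ?W" using aS by simp
  qed
qed

lemma lattice_polytope_pms_polytope:
  fixes G :: "'n::finite sgraph"
  shows "lattice_polytope (pms_polytope G)"
proof -
  have "polytope (pms_polytope G)" unfolding polytope_def pms_polytope_def by (intro exI[of _ "rho ` matchable_sets G"]) simp
  moreover have "v \<in> range vec_of_int" if "v extreme_point_of pms_polytope G" for v
  proof -
    have "v \<in> rho ` matchable_sets G"
      using extreme_point_of_convex_hull that unfolding pms_polytope_def by blast
    then show ?thesis using vec_of_int_ind by (metis imageE rangeI)
  qed
  ultimately show ?thesis by (simp add: lattice_polytope_def)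
qed

lemma weight_image_ind: "weight (image_mset ind M) = (\<chi> i. int (deg M i), size M)"
  by (induction M) (auto simp: vec_eq_iff ind_def zero_prod_def)

lemma weight_eq_iff: "weight (image_mset ind M) = weight (image_mset ind N) \<longleftrightarrow> same_fiber M N"
  by (auto simp: weight_image_ind same_fiber_def vec_eq_iff)

lemma count_image_ind [simp]: "count (image_mset ind M) (ind S) = count M S"
  by (induction M) (auto simp: inj_eq[OF inj_ind])

lemma multiset_over_image_ind:
  assumes "set_mset K \<subseteq> ind ` W"
  obtains M where "K = image_mset ind M" "set_mset M \<subseteq> W"
proof (rule that)
  have "ind (ones a) = a" if "a \<in># K" for a using that assms by auto
  then have "image_mset ind (image_mset ones K) = image_mset id K"
    unfolding multiset.map_comp by (intro image_mset_cong) simp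
  then show "K = image_mset ind (image_mset ones K)" by simp
  show "set_mset (image_mset ones K) \<subseteq> W" using assms by auto
qed

lemma revlex_irrefl: "\<not> revlex_less ys m m"
  by (auto simp: revlex_less_def)

lemma revlex_mono_of:
  "revlex_less ys (mono_of M) (mono_of N) \<longleftrightarrow> size M < size N \<or> (size M = size N \<and>
    (\<exists>i<length ys. count M (ys ! i) > count N (ys ! i) \<and>
      (\<forall>j<length ys. i < j \<longrightarrow> count M (ys ! j) = count N (ys ! j))))"
  by (simp add: revlex_less_def)

text \<open>Members of a fiber have equal size, so only the tie-breaking part of the reverse
  lexicographic order remains.\<close>

definition less_in_fiber :: "'a set list \<Rightarrow> 'a set multiset \<Rightarrow> 'a set multiset \<Rightarrow> bool" where
  "less_in_fiber ss M N \<longleftrightarrow> same_fiber M N \<and>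
    (\<exists>i<length ss. count M (ss ! i) > count N (ss ! i) \<and>
      (\<forall>j<length ss. i < j \<longrightarrow> count M (ss ! j) = count N (ss ! j)))"

text \<open>Carries the question over to multisets of matchable sets: a nonstandard monomial is one
  with a smaller element in its fiber. The right-hand side no longer depends on the field.\<close>

lemma initial_ideal_squarefree_iff:
  fixes P :: "(real^'n::finite) set"
  assumes P: "lattice_points P = ind ` W"
  shows "squarefree_generated (lattice_points P) (initial_ideal (lattice_points P) (revlex_less (map ind ss))
      (toric_ideal P :: ((int^'n \<Rightarrow>\<^sub>0 nat) \<Rightarrow>\<^sub>0 'k::field) set)) \<longleftrightarrow>
    (\<forall>M M'. set_mset M \<subseteq> W \<longrightarrow> set_mset M' \<subseteq> W \<longrightarrow> less_in_fiber ss M' M \<longrightarrow>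
      (\<exists>D D'. D \<subseteq># M \<and> (\<forall>S. count D S \<le> 1) \<and> set_mset D' \<subseteq> W \<and> less_in_fiber ss D' D))"
proof -
  let ?A = "lattice_points P" and ?lt = "revlex_less (map ind ss) :: (int^'n \<Rightarrow>\<^sub>0 nat) \<Rightarrow> _"
  let ?L = "{m \<in> monoms_in ?A. \<exists>m'\<in>monoms_in ?A. term_weight m' = term_weight m \<and> ?lt m' m}"
  have lt: "?lt (mono_of (image_mset ind M')) (mono_of (image_mset ind M)) \<longleftrightarrow>
      (\<exists>i<length ss. count M' (ss ! i) > count M (ss ! i) \<and>
        (\<forall>j<length ss. i < j \<longrightarrow> count M' (ss ! j) = count M (ss ! j)))" if "size M' = size M" for M M'
    using that by (auto simp: revlex_mono_of)
  have mono: "mono_of (image_mset ind M) \<in> ?L \<longleftrightarrow>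
      set_mset M \<subseteq> W \<and> (\<exists>M'. set_mset M' \<subseteq> W \<and> less_in_fiber ss M' M)" for M
  proof -
    have over: "mono_of (image_mset ind M) \<in> monoms_in ?A \<longleftrightarrow> set_mset M \<subseteq> W" for M
      by (simp add: P inj_image_subset_iff[OF inj_ind])
    have ex: "(\<exists>m'\<in>monoms_in ?A. Q m') \<longleftrightarrow> (\<exists>M'. set_mset M' \<subseteq> W \<and> Q (mono_of (image_mset ind M')))" for Q
    proof
      assume "\<exists>m'\<in>monoms_in ?A. Q m'"
      then obtain m' where m': "m' \<in> monoms_in ?A" "Q m'" by blast
      obtain K where K: "m' = mono_of K" using mono_of_surj by blast
      then have "set_mset K \<subseteq> ind ` W" using m'(1) P by simp
      then obtain M' where "K = image_mset ind M'" "set_mset M' \<subseteq> W" by (rule multiset_over_image_ind)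
      then show "\<exists>M'. set_mset M' \<subseteq> W \<and> Q (mono_of (image_mset ind M'))" using K m'(2) by blast
    next
      assume "\<exists>M'. set_mset M' \<subseteq> W \<and> Q (mono_of (image_mset ind M'))"
      then show "\<exists>m'\<in>monoms_in ?A. Q m'" using over by blast
    qed
    have "less_in_fiber ss M' M \<longleftrightarrow> term_weight (mono_of (image_mset ind M')) = term_weight (mono_of (image_mset ind M)) \<and>
        ?lt (mono_of (image_mset ind M')) (mono_of (image_mset ind M))" for M'
      unfolding term_weight_mono_of weight_eq_iff less_in_fiber_def
      using lt[of M' M] by (auto simp only: same_fiber_def)
    then show ?thesis unfolding mem_Collect_eq ex over by blast
  qed
  have up: "m + d \<in> ?L" if m: "m \<in> ?L" and d: "d \<in> monoms_in ?A" for m d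
  proof -
    obtain M K where MK: "m = mono_of M" "d = mono_of K" using mono_of_surj by metis
    have "set_mset M \<subseteq> ind ` W" "set_mset K \<subseteq> ind ` W" using m d MK P by auto
    then obtain M1 K1 where M1: "M = image_mset ind M1" "K = image_mset ind K1" "set_mset K1 \<subseteq> W"
      by (metis multiset_over_image_ind)
    then have "mono_of (image_mset ind M1) \<in> ?L" using m MK by simp
    then obtain M' where M': "set_mset M1 \<subseteq> W" "set_mset M' \<subseteq> W" "less_in_fiber ss M' M1" unfolding mono by blast
    then have "less_in_fiber ss (M' + K1) (M1 + K1)" by (simp add: less_in_fiber_def)
    then have "mono_of (image_mset ind (M1 + K1)) \<in> ?L"
      unfolding mono using M' M1(3) by (intro conjI exI[of _ "M' + K1"]) auto
    then show ?thesis unfolding MK M1 by simp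
  qed
  have sub: "?L \<subseteq> monoms_in ?A" by blast
  have "squarefree_generated ?A (initial_ideal ?A ?lt (toric_ideal P :: ((int^'n \<Rightarrow>\<^sub>0 nat) \<Rightarrow>\<^sub>0 'k) set)) \<longleftrightarrow>
    (\<forall>m\<in>?L. \<exists>m0\<in>?L. squarefree_monom m0 \<and> (\<exists>d. m = m0 + d))"
    unfolding initial_ideal_def lead_monoms_toric_ideal[OF revlex_irrefl]
    by (rule squarefree_generated_iff[OF sub up])
  also have "\<dots> \<longleftrightarrow> (\<forall>M M'. set_mset M \<subseteq> W \<longrightarrow> set_mset M' \<subseteq> W \<longrightarrow> less_in_fiber ss M' M \<longrightarrow>
      (\<exists>D D'. D \<subseteq># M \<and> (\<forall>S. count D S \<le> 1) \<and> set_mset D' \<subseteq> W \<and> less_in_fiber ss D' D))"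
    (is "?l \<longleftrightarrow> ?r")
  proof
    assume l: ?l
    show ?r
    proof (intro allI impI)
      fix M M' assume M: "set_mset M \<subseteq> W" "set_mset M' \<subseteq> W" "less_in_fiber ss M' M"
      then have "mono_of (image_mset ind M) \<in> ?L" unfolding mono by blast
      then obtain m0 d where m0: "m0 \<in> ?L" "squarefree_monom m0" "mono_of (image_mset ind M) = m0 + d"
        using l by blast
      obtain K where K: "m0 = mono_of K" using mono_of_surj by blast
      have "set_mset K \<subseteq> ind ` W" using m0(1) K P by simp
      then obtain D where D: "K = image_mset ind D" "set_mset D \<subseteq> W" by (rule multiset_over_image_ind)
      have "image_mset ind D \<subseteq># image_mset ind M"
        using m0(3) unfolding K D(1) by (subst mono_of_dvd_iff[symmetric]) blast
      then have "count D S \<le> count M S" for S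
        using mset_subset_eq_count[of "image_mset ind D" "image_mset ind M" "ind S"] by simp
      then have "D \<subseteq># M" by (simp add: subseteq_mset_def)
      moreover have "count D S \<le> 1" for S
        using m0(2) unfolding K D(1) squarefree_mono_of by (metis count_image_ind)
      moreover obtain D' where "set_mset D' \<subseteq> W" "less_in_fiber ss D' D"
        using m0(1) unfolding K D(1) mono by blast
      ultimately show "\<exists>D D'. D \<subseteq># M \<and> (\<forall>S. count D S \<le> 1) \<and> set_mset D' \<subseteq> W \<and> less_in_fiber ss D' D"
        by blast
    qed
  next
    assume r: ?r
    show ?l
    proof
      fix m assume m: "m \<in> ?L"
      obtain K where K: "m = mono_of K" using mono_of_surj by blast
      have "set_mset K \<subseteq> ind ` W" using m K P by simp
      then obtain M where M: "K = image_mset ind M" "set_mset M \<subseteq> W" by (rule multiset_over_image_ind)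
      obtain M' where "set_mset M' \<subseteq> W" "less_in_fiber ss M' M" using m unfolding K M(1) mono by blast
      then obtain D D' where D: "D \<subseteq># M" "\<forall>S. count D S \<le> 1" "set_mset D' \<subseteq> W" "less_in_fiber ss D' D"
        using r M(2) by blast
      have DW: "set_mset D \<subseteq> W" using D(1) M(2) set_mset_mono by blast
      have "mono_of (image_mset ind D) \<in> ?L" unfolding mono using D DW by blast
      moreover have "squarefree_monom (mono_of (image_mset ind D))"
        unfolding squarefree_mono_of
      proof
        fix a show "count (image_mset ind D) a \<le> 1"
        proof (cases "a \<in># image_mset ind D")
          case True
          then obtain S where "a = ind S" by auto
          then show ?thesis using D(2) by simp
        next
          case False
          then show ?thesis by (metis not_in_iff zero_le)
        qed
      qed
      moreover have "\<exists>d. m = mono_of (image_mset ind D) + d"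
        unfolding K M(1) mono_of_dvd_iff by (rule image_mset_subseteq_mono[OF D(1)])
      ultimately show "\<exists>m0\<in>?L. squarefree_monom m0 \<and> (\<exists>d. m = m0 + d)" by blast
    qed
  qed
  finally show ?thesis .
qed

text \<open>For a nonstandard \<open>M\<close>, the support of what remains after cancelling a
  smaller \<open>M'\<close> is a squarefree divisor. The exchange property puts into its fiber a
  multiset using the last variable in which \<open>M\<close> and \<open>M'\<close> differ, and this
  is smaller.\<close>

lemma compressed_if_exchange:
  fixes G :: "'n::finite sgraph"
  assumes ex: "exchange_property (matchable_sets G)"
  shows "compressed TYPE('k::field) (pms_polytope G)"
  unfolding compressed_def
proof (intro conjI allI impI lattice_polytope_pms_polytope, elim conjE)
  let ?W = "matchable_sets G"
  note P = lattice_points_pms_polytope[of G]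
  fix ys assume ys: "distinct ys" "set ys = lattice_points (pms_polytope G)"
  define ss where "ss = map ones ys"
  have "ind (ones y) = y" if "y \<in> set ys" for y
    using that ys(2) P by auto
  then have ys_ss: "ys = map ind ss" unfolding ss_def by (simp add: map_idI)
  then have "ind ` set ss = ind ` ?W" using ys(2) P by simp
  then have ss: "set ss = ?W" by (simp only: inj_image_eq_iff[OF inj_ind])
  show "squarefree_generated (lattice_points (pms_polytope G))
      (initial_ideal (lattice_points (pms_polytope G)) (revlex_less ys)
        (toric_ideal (pms_polytope G) :: ((int^'n \<Rightarrow>\<^sub>0 nat) \<Rightarrow>\<^sub>0 'k) set))"
    unfolding ys_ss initial_ideal_squarefree_iff[OF P]
  proof (intro allI impI)
    fix M M' assume M: "set_mset M \<subseteq> ?W" "set_mset M' \<subseteq> ?W" "less_in_fiber ss M' M"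
    obtain i where i: "i < length ss" "count M' (ss ! i) > count M (ss ! i)"
      "\<And>j. j < length ss \<Longrightarrow> i < j \<Longrightarrow> count M' (ss ! j) = count M (ss ! j)"
      and MM: "same_fiber M' M" using M(3) unfolding less_in_fiber_def by blast
    let ?T = "ss ! i"
    define U where "U = M - M'"
    define U' where "U' = M' - M"
    have eq: "M = U + (M \<inter># M')" "M' = U' + (M \<inter># M')"
      unfolding U_def U'_def by (rule multiset_eqI; simp)+
    have "same_fiber U U'"
      using same_fiber_sym[OF MM] same_fiber_add_cancel[of U "M \<inter># M'" U'] eq by simp
    moreover have "?T \<in># U'" using i(2) by (simp add: U'_def in_diff_count)
    then have U': "U' = add_mset ?T (U' - {#?T#})" by simp
    ultimately have UU: "same_fiber U (add_mset ?T (U' - {#?T#}))" by simp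
    let ?D = "mset_set (set_mset U)"
    have sub: "set_mset U \<subseteq> ?W" "set_mset (U' - {#?T#}) \<subseteq> ?W" "?T \<in> ?W"
      using M(1,2) ss i(1) by (auto simp: U_def U'_def dest!: in_diffD)
    have "set_mset ?D = set_mset U" by simp
    from exchange_propertyD[OF ex sub(3,1,2) UU this]
    obtain N where N: "set_mset N \<subseteq> ?W" "same_fiber ?D (add_mset ?T N)" by blast
    let ?D' = "add_mset ?T N"
    \<comment> \<open>From position \<open>i\<close> on, \<open>M'\<close> has at least the
      multiplicities of \<open>M\<close>, so none of these sets survives in
      \<open>U\<close>.\<close>
    have zero: "count ?D (ss ! j) = 0" if "j < length ss" "i \<le> j" for j
    proof -
      have "count M (ss ! j) \<le> count M' (ss ! j)" using i(2,3) that by (cases "j = i") auto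
      then have "ss ! j \<notin># U" by (simp add: U_def in_diff_count)
      then show ?thesis by simp
    qed
    \<comment> \<open>The exchange may introduce sets even later than \<open>?T\<close>. The
      comparison is therefore made at the last position in use; \<open>?T\<close> shows that there
      is one from \<open>i\<close> on.\<close>
    define J where "J = {j. j < length ss \<and> i \<le> j \<and> ss ! j \<in># ?D'}"
    have J: "finite J" "i \<in> J" using i(1) by (auto simp: J_def)
    define k where "k = Max J"
    have k: "k \<in> J" "\<And>j. j \<in> J \<Longrightarrow> j \<le> k" using J Max_in[OF J(1)] Max_ge[OF J(1)] by (auto simp: k_def simp del: Max_in)
    have "less_in_fiber ss ?D' ?D"
      unfolding less_in_fiber_def
    proof (intro conjI exI[of _ k] allI impI)
      show "same_fiber ?D' ?D" by (rule same_fiber_sym[OF N(2)])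
      show "k < length ss" using k(1) by (simp add: J_def)
      have "count ?D (ss ! k) = 0" "count ?D' (ss ! k) > 0" using k(1) zero by (auto simp: J_def)
      then show "count ?D (ss ! k) < count ?D' (ss ! k)" by linarith
      fix j assume j: "j < length ss" "k < j"
      have "i \<le> j" using k(1) j(2) by (simp add: J_def)
      moreover have "j \<notin> J" using k(2)[of j] j(2) by auto
      ultimately have "count ?D' (ss ! j) = 0" using j(1) unfolding J_def not_in_iff[symmetric] by blast
      then show "count ?D' (ss ! j) = count ?D (ss ! j)" using zero[OF j(1) \<open>i \<le> j\<close>] by simp
    qed
    moreover have "?D \<subseteq># M"
      unfolding subseteq_mset_def
    proof
      fix S show "count ?D S \<le> count M S"
        by (cases "S \<in># U") (auto simp: U_def Suc_le_eq dest!: in_diffD)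
    qed
    moreover have "\<forall>S. count ?D S \<le> 1" by (simp add: count_mset_set')
    moreover have "set_mset ?D' \<subseteq> ?W" using N(1) sub(3) by simp
    ultimately show "\<exists>D D'. D \<subseteq># M \<and> (\<forall>S. count D S \<le> 1) \<and> set_mset D' \<subseteq> ?W \<and> less_in_fiber ss D' D"
      by blast
  qed
qed

lemma unobstructed_if_compressed:
  fixes G :: "'n::finite sgraph"
  assumes comp: "compressed TYPE('k::field) (pms_polytope G)"
  shows "\<not> obstructed (matchable_sets G)"
proof
  let ?W = "matchable_sets G"
  note P = lattice_points_pms_polytope[of G]
  assume "obstructed ?W"
  then obtain D A T M N where *: "A \<in> D \<and> T \<in> ?W \<and> T \<noteq> A \<and> set_mset M = D \<and> D \<subseteq> ?W \<and>
     set_mset N \<subseteq> ?W \<and> same_fiber M (add_mset T N) \<and>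
     (\<forall>E. set_mset E \<subseteq> ?W \<and> same_fiber E (mset_set D) \<longrightarrow>
        T \<notin># E \<and> (A \<in># E \<longrightarrow> E = mset_set D))"
    unfolding obstructed_def by (elim exE) (rule that)
  then have w: "A \<in> D" "T \<in> ?W" "T \<noteq> A" "set_mset M = D" "D \<subseteq> ?W"
     "set_mset N \<subseteq> ?W" "same_fiber M (add_mset T N)" by simp_all
  have E: "T \<notin># E" "A \<in># E \<Longrightarrow> E = mset_set D"
    if "set_mset E \<subseteq> ?W" "same_fiber E (mset_set D)" for E
    using * that by simp_all
  have fin: "finite D" using w(4) by auto
  have TD: "T \<notin> D" using E(1)[of "mset_set D"] w(5) fin by simp
  obtain zs where zs: "set zs = ?W - {A, T}" "distinct zs" using finite_distinct_list[of "?W - {A, T}"] by auto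
  define ss where "ss = zs @ [A, T]"
  have ss: "distinct ss" "set ss = ?W" using zs w by (auto simp: ss_def)
  have "distinct (map ind ss)" "set (map ind ss) = lattice_points (pms_polytope G)"
    using ss P inj_on_subset[OF inj_ind] by (auto simp: distinct_map)
  then have sq: "squarefree_generated (lattice_points (pms_polytope G))
      (initial_ideal (lattice_points (pms_polytope G)) (revlex_less (map ind ss))
        (toric_ideal (pms_polytope G) :: ((int^'n \<Rightarrow>\<^sub>0 nat) \<Rightarrow>\<^sub>0 'k) set))"
    using comp unfolding compressed_def by blast
  have len: "length ss = length zs + 2" "ss ! length zs = A" "ss ! (length zs + 1) = T"
    by (simp_all add: ss_def nth_append)
  have "less_in_fiber ss (add_mset T N) M"
    unfolding less_in_fiber_def
  proof (intro conjI exI[of _ "length zs + 1"] allI impI)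
    show "same_fiber (add_mset T N) M" by (rule same_fiber_sym[OF w(7)])
    have "count M T = 0" using TD w(4) by (metis not_in_iff)
    then show "count M (ss ! (length zs + 1)) < count (add_mset T N) (ss ! (length zs + 1))"
      unfolding len by simp
  qed (simp_all add: len)
  moreover have "set_mset M \<subseteq> ?W" "set_mset (add_mset T N) \<subseteq> ?W" using w by auto
  ultimately obtain K K' where K: "K \<subseteq># M" "\<And>S. count K S \<le> 1" "set_mset K' \<subseteq> ?W" "less_in_fiber ss K' K"
    using sq unfolding initial_ideal_squarefree_iff[OF P] by blast
  have "K \<subseteq># mset_set D"
    unfolding subseteq_mset_def
  proof
    fix S
    have "S \<in> D" if "S \<in># K" using that K(1) w(4) mset_subset_eqD by metis
    then show "count K S \<le> count (mset_set D) S"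
      using K(2)[of S] fin by (cases "S \<in># K") (auto simp: not_in_iff)
  qed
  then have D_eq: "mset_set D = K + (mset_set D - K)" by simp
  \<comment> \<open>The squarefree divisor \<open>K\<close> of \<open>M\<close> is completed to the
    whole support, so that the assumption on the fiber of \<open>mset_set D\<close> applies.\<close>
  define E where "E = K' + (mset_set D - K)"
  have KK: "same_fiber K' K" using K(4) by (simp add: less_in_fiber_def)
  have "same_fiber E (K + (mset_set D - K))" unfolding E_def using KK by simp
  then have ED: "same_fiber E (mset_set D)" using D_eq by simp
  have "set_mset (mset_set D - K) \<subseteq> D" using fin by (auto dest: in_diffD)
  then have EW: "set_mset E \<subseteq> ?W" using K(3) w(5) by (auto simp: E_def)
  note E = E[OF EW ED]
  have shift: "count E S + count K S = count K' S + count (mset_set D) S" for S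
    using arg_cong[OF D_eq, of "\<lambda>M. count M S"] by (simp add: E_def)
  obtain i where i: "i < length ss" "count K' (ss ! i) > count K (ss ! i)"
    "\<And>j. j < length ss \<Longrightarrow> i < j \<Longrightarrow> count K' (ss ! j) = count K (ss ! j)"
    using K(4) unfolding less_in_fiber_def by blast
  \<comment> \<open>\<open>E\<close> exceeds \<open>mset_set D\<close> at position \<open>i\<close>,
    hence differs from it and contains neither \<open>A\<close> nor \<open>T\<close>. As
    \<open>A\<close> lies in \<open>D\<close>, \<open>K'\<close> and \<open>K\<close> differ at
    \<open>A\<close>, so \<open>i\<close> is the position of \<open>A\<close> or \<open>T\<close>,
    where \<open>E\<close> has multiplicity zero: a contradiction.\<close>
  have gt: "count E (ss ! i) > count (mset_set D) (ss ! i)" using shift[of "ss ! i"] i(2) by linarith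
  then have "E \<noteq> mset_set D" by auto
  then have AE: "count E A = 0" using E(2) by (metis not_in_iff)
  have TE: "count E T = 0" using E(1) by (simp add: not_in_iff)
  have "count (mset_set D) A = 1" using w(1) fin by simp
  then have "count K' A \<noteq> count K A" using shift[of A] AE by linarith
  then have "\<not> i < length zs" using i(3)[of "length zs"] len by auto
  then have "i = length zs \<or> i = length zs + 1" using i(1) len by linarith
  then show False using gt AE TE len by auto
qed

theorem theorem1p1:
  fixes G :: "'n::finite sgraph"
  assumes "simple_graph G" and "verts G = UNIV" and "connected_graph G"
  shows "compressed TYPE('k::field) (pms_polytope G) \<longleftrightarrow>
    (\<exists>X. X \<subseteq> blocks G \<and> finite X \<and> card X \<le> 1 \<and>
       (\<forall>B \<in> blocks G - X. complete_bipartite B) \<and>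
       (\<forall>B \<in> X. is_complete 4 B \<or> (\<exists>n\<ge>1. is_complete_multipartite [1, 1, n] B)))"
proof
  assume "compressed TYPE('k) (pms_polytope G)"
  then have "\<not> obstructed (matchable_sets G)" by (rule unobstructed_if_compressed)
  with assms(1,3) show "\<exists>X. X \<subseteq> blocks G \<and> finite X \<and> card X \<le> 1 \<and>
       (\<forall>B \<in> blocks G - X. complete_bipartite B) \<and>
       (\<forall>B \<in> X. is_complete 4 B \<or> (\<exists>n\<ge>1. is_complete_multipartite [1, 1, n] B))"
    by (rule block_structure_if_unobstructed)
next
  assume "\<exists>X. X \<subseteq> blocks G \<and> finite X \<and> card X \<le> 1 \<and>
       (\<forall>B \<in> blocks G - X. complete_bipartite B) \<and>
       (\<forall>B \<in> X. is_complete 4 B \<or> (\<exists>n\<ge>1. is_complete_multipartite [1, 1, n] B))"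
  then obtain X where X: "finite X" "card X \<le> 1" "\<And>B. B \<in> blocks G - X \<Longrightarrow> complete_bipartite B"
    "\<And>B. B \<in> X \<Longrightarrow> is_complete 4 B \<or> (\<exists>n\<ge>1. is_complete_multipartite [1, 1, n] B)" by blast
  have "exchange_property (matchable_sets G)"
    using exchange_matchable[OF assms(1,3) X] by blast
  then show "compressed TYPE('k) (pms_polytope G)" by (rule compressed_if_exchange)
qed

end
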